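(* Let $\mathcal{A}$ be a rigid abelian $\otimes$-category, $\mathcal{I}$ a Serre $\otimes$-ideal of $\mathcal{A}$, $F:\mathcal{A}\to\mathcal{A}/\!\!/\mathcal{I}$ the exact localisation functor to the Serre quotient, and $Z(F):Z(\mathcal{A})\to Z(\mathcal{A}/\!\!/\mathcal{I})$ the induced ring homomorphism. Then the kernel of $Z(F)$ is equal to $I(\mathcal{I})$, and the induced functor $$Z(\mathcal{A})/I(\mathcal{I})\otimes_{Z(\mathcal{A})}\mathcal{A}\longrightarrow\mathcal{A}/\!\!/\mathcal{I}$$ is an equivalence of $\otimes$-categories; in particular, $F$ is full.
   Context: A $\otimes$-category is an additive symmetric monoidal category with unit $\mathbf{1}$ and biadditive tensor product; it is rigid if every object has a dual. A rigid abelian $\otimes$-category is a rigid $\otimes$-category whose underlying category is abelian. For a $\otimes$-category $\mathcal{C}$, $Z(\mathcal{C})=\operatorname{End}_{\mathcal{C}}(\mathbf{1})$, a commutative ring acting on all Hom groups. A Serre $\otimes$-ideal $\mathcal{I}$ of $\mathcal{A}$ is a Serre subcategory such that $A\otimes B\in\mathcal{I}$ for all $A\in\mathcal{A}$, $B\in\mathcal{I}$; the Serre quotient $\mathcal{A}/\!\!/\mathcal{I}$ then inherits the structure of a rigid abelian $\otimes$-category such that $F$ is an exact $\otimes$-functor. Every subobject $U$ of $\mathbf{1}$ has a unique complement $U^\perp$ with $\mathbf{1}=U\oplus U^\perp$; let $e(U)\in Z(\mathcal{A})$ be the idempotent with image $U$ and kernel $U^\perp$. For $A\in\mathcal{A}$,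 $\operatorname{Supp}(A)$ is the subobject $\operatorname{Ker}(\mathbf{1}\to A^\vee\otimes A)^\perp$ of $\mathbf{1}$, where $\mathbf{1}\to A^\vee\otimes A$ is the adjoint of $1_A$, and $e(A)=e(\operatorname{Supp}(A))$. $I(\mathcal{I})$ is the ideal of $Z(\mathcal{A})$ generated by the idempotents $e(A)$ for $A\in\mathcal{I}$. For an ideal $I$ of $Z(\mathcal{A})$, $Z(\mathcal{A})/I\otimes_{Z(\mathcal{A})}\mathcal{A}$ is the category with the same objects as $\mathcal{A}$ and with Hom groups $Z(\mathcal{A})/I\otimes_{Z(\mathcal{A})}\mathcal{A}(A,B)$. *)

theory Defs
  imports
    "HOL-Algebra.Generated_Groups"
    "HOL-Algebra.Free_Abelian_Groups"
    "HOL-Algebra.QuotRing"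
    "HOL-Algebra.Module"
begin

section \<open>Abelian categories\<close>

text \<open>
  Categories are records with a carrier set of objects and a carrier set of arrows; every arrow
  knows its domain and codomain. As in HOL-Algebra, nothing is assumed about values outside
  the carriers. Composition \<open>g \<cdot> f\<close> is ``\<open>g\<close> after \<open>f\<close>''.
\<close>

record ('o, 'm) cat =
  Ob :: "'o set"
  Ar :: "'m set"
  Dom :: "'m \<Rightarrow> 'o"
  Cod :: "'m \<Rightarrow> 'o"
  idt :: "'o \<Rightarrow> 'm"
  Cmp :: "['m, 'm] \<Rightarrow> 'm" (infixl \<open>\<cdot>\<index>\<close> 70)

definition homs :: "('o, 'm, 'z) cat_scheme \<Rightarrow> 'o \<Rightarrow> 'o \<Rightarrow> 'm set" where
  "homs C A B = {f \<in> Ar C. Dom C f = A \<and> Cod C f = B}"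

locale category =
  fixes C :: "('o, 'm, 'z) cat_scheme" (structure)
  assumes dom_closed: "f \<in> Ar C \<Longrightarrow> Dom C f \<in> Ob C"
    and cod_closed: "f \<in> Ar C \<Longrightarrow> Cod C f \<in> Ob C"
    and idt_closed: "A \<in> Ob C \<Longrightarrow> idt C A \<in> homs C A A"
    and cmp_closed: "f \<in> homs C A B \<Longrightarrow> g \<in> homs C B D \<Longrightarrow> g \<cdot> f \<in> homs C A D"
    and cmp_idt: "f \<in> homs C A B \<Longrightarrow> f \<cdot> idt C A = f"
    and idt_cmp: "f \<in> homs C A B \<Longrightarrow> idt C B \<cdot> f = f"
    and cmp_assoc: "f \<in> homs C A B \<Longrightarrow> g \<in> homs C B D \<Longrightarrow> h \<in> homs C D E \<Longrightarrow>
      (h \<cdot> g) \<cdot> f = h \<cdot> (g \<cdot> f)"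

definition is_inverse :: "('o, 'm, 'z) cat_scheme \<Rightarrow> 'm \<Rightarrow> 'm \<Rightarrow> bool" where
  "is_inverse C f g \<longleftrightarrow> f \<in> Ar C \<and> g \<in> homs C (Cod C f) (Dom C f) \<and>
     g \<cdot>\<^bsub>C\<^esub> f = idt C (Dom C f) \<and> f \<cdot>\<^bsub>C\<^esub> g = idt C (Cod C f)"

definition isos :: "('o, 'm, 'z) cat_scheme \<Rightarrow> 'o \<Rightarrow> 'o \<Rightarrow> 'm set" where
  "isos C A B = {f \<in> homs C A B. \<exists>g. is_inverse C f g}"

definition inv_ar :: "('o, 'm, 'z) cat_scheme \<Rightarrow> 'm \<Rightarrow> 'm" where
  "inv_ar C f = (THE g. is_inverse C f g)"

definition is_mono :: "('o, 'm, 'z) cat_scheme \<Rightarrow> 'm \<Rightarrow> bool" where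
  "is_mono C f \<longleftrightarrow> f \<in> Ar C \<and>
     (\<forall>X. \<forall>g \<in> homs C X (Dom C f). \<forall>h \<in> homs C X (Dom C f). f \<cdot>\<^bsub>C\<^esub> g = f \<cdot>\<^bsub>C\<^esub> h \<longrightarrow> g = h)"

definition is_epi :: "('o, 'm, 'z) cat_scheme \<Rightarrow> 'm \<Rightarrow> bool" where
  "is_epi C f \<longleftrightarrow> f \<in> Ar C \<and>
     (\<forall>X. \<forall>g \<in> homs C (Cod C f) X. \<forall>h \<in> homs C (Cod C f) X. g \<cdot>\<^bsub>C\<^esub> f = h \<cdot>\<^bsub>C\<^esub> f \<longrightarrow> g = h)"

definition is_zero_object :: "('o, 'm, 'z) cat_scheme \<Rightarrow> 'o \<Rightarrow> bool" where
  "is_zero_object C N \<longleftrightarrow> N \<in> Ob C \<and>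
     (\<forall>A \<in> Ob C. (\<exists>!f. f \<in> homs C N A) \<and> (\<exists>!f. f \<in> homs C A N))"

record ('o, 'm) add_cat = "('o, 'm) cat" +
  hzero :: "'o \<Rightarrow> 'o \<Rightarrow> 'm"
  hadd :: "'m \<Rightarrow> 'm \<Rightarrow> 'm"

text \<open>The group of arrows from \<open>A\<close> to \<open>B\<close> (addition of arrows is the group operation).\<close>

definition hom_group :: "('o, 'm, 'z) add_cat_scheme \<Rightarrow> 'o \<Rightarrow> 'o \<Rightarrow> 'm monoid" where
  "hom_group C A B = \<lparr>carrier = homs C A B, mult = hadd C, one = hzero C A B\<rparr>"

definition is_biproduct ::
    "('o, 'm, 'z) add_cat_scheme \<Rightarrow> 'o \<Rightarrow> 'o \<Rightarrow> 'o \<Rightarrow> 'm \<Rightarrow> 'm \<Rightarrow> 'm \<Rightarrow> 'm \<Rightarrow> bool" where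
  "is_biproduct C A B P i j p q \<longleftrightarrow> P \<in> Ob C \<and>
     i \<in> homs C A P \<and> j \<in> homs C B P \<and> p \<in> homs C P A \<and> q \<in> homs C P B \<and>
     p \<cdot>\<^bsub>C\<^esub> i = idt C A \<and> q \<cdot>\<^bsub>C\<^esub> j = idt C B \<and>
     p \<cdot>\<^bsub>C\<^esub> j = hzero C B A \<and> q \<cdot>\<^bsub>C\<^esub> i = hzero C A B \<and>
     hadd C (i \<cdot>\<^bsub>C\<^esub> p) (j \<cdot>\<^bsub>C\<^esub> q) = idt C P"

locale additive_category = category C for C :: "('o, 'm, 'z) add_cat_scheme" (structure) +
  assumes hom_comm_group: "A \<in> Ob C \<Longrightarrow> B \<in> Ob C \<Longrightarrow> comm_group (hom_group C A B)"
    and cmp_hadd: "f \<in> homs C A B \<Longrightarrow> f' \<in> homs C A B \<Longrightarrow> g \<in> homs C B D \<Longrightarrow>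
      g \<cdot> hadd C f f' = hadd C (g \<cdot> f) (g \<cdot> f')"
    and hadd_cmp: "f \<in> homs C A B \<Longrightarrow> g \<in> homs C B D \<Longrightarrow> g' \<in> homs C B D \<Longrightarrow>
      hadd C g g' \<cdot> f = hadd C (g \<cdot> f) (g' \<cdot> f)"
    and ex_zero_object: "\<exists>N. is_zero_object C N"
    and ex_biproduct: "A \<in> Ob C \<Longrightarrow> B \<in> Ob C \<Longrightarrow> \<exists>P i j p q. is_biproduct C A B P i j p q"

definition is_kernel :: "('o, 'm, 'z) add_cat_scheme \<Rightarrow> 'm \<Rightarrow> 'm \<Rightarrow> bool" where
  "is_kernel C f k \<longleftrightarrow> f \<in> Ar C \<and> k \<in> Ar C \<and> Cod C k = Dom C f \<and>
     f \<cdot>\<^bsub>C\<^esub> k = hzero C (Dom C k) (Cod C f) \<and>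
     (\<forall>X. \<forall>h \<in> homs C X (Dom C f). f \<cdot>\<^bsub>C\<^esub> h = hzero C X (Cod C f) \<longrightarrow>
        (\<exists>!l. l \<in> homs C X (Dom C k) \<and> k \<cdot>\<^bsub>C\<^esub> l = h))"

definition is_cokernel :: "('o, 'm, 'z) add_cat_scheme \<Rightarrow> 'm \<Rightarrow> 'm \<Rightarrow> bool" where
  "is_cokernel C f c \<longleftrightarrow> f \<in> Ar C \<and> c \<in> Ar C \<and> Dom C c = Cod C f \<and>
     c \<cdot>\<^bsub>C\<^esub> f = hzero C (Dom C f) (Cod C c) \<and>
     (\<forall>X. \<forall>h \<in> homs C (Cod C f) X. h \<cdot>\<^bsub>C\<^esub> f = hzero C (Dom C f) X \<longrightarrow>
        (\<exists>!l. l \<in> homs C (Cod C c) X \<and> l \<cdot>\<^bsub>C\<^esub> c = h))"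

locale abelian_category = additive_category +
  assumes ex_kernel: "f \<in> Ar C \<Longrightarrow> \<exists>k. is_kernel C f k"
    and ex_cokernel: "f \<in> Ar C \<Longrightarrow> \<exists>c. is_cokernel C f c"
    and mono_normal: "is_mono C f \<Longrightarrow> \<exists>g. is_kernel C g f"
    and epi_normal: "is_epi C f \<Longrightarrow> \<exists>g. is_cokernel C g f"

definition is_image :: "('o, 'm, 'z) add_cat_scheme \<Rightarrow> 'm \<Rightarrow> 'm \<Rightarrow> bool" where
  "is_image C f u \<longleftrightarrow> (\<exists>c. is_cokernel C f c \<and> is_kernel C c u)"

definition short_exact :: "('o, 'm, 'z) add_cat_scheme \<Rightarrow> 'm \<Rightarrow> 'm \<Rightarrow> bool" where
  "short_exact C f g \<longleftrightarrow> is_kernel C g f \<and> is_cokernel C f g"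


section \<open>Rigid abelian tensor categories\<close>

text \<open>
  Structural isomorphisms:
  \<open>asc A B D : (A \<otimes> B) \<otimes> D \<rightarrow> A \<otimes> (B \<otimes> D)\<close>, \<open>lun A : 1 \<otimes> A \<rightarrow> A\<close>, \<open>run A : A \<otimes> 1 \<rightarrow> A\<close>,
  \<open>brd A B : A \<otimes> B \<rightarrow> B \<otimes> A\<close>.
\<close>

record ('o, 'm) tensor_cat = "('o, 'm) add_cat" +
  tob :: "['o, 'o] \<Rightarrow> 'o" (infixl \<open>\<otimes>\<^sub>o\<index>\<close> 75)
  tar :: "['m, 'm] \<Rightarrow> 'm" (infixl \<open>\<otimes>\<^sub>a\<index>\<close> 75)
  unt :: "'o"
  asc :: "'o \<Rightarrow> 'o \<Rightarrow> 'o \<Rightarrow> 'm"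
  lun :: "'o \<Rightarrow> 'm"
  run :: "'o \<Rightarrow> 'm"
  brd :: "'o \<Rightarrow> 'o \<Rightarrow> 'm"

locale tensor_category = additive_category C for C :: "('o, 'm, 'z) tensor_cat_scheme" (structure) +
  assumes tob_closed: "A \<in> Ob C \<Longrightarrow> B \<in> Ob C \<Longrightarrow> A \<otimes>\<^sub>o B \<in> Ob C"
    and unt_closed: "unt C \<in> Ob C"
    and tar_closed: "f \<in> homs C A A' \<Longrightarrow> g \<in> homs C B B' \<Longrightarrow>
      f \<otimes>\<^sub>a g \<in> homs C (A \<otimes>\<^sub>o B) (A' \<otimes>\<^sub>o B')"
    and tar_idt: "A \<in> Ob C \<Longrightarrow> B \<in> Ob C \<Longrightarrow> idt C A \<otimes>\<^sub>a idt C B = idt C (A \<otimes>\<^sub>o B)"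
    and tar_cmp: "f \<in> homs C A A' \<Longrightarrow> f' \<in> homs C A' A'' \<Longrightarrow>
      g \<in> homs C B B' \<Longrightarrow> g' \<in> homs C B' B'' \<Longrightarrow>
      (f' \<cdot> f) \<otimes>\<^sub>a (g' \<cdot> g) = (f' \<otimes>\<^sub>a g') \<cdot> (f \<otimes>\<^sub>a g)"
    and tar_hadd_left: "f \<in> homs C A A' \<Longrightarrow> f' \<in> homs C A A' \<Longrightarrow> g \<in> homs C B B' \<Longrightarrow>
      hadd C f f' \<otimes>\<^sub>a g = hadd C (f \<otimes>\<^sub>a g) (f' \<otimes>\<^sub>a g)"
    and tar_hadd_right: "f \<in> homs C A A' \<Longrightarrow> g \<in> homs C B B' \<Longrightarrow> g' \<in> homs C B B' \<Longrightarrow>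
      f \<otimes>\<^sub>a hadd C g g' = hadd C (f \<otimes>\<^sub>a g) (f \<otimes>\<^sub>a g')"
    and asc_iso: "A \<in> Ob C \<Longrightarrow> B \<in> Ob C \<Longrightarrow> D \<in> Ob C \<Longrightarrow>
      asc C A B D \<in> isos C ((A \<otimes>\<^sub>o B) \<otimes>\<^sub>o D) (A \<otimes>\<^sub>o (B \<otimes>\<^sub>o D))"
    and lun_iso: "A \<in> Ob C \<Longrightarrow> lun C A \<in> isos C (unt C \<otimes>\<^sub>o A) A"
    and run_iso: "A \<in> Ob C \<Longrightarrow> run C A \<in> isos C (A \<otimes>\<^sub>o unt C) A"
    and brd_iso: "A \<in> Ob C \<Longrightarrow> B \<in> Ob C \<Longrightarrow> brd C A B \<in> isos C (A \<otimes>\<^sub>o B) (B \<otimes>\<^sub>o A)"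
    and asc_natural: "f \<in> homs C A A' \<Longrightarrow> g \<in> homs C B B' \<Longrightarrow> h \<in> homs C D D' \<Longrightarrow>
      asc C A' B' D' \<cdot> ((f \<otimes>\<^sub>a g) \<otimes>\<^sub>a h) = (f \<otimes>\<^sub>a (g \<otimes>\<^sub>a h)) \<cdot> asc C A B D"
    and lun_natural: "f \<in> homs C A A' \<Longrightarrow> lun C A' \<cdot> (idt C (unt C) \<otimes>\<^sub>a f) = f \<cdot> lun C A"
    and run_natural: "f \<in> homs C A A' \<Longrightarrow> run C A' \<cdot> (f \<otimes>\<^sub>a idt C (unt C)) = f \<cdot> run C A"
    and brd_natural: "f \<in> homs C A A' \<Longrightarrow> g \<in> homs C B B' \<Longrightarrow>
      brd C A' B' \<cdot> (f \<otimes>\<^sub>a g) = (g \<otimes>\<^sub>a f) \<cdot> brd C A B"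
    and pentagon: "A \<in> Ob C \<Longrightarrow> B \<in> Ob C \<Longrightarrow> D \<in> Ob C \<Longrightarrow> E \<in> Ob C \<Longrightarrow>
      asc C A B (D \<otimes>\<^sub>o E) \<cdot> asc C (A \<otimes>\<^sub>o B) D E =
      (idt C A \<otimes>\<^sub>a asc C B D E) \<cdot> (asc C A (B \<otimes>\<^sub>o D) E \<cdot> (asc C A B D \<otimes>\<^sub>a idt C E))"
    and triangle: "A \<in> Ob C \<Longrightarrow> B \<in> Ob C \<Longrightarrow>
      (idt C A \<otimes>\<^sub>a lun C B) \<cdot> asc C A (unt C) B = run C A \<otimes>\<^sub>a idt C B"
    and hexagon: "A \<in> Ob C \<Longrightarrow> B \<in> Ob C \<Longrightarrow> D \<in> Ob C \<Longrightarrow>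
      asc C B D A \<cdot> (brd C A (B \<otimes>\<^sub>o D) \<cdot> asc C A B D) =
      (idt C B \<otimes>\<^sub>a brd C A D) \<cdot> (asc C B A D \<cdot> (brd C A B \<otimes>\<^sub>a idt C D))"
    and brd_symmetric: "A \<in> Ob C \<Longrightarrow> B \<in> Ob C \<Longrightarrow> brd C B A \<cdot> brd C A B = idt C (A \<otimes>\<^sub>o B)"

text \<open>
  A dual of \<open>A\<close> is an object \<open>D\<close> with \<open>\<eta> : 1 \<rightarrow> D \<otimes> A\<close> and \<open>\<epsilon> : A \<otimes> D \<rightarrow> 1\<close> satisfying
  the triangle identities, i.e. exhibiting \<open>D \<otimes> -\<close> as right adjoint to \<open>A \<otimes> -\<close>. Under the
  adjunction \<open>Hom(A \<otimes> 1, A) \<cong> Hom(1, D \<otimes> A)\<close>, the identity of \<open>A\<close> corresponds to \<open>\<eta>\<close>.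
\<close>

definition is_dual :: "('o, 'm, 'z) tensor_cat_scheme \<Rightarrow> 'o \<Rightarrow> 'o \<Rightarrow> 'm \<Rightarrow> 'm \<Rightarrow> bool" where
  "is_dual C A D \<eta> \<epsilon> \<longleftrightarrow> D \<in> Ob C \<and>
     \<eta> \<in> homs C (unt C) (D \<otimes>\<^sub>o\<^bsub>C\<^esub> A) \<and> \<epsilon> \<in> homs C (A \<otimes>\<^sub>o\<^bsub>C\<^esub> D) (unt C) \<and>
     lun C A \<cdot>\<^bsub>C\<^esub> ((\<epsilon> \<otimes>\<^sub>a\<^bsub>C\<^esub> idt C A) \<cdot>\<^bsub>C\<^esub> (inv_ar C (asc C A D A) \<cdot>\<^bsub>C\<^esub> (idt C A \<otimes>\<^sub>a\<^bsub>C\<^esub> \<eta>))) = run C A \<and>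
     run C D \<cdot>\<^bsub>C\<^esub> ((idt C D \<otimes>\<^sub>a\<^bsub>C\<^esub> \<epsilon>) \<cdot>\<^bsub>C\<^esub> (asc C D A D \<cdot>\<^bsub>C\<^esub> (\<eta> \<otimes>\<^sub>a\<^bsub>C\<^esub> idt C D))) = lun C D"

locale rigid_tensor_category = tensor_category +
  assumes rigid: "A \<in> Ob C \<Longrightarrow> \<exists>D \<eta> \<epsilon>. is_dual C A D \<eta> \<epsilon>"

locale rigid_abelian_tensor_category =
  rigid_tensor_category C + abelian_category C
  for C :: "('o, 'm, 'z) tensor_cat_scheme" (structure)

text \<open>The ring \<open>Z(C) = End(1)\<close> and its action \<open>A \<cong> 1 \<otimes> A \<rightarrow> 1 \<otimes> B \<cong> B\<close> on \<open>Hom(A, B)\<close>.\<close>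

definition Z_ring :: "('o, 'm, 'z) tensor_cat_scheme \<Rightarrow> 'm ring" where
  "Z_ring C = \<lparr>carrier = homs C (unt C) (unt C), mult = Cmp C, one = idt C (unt C),
     zero = hzero C (unt C) (unt C), add = hadd C\<rparr>"

definition Z_act :: "('o, 'm, 'z) tensor_cat_scheme \<Rightarrow> 'm \<Rightarrow> 'm \<Rightarrow> 'm" where
  "Z_act C z f = lun C (Cod C f) \<cdot>\<^bsub>C\<^esub> ((z \<otimes>\<^sub>a\<^bsub>C\<^esub> f) \<cdot>\<^bsub>C\<^esub> inv_ar C (lun C (Dom C f)))"

text \<open>
  In a record used as a module over a ring, the fields \<open>mult\<close> and \<open>one\<close> inherited from rings play
  no role (cf. the locale \<open>module\<close> of HOL-Algebra).
\<close>

definition hom_module :: "('o, 'm, 'z) tensor_cat_scheme \<Rightarrow> 'o \<Rightarrow> 'o \<Rightarrow> ('m, 'm) module" where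
  "hom_module C A B = \<lparr>carrier = homs C A B, mult = undefined, one = undefined,
     zero = hzero C A B, add = hadd C, smult = Z_act C\<rparr>"


section \<open>Tensor functors and tensor equivalences\<close>

text \<open>
  Tensor functors are additive strong symmetric monoidal functors, with constraints
  \<open>fmu A B : F A \<otimes> F B \<rightarrow> F (A \<otimes> B)\<close> and \<open>feta : 1 \<rightarrow> F 1\<close>.
\<close>

record ('o, 'm, 'p, 'n) tfunctor =
  fob :: "'o \<Rightarrow> 'p"
  far :: "'m \<Rightarrow> 'n"
  fmu :: "'o \<Rightarrow> 'o \<Rightarrow> 'n"
  feta :: "'n"

locale tensor_functor = S: tensor_category C + T: tensor_category D
  for C :: "('o, 'm, 'z) tensor_cat_scheme" and D :: "('p, 'n, 'y) tensor_cat_scheme" +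
  fixes F :: "('o, 'm, 'p, 'n) tfunctor"
  assumes fob_closed: "A \<in> Ob C \<Longrightarrow> fob F A \<in> Ob D"
    and far_closed: "f \<in> homs C A B \<Longrightarrow> far F f \<in> homs D (fob F A) (fob F B)"
    and far_idt: "A \<in> Ob C \<Longrightarrow> far F (idt C A) = idt D (fob F A)"
    and far_cmp: "f \<in> homs C A B \<Longrightarrow> g \<in> homs C B E \<Longrightarrow> far F (g \<cdot>\<^bsub>C\<^esub> f) = far F g \<cdot>\<^bsub>D\<^esub> far F f"
    and far_hadd: "f \<in> homs C A B \<Longrightarrow> g \<in> homs C A B \<Longrightarrow>
      far F (hadd C f g) = hadd D (far F f) (far F g)"
    and feta_iso: "feta F \<in> isos D (unt D) (fob F (unt C))"
    and fmu_iso: "A \<in> Ob C \<Longrightarrow> B \<in> Ob C \<Longrightarrow>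
      fmu F A B \<in> isos D (fob F A \<otimes>\<^sub>o\<^bsub>D\<^esub> fob F B) (fob F (A \<otimes>\<^sub>o\<^bsub>C\<^esub> B))"
    and fmu_natural: "f \<in> homs C A A' \<Longrightarrow> g \<in> homs C B B' \<Longrightarrow>
      fmu F A' B' \<cdot>\<^bsub>D\<^esub> (far F f \<otimes>\<^sub>a\<^bsub>D\<^esub> far F g) = far F (f \<otimes>\<^sub>a\<^bsub>C\<^esub> g) \<cdot>\<^bsub>D\<^esub> fmu F A B"
    and fmu_asc: "A \<in> Ob C \<Longrightarrow> B \<in> Ob C \<Longrightarrow> E \<in> Ob C \<Longrightarrow>
      far F (asc C A B E) \<cdot>\<^bsub>D\<^esub> (fmu F (A \<otimes>\<^sub>o\<^bsub>C\<^esub> B) E \<cdot>\<^bsub>D\<^esub> (fmu F A B \<otimes>\<^sub>a\<^bsub>D\<^esub> idt D (fob F E))) =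
      fmu F A (B \<otimes>\<^sub>o\<^bsub>C\<^esub> E) \<cdot>\<^bsub>D\<^esub>
        ((idt D (fob F A) \<otimes>\<^sub>a\<^bsub>D\<^esub> fmu F B E) \<cdot>\<^bsub>D\<^esub> asc D (fob F A) (fob F B) (fob F E))"
    and fmu_lun: "A \<in> Ob C \<Longrightarrow>
      far F (lun C A) \<cdot>\<^bsub>D\<^esub> (fmu F (unt C) A \<cdot>\<^bsub>D\<^esub> (feta F \<otimes>\<^sub>a\<^bsub>D\<^esub> idt D (fob F A))) = lun D (fob F A)"
    and fmu_run: "A \<in> Ob C \<Longrightarrow>
      far F (run C A) \<cdot>\<^bsub>D\<^esub> (fmu F A (unt C) \<cdot>\<^bsub>D\<^esub> (idt D (fob F A) \<otimes>\<^sub>a\<^bsub>D\<^esub> feta F)) = run D (fob F A)"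
    and fmu_brd: "A \<in> Ob C \<Longrightarrow> B \<in> Ob C \<Longrightarrow>
      far F (brd C A B) \<cdot>\<^bsub>D\<^esub> fmu F A B = fmu F B A \<cdot>\<^bsub>D\<^esub> brd D (fob F A) (fob F B)"

definition full_functor ::
    "('o, 'm, 'z) cat_scheme \<Rightarrow> ('p, 'n, 'y) cat_scheme \<Rightarrow> ('o, 'm, 'p, 'n) tfunctor \<Rightarrow> bool" where
  "full_functor C D F \<longleftrightarrow>
     (\<forall>A \<in> Ob C. \<forall>B \<in> Ob C. far F ` homs C A B = homs D (fob F A) (fob F B))"

text \<open>The ring homomorphism \<open>Z(F) : Z(C) \<rightarrow> Z(D)\<close>, where \<open>F(1)\<close> is identified with \<open>1\<close>.\<close>

definition Z_map ::
    "('p, 'n, 'y) tensor_cat_scheme \<Rightarrow> ('o, 'm, 'p, 'n) tfunctor \<Rightarrow> 'm \<Rightarrow> 'n" where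
  "Z_map D F z = inv_ar D (feta F) \<cdot>\<^bsub>D\<^esub> (far F z \<cdot>\<^bsub>D\<^esub> feta F)"

definition tfunctor_id :: "('o, 'm, 'z) tensor_cat_scheme \<Rightarrow> ('o, 'm, 'o, 'm) tfunctor" where
  "tfunctor_id C = \<lparr>fob = (\<lambda>A. A), far = (\<lambda>f. f), fmu = (\<lambda>A B. idt C (A \<otimes>\<^sub>o\<^bsub>C\<^esub> B)),
     feta = idt C (unt C)\<rparr>"

definition tfunctor_comp :: "('q, 'k, 'z) tensor_cat_scheme \<Rightarrow> ('p, 'n, 'q, 'k) tfunctor \<Rightarrow>
    ('o, 'm, 'p, 'n) tfunctor \<Rightarrow> ('o, 'm, 'q, 'k) tfunctor" where
  "tfunctor_comp E G F = \<lparr>fob = fob G \<circ> fob F, far = far G \<circ> far F,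
     fmu = (\<lambda>A B. far G (fmu F A B) \<cdot>\<^bsub>E\<^esub> fmu G (fob F A) (fob F B)),
     feta = far G (feta F) \<cdot>\<^bsub>E\<^esub> feta G\<rparr>"

definition tensor_nat_iso :: "('o, 'm, 'z) tensor_cat_scheme \<Rightarrow> ('p, 'n, 'y) tensor_cat_scheme \<Rightarrow>
    ('o, 'm, 'p, 'n) tfunctor \<Rightarrow> ('o, 'm, 'p, 'n) tfunctor \<Rightarrow> ('o \<Rightarrow> 'n) \<Rightarrow> bool" where
  "tensor_nat_iso C D F G \<tau> \<longleftrightarrow>
     (\<forall>A \<in> Ob C. \<tau> A \<in> isos D (fob F A) (fob G A)) \<and>
     (\<forall>A B. \<forall>f \<in> homs C A B. \<tau> B \<cdot>\<^bsub>D\<^esub> far F f = far G f \<cdot>\<^bsub>D\<^esub> \<tau> A) \<and>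
     (\<forall>A \<in> Ob C. \<forall>B \<in> Ob C.
        \<tau> (A \<otimes>\<^sub>o\<^bsub>C\<^esub> B) \<cdot>\<^bsub>D\<^esub> fmu F A B = fmu G A B \<cdot>\<^bsub>D\<^esub> (\<tau> A \<otimes>\<^sub>a\<^bsub>D\<^esub> \<tau> B)) \<and>
     \<tau> (unt C) \<cdot>\<^bsub>D\<^esub> feta F = feta G"

definition tensor_equivalence :: "('o, 'm, 'z) tensor_cat_scheme \<Rightarrow>
    ('p, 'n, 'y) tensor_cat_scheme \<Rightarrow> ('o, 'm, 'p, 'n) tfunctor \<Rightarrow> bool" where
  "tensor_equivalence C D F \<longleftrightarrow> tensor_functor C D F \<and>
     (\<exists>G \<sigma> \<tau>. tensor_functor D C G \<and>
        tensor_nat_iso C C (tfunctor_comp C G F) (tfunctor_id C) \<sigma> \<and>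
        tensor_nat_iso D D (tfunctor_comp D F G) (tfunctor_id D) \<tau>)"


section \<open>Supports and the ideal attached to a Serre tensor ideal\<close>

text \<open>
  Subobjects of an object are represented by monomorphisms into it. The choices made by
  \<open>SOME\<close> below are unique up to isomorphism of subobjects, and \<open>e_sub\<close>, \<open>e_obj\<close> do not depend on them.
\<close>

definition is_complement :: "('o, 'm, 'z) add_cat_scheme \<Rightarrow> 'm \<Rightarrow> 'm \<Rightarrow> bool" where
  "is_complement C u v \<longleftrightarrow> (\<exists>p q. is_biproduct C (Dom C u) (Dom C v) (Cod C u) u v p q)"

definition complement :: "('o, 'm, 'z) add_cat_scheme \<Rightarrow> 'm \<Rightarrow> 'm" where
  "complement C u = (SOME v. is_complement C u v)"

definition e_sub :: "('o, 'm, 'z) tensor_cat_scheme \<Rightarrow> 'm \<Rightarrow> 'm" where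
  "e_sub C u = (THE e. e \<in> carrier (Z_ring C) \<and> e \<cdot>\<^bsub>C\<^esub> e = e \<and>
     is_image C e u \<and> is_kernel C e (complement C u))"

definition coev :: "('o, 'm, 'z) tensor_cat_scheme \<Rightarrow> 'o \<Rightarrow> 'm" where
  "coev C A = (SOME \<eta>. \<exists>D \<epsilon>. is_dual C A D \<eta> \<epsilon>)"

definition supp :: "('o, 'm, 'z) tensor_cat_scheme \<Rightarrow> 'o \<Rightarrow> 'm" where
  "supp C A = complement C (SOME k. is_kernel C (coev C A) k)"

definition e_obj :: "('o, 'm, 'z) tensor_cat_scheme \<Rightarrow> 'o \<Rightarrow> 'm" where
  "e_obj C A = e_sub C (supp C A)"

definition serre_subcategory :: "('o, 'm, 'z) add_cat_scheme \<Rightarrow> 'o set \<Rightarrow> bool" where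
  "serre_subcategory C \<I> \<longleftrightarrow> \<I> \<subseteq> Ob C \<and> \<I> \<noteq> {} \<and>
     (\<forall>f g. short_exact C f g \<longrightarrow> (Cod C f \<in> \<I> \<longleftrightarrow> Dom C f \<in> \<I> \<and> Cod C g \<in> \<I>))"

definition serre_tensor_ideal :: "('o, 'm, 'z) tensor_cat_scheme \<Rightarrow> 'o set \<Rightarrow> bool" where
  "serre_tensor_ideal C \<I> \<longleftrightarrow> serre_subcategory C \<I> \<and>
     (\<forall>A \<in> Ob C. \<forall>B \<in> \<I>. A \<otimes>\<^sub>o\<^bsub>C\<^esub> B \<in> \<I>)"

definition I_ideal :: "('o, 'm, 'z) tensor_cat_scheme \<Rightarrow> 'o set \<Rightarrow> 'm set" where
  "I_ideal C \<I> = Idl\<^bsub>Z_ring C\<^esub> (e_obj C ` \<I>)"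


section \<open>The Serre quotient\<close>

text \<open>
  The quotient is the localisation at the arrows whose kernel and cokernel lie in \<open>\<I>\<close>,
  constructed by the calculus of fractions: the arrows from \<open>A\<close> to \<open>B\<close> are classes of
  roofs \<open>A \<leftarrow> X \<rightarrow> B\<close>, written \<open>(s, f)\<close>, with \<open>s : X \<rightarrow> A\<close> such an arrow and \<open>f : X \<rightarrow> B\<close>. The
  class is tagged with \<open>A\<close> and \<open>B\<close>.
\<close>

definition serre_weq :: "('o, 'm, 'z) add_cat_scheme \<Rightarrow> 'o set \<Rightarrow> 'm set" where
  "serre_weq C \<I> = {s \<in> Ar C. \<exists>k c. is_kernel C s k \<and> is_cokernel C s c \<and>
     Dom C k \<in> \<I> \<and> Cod C c \<in> \<I>}"

definition roofs :: "('o, 'm, 'z) add_cat_scheme \<Rightarrow> 'o set \<Rightarrow> 'o \<Rightarrow> 'o \<Rightarrow> ('m \<times> 'm) set" where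
  "roofs C \<I> A B = {(s, f). s \<in> serre_weq C \<I> \<and> f \<in> Ar C \<and>
     Cod C s = A \<and> Dom C s = Dom C f \<and> Cod C f = B}"

definition roof_equiv ::
    "('o, 'm, 'z) add_cat_scheme \<Rightarrow> 'o set \<Rightarrow> 'm \<times> 'm \<Rightarrow> 'm \<times> 'm \<Rightarrow> bool" where
  "roof_equiv C \<I> = (\<lambda>(s, f) (s', f'). \<exists>u v. u \<in> Ar C \<and> v \<in> Ar C \<and> Dom C u = Dom C v \<and>
     Cod C u = Dom C s \<and> Cod C v = Dom C s' \<and>
     s \<cdot>\<^bsub>C\<^esub> u = s' \<cdot>\<^bsub>C\<^esub> v \<and> s \<cdot>\<^bsub>C\<^esub> u \<in> serre_weq C \<I> \<and> f \<cdot>\<^bsub>C\<^esub> u = f' \<cdot>\<^bsub>C\<^esub> v)"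

definition roof_class ::
    "('o, 'm, 'z) add_cat_scheme \<Rightarrow> 'o set \<Rightarrow> 'm \<Rightarrow> 'm \<Rightarrow> ('m \<times> 'm) set" where
  "roof_class C \<I> s f = {r \<in> roofs C \<I> (Cod C s) (Cod C f). roof_equiv C \<I> (s, f) r}"

type_synonym ('o, 'm) frac = "'o \<times> 'o \<times> ('m \<times> 'm) set"

definition loc_ar :: "('o, 'm, 'z) add_cat_scheme \<Rightarrow> 'o set \<Rightarrow> 'm \<Rightarrow> ('o, 'm) frac" where
  "loc_ar C \<I> f = (Dom C f, Cod C f, roof_class C \<I> (idt C (Dom C f)) f)"

text \<open>
  The operations on classes are given by the usual formulas on representatives; since the resulting
  class does not depend on any choice, it is the union of the classes obtained from all choices.
\<close>

definition frac_cmp :: "('o, 'm, 'z) add_cat_scheme \<Rightarrow> 'o set \<Rightarrow>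
    ('m \<times> 'm) set \<Rightarrow> ('m \<times> 'm) set \<Rightarrow> ('m \<times> 'm) set" where
  "frac_cmp C \<I> Y X = \<Union> {roof_class C \<I> (s \<cdot>\<^bsub>C\<^esub> u) (g \<cdot>\<^bsub>C\<^esub> v) | s f t g u v.
     (s, f) \<in> X \<and> (t, g) \<in> Y \<and> u \<in> serre_weq C \<I> \<and> v \<in> Ar C \<and> Dom C u = Dom C v \<and>
     Cod C u = Dom C f \<and> Cod C v = Dom C t \<and> f \<cdot>\<^bsub>C\<^esub> u = t \<cdot>\<^bsub>C\<^esub> v}"

definition frac_add :: "('o, 'm, 'z) add_cat_scheme \<Rightarrow> 'o set \<Rightarrow>
    ('m \<times> 'm) set \<Rightarrow> ('m \<times> 'm) set \<Rightarrow> ('m \<times> 'm) set" where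
  "frac_add C \<I> X Y = \<Union> {roof_class C \<I> (s \<cdot>\<^bsub>C\<^esub> u) (hadd C (f \<cdot>\<^bsub>C\<^esub> u) (g \<cdot>\<^bsub>C\<^esub> v)) | s f t g u v.
     (s, f) \<in> X \<and> (t, g) \<in> Y \<and> u \<in> Ar C \<and> v \<in> Ar C \<and> Dom C u = Dom C v \<and>
     Cod C u = Dom C s \<and> Cod C v = Dom C t \<and>
     s \<cdot>\<^bsub>C\<^esub> u = t \<cdot>\<^bsub>C\<^esub> v \<and> s \<cdot>\<^bsub>C\<^esub> u \<in> serre_weq C \<I>}"

definition frac_tar :: "('o, 'm, 'z) tensor_cat_scheme \<Rightarrow> 'o set \<Rightarrow>
    ('m \<times> 'm) set \<Rightarrow> ('m \<times> 'm) set \<Rightarrow> ('m \<times> 'm) set" where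
  "frac_tar C \<I> X Y = \<Union> {roof_class C \<I> (s \<otimes>\<^sub>a\<^bsub>C\<^esub> t) (f \<otimes>\<^sub>a\<^bsub>C\<^esub> g) | s f t g. (s, f) \<in> X \<and> (t, g) \<in> Y}"

definition serre_quotient ::
    "('o, 'm, 'z) tensor_cat_scheme \<Rightarrow> 'o set \<Rightarrow> ('o, ('o, 'm) frac) tensor_cat" where
  "serre_quotient C \<I> = \<lparr>
     Ob = Ob C,
     Ar = {(A, B, roof_class C \<I> s f) | A B s f. A \<in> Ob C \<and> B \<in> Ob C \<and> (s, f) \<in> roofs C \<I> A B},
     Dom = (\<lambda>(A, B, X). A),
     Cod = (\<lambda>(A, B, X). B),
     idt = (\<lambda>A. loc_ar C \<I> (idt C A)),
     Cmp = (\<lambda>(B', D, Y) (A, B, X). (A, D, frac_cmp C \<I> Y X)),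
     hzero = (\<lambda>A B. loc_ar C \<I> (hzero C A B)),
     hadd = (\<lambda>(A, B, X) (A', B', Y). (A, B, frac_add C \<I> X Y)),
     tob = tob C,
     tar = (\<lambda>(A, A', X) (B, B', Y). (A \<otimes>\<^sub>o\<^bsub>C\<^esub> B, A' \<otimes>\<^sub>o\<^bsub>C\<^esub> B', frac_tar C \<I> X Y)),
     unt = unt C,
     asc = (\<lambda>A B D. loc_ar C \<I> (asc C A B D)),
     lun = (\<lambda>A. loc_ar C \<I> (lun C A)),
     run = (\<lambda>A. loc_ar C \<I> (run C A)),
     brd = (\<lambda>A B. loc_ar C \<I> (brd C A B))\<rparr>"

definition serre_loc ::
    "('o, 'm, 'z) tensor_cat_scheme \<Rightarrow> 'o set \<Rightarrow> ('o, 'm, 'o, ('o, 'm) frac) tfunctor" where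
  "serre_loc C \<I> = \<lparr>fob = (\<lambda>A. A), far = loc_ar C \<I>,
     fmu = (\<lambda>A B. idt (serre_quotient C \<I>) (A \<otimes>\<^sub>o\<^bsub>C\<^esub> B)),
     feta = idt (serre_quotient C \<I>) (unt C)\<rparr>"


section \<open>Tensor products of modules and base change of tensor categories\<close>

text \<open>
  The tensor product \<open>M \<otimes>\<^sub>R N\<close> over a commutative ring as an abelian group: the free abelian group on
  \<open>M \<times> N\<close> modulo the subgroup generated by the usual relations.
\<close>

definition tensor_relations ::
    "('r, 'w) ring_scheme \<Rightarrow> ('r, 'a, 'u) module_scheme \<Rightarrow> ('r, 'b, 'v) module_scheme \<Rightarrow>
     ('a \<times> 'b \<Rightarrow>\<^sub>0 int) set" where
  "tensor_relations R M N = generate (free_Abelian_group (carrier M \<times> carrier N))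
     ({frag_of (m \<oplus>\<^bsub>M\<^esub> m', n) - frag_of (m, n) - frag_of (m', n) | m m' n.
         m \<in> carrier M \<and> m' \<in> carrier M \<and> n \<in> carrier N} \<union>
      {frag_of (m, n \<oplus>\<^bsub>N\<^esub> n') - frag_of (m, n) - frag_of (m, n') | m n n'.
         m \<in> carrier M \<and> n \<in> carrier N \<and> n' \<in> carrier N} \<union>
      {frag_of (r \<odot>\<^bsub>M\<^esub> m, n) - frag_of (m, r \<odot>\<^bsub>N\<^esub> n) | r m n.
         r \<in> carrier R \<and> m \<in> carrier M \<and> n \<in> carrier N})"

definition tensor_product ::
    "('r, 'w) ring_scheme \<Rightarrow> ('r, 'a, 'u) module_scheme \<Rightarrow> ('r, 'b, 'v) module_scheme \<Rightarrow>
     ('a \<times> 'b \<Rightarrow>\<^sub>0 int) set monoid" where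
  "tensor_product R M N =
     free_Abelian_group (carrier M \<times> carrier N) Mod tensor_relations R M N"

definition tensor_class ::
    "('r, 'w) ring_scheme \<Rightarrow> ('r, 'a, 'u) module_scheme \<Rightarrow> ('r, 'b, 'v) module_scheme \<Rightarrow>
     ('a \<times> 'b \<Rightarrow>\<^sub>0 int) \<Rightarrow> ('a \<times> 'b \<Rightarrow>\<^sub>0 int) set" where
  "tensor_class R M N x =
     tensor_relations R M N #>\<^bsub>free_Abelian_group (carrier M \<times> carrier N)\<^esub> x"

definition frag_bilinear :: "('a \<Rightarrow> 'b \<Rightarrow> 'c) \<Rightarrow> ('a \<Rightarrow>\<^sub>0 int) \<Rightarrow> ('b \<Rightarrow>\<^sub>0 int) \<Rightarrow> ('c \<Rightarrow>\<^sub>0 int)" where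
  "frag_bilinear \<phi> x y = frag_extend (\<lambda>p. frag_extend (\<lambda>q. frag_of (\<phi> p q)) y) x"

definition quot_module :: "('r, 'w) ring_scheme \<Rightarrow> 'r set \<Rightarrow> ('r, 'r set) module" where
  "quot_module R I = \<lparr>carrier = carrier (R Quot I), mult = mult (R Quot I), one = one (R Quot I),
     zero = zero (R Quot I), add = add (R Quot I), smult = (\<lambda>r X. (I +>\<^bsub>R\<^esub> r) \<otimes>\<^bsub>R Quot I\<^esub> X)\<rparr>"

text \<open>
  The category \<open>Z(C)/I \<otimes>\<^bsub>Z(C)\<^esub> C\<close>. Composition and tensor product of arrows are the biadditive extensions of
  \<open>(t \<otimes> g) \<cdot> (s \<otimes> f) = t s \<otimes> (g \<cdot> f)\<close> and \<open>(s \<otimes> f) \<otimes> (t \<otimes> g) = s t \<otimes> (f \<otimes> g)\<close>; as above, they are written as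
  unions over representatives.
\<close>

type_synonym ('o, 'm) bc_arrow = "'o \<times> 'o \<times> ('m set \<times> 'm \<Rightarrow>\<^sub>0 int) set"

definition bc_class :: "('o, 'm, 'z) tensor_cat_scheme \<Rightarrow> 'm set \<Rightarrow> 'o \<Rightarrow> 'o \<Rightarrow>
    ('m set \<times> 'm \<Rightarrow>\<^sub>0 int) \<Rightarrow> ('m set \<times> 'm \<Rightarrow>\<^sub>0 int) set" where
  "bc_class C I A B = tensor_class (Z_ring C) (quot_module (Z_ring C) I) (hom_module C A B)"

definition bc_ar :: "('o, 'm, 'z) tensor_cat_scheme \<Rightarrow> 'm set \<Rightarrow> 'm \<Rightarrow> ('o, 'm) bc_arrow" where
  "bc_ar C I f = (Dom C f, Cod C f,
     bc_class C I (Dom C f) (Cod C f) (frag_of (\<one>\<^bsub>Z_ring C Quot I\<^esub>, f)))"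

definition base_change ::
    "('o, 'm, 'z) tensor_cat_scheme \<Rightarrow> 'm set \<Rightarrow> ('o, ('o, 'm) bc_arrow) tensor_cat" where
  "base_change C I = \<lparr>
     Ob = Ob C,
     Ar = {(A, B, X). A \<in> Ob C \<and> B \<in> Ob C \<and>
       X \<in> carrier (tensor_product (Z_ring C) (quot_module (Z_ring C) I) (hom_module C A B))},
     Dom = (\<lambda>(A, B, X). A),
     Cod = (\<lambda>(A, B, X). B),
     idt = (\<lambda>A. bc_ar C I (idt C A)),
     Cmp = (\<lambda>(B', D, Y) (A, B, X). (A, D, \<Union>y\<in>Y. \<Union>x\<in>X. bc_class C I A D
       (frag_bilinear (\<lambda>(t, g) (s, f). (t \<otimes>\<^bsub>Z_ring C Quot I\<^esub> s, g \<cdot>\<^bsub>C\<^esub> f)) y x))),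
     hzero = (\<lambda>A B. (A, B,
       one (tensor_product (Z_ring C) (quot_module (Z_ring C) I) (hom_module C A B)))),
     hadd = (\<lambda>(A, B, X) (A', B', Y). (A, B,
       mult (tensor_product (Z_ring C) (quot_module (Z_ring C) I) (hom_module C A B)) X Y)),
     tob = tob C,
     tar = (\<lambda>(A, A', X) (B, B', Y). (A \<otimes>\<^sub>o\<^bsub>C\<^esub> B, A' \<otimes>\<^sub>o\<^bsub>C\<^esub> B',
       \<Union>x\<in>X. \<Union>y\<in>Y. bc_class C I (A \<otimes>\<^sub>o\<^bsub>C\<^esub> B) (A' \<otimes>\<^sub>o\<^bsub>C\<^esub> B')
         (frag_bilinear (\<lambda>(s, f) (t, g). (s \<otimes>\<^bsub>Z_ring C Quot I\<^esub> t, f \<otimes>\<^sub>a\<^bsub>C\<^esub> g)) x y))),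
     unt = unt C,
     asc = (\<lambda>A B D. bc_ar C I (asc C A B D)),
     lun = (\<lambda>A. bc_ar C I (lun C A)),
     run = (\<lambda>A. bc_ar C I (run C A)),
     brd = (\<lambda>A B. bc_ar C I (brd C A B))\<rparr>"

text \<open>
  A tensor functor \<open>F : C \<rightarrow> D\<close> with \<open>Z(F)(I) = 0\<close> induces the functor
  \<open>Z(C)/I \<otimes>\<^bsub>Z(C)\<^esub> C \<rightarrow> D\<close>, \<open>[z] \<otimes> f \<mapsto> Z(F)(z) F(f)\<close>, extended additively. By well-definedness the images of the
  representatives of a class form a singleton, whose element is extracted by \<open>the_elem\<close>.
\<close>

definition induced_functor :: "('o, 'm, 'z) tensor_cat_scheme \<Rightarrow>
    ('p, 'n, 'y) tensor_cat_scheme \<Rightarrow> ('o, 'm, 'p, 'n) tfunctor \<Rightarrow>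
    ('o, ('o, 'm) bc_arrow, 'p, 'n) tfunctor" where
  "induced_functor C D F = \<lparr>
     fob = fob F,
     far = (\<lambda>(A, B, X). the_elem ((\<lambda>x.
       finprod (hom_group D (fob F A) (fob F B))
         (\<lambda>(s, f). Z_act D (the_elem (Z_map D F ` s)) (far F f)
            [^]\<^bsub>hom_group D (fob F A) (fob F B)\<^esub> Poly_Mapping.lookup x (s, f))
         (Poly_Mapping.keys x)) ` X)),
     fmu = fmu F,
     feta = feta F\<rparr>"

end

theory Submission
  imports Defs
begin

text \<open>
  Since every object has a dual, the tensor product is exact. The kernel of \<open>\<eta> : 1 \<rightarrow> A\<^sup>\<or> \<otimes> A\<close> therefore splits off
  \<open>1\<close>, and \<open>e(A)\<close> is an idempotent that acts as the identity on \<open>A\<close> and whose image embeds into \<open>A\<^sup>\<or> \<otimes> A\<close>. So for \<open>A\<close>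
  in the Serre ideal, \<open>w = 1 - e(A)\<close> annihilates \<open>A\<close>, while \<open>e(A)\<close> dies in the quotient. Applied to the
  kernel and the cokernel of a weak equivalence \<open>s\<close> this yields an idempotent scalar \<open>w\<close>, trivial in the quotient, and an
  arrow \<open>t\<close> with \<open>s t = w\<close> and \<open>t s = w\<close>. Hence the fraction \<open>f s\<^sup>-\<^sup>1\<close> is the image of \<open>f t\<close>, and \<open>f\<close> and \<open>g\<close> have the
  same image if and only if \<open>w f = w g\<close> for some such \<open>w\<close>. In the base change every arrow has the form \<open>1 \<otimes> f\<close>, and
  equality there is governed by the same relation, because \<open>1 - w \<in> I(\<I>)\<close>. Both categories are thus the
  quotient of \<open>\<A>\<close> by one congruence.
\<close>

section \<open>Arrows in abelian categories\<close>

text \<open>A Serre localisation and a quotient of scalars can agree because \<open>I_ideal\<close>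
  is generated by idempotents: modulo \<open>e\<close> the idempotent \<open>1 - e\<close> becomes
  1, so killing \<open>e\<close> and inverting \<open>1 - e\<close> are the same operation, and base
  change along the quotient ring is itself a localisation. The single idempotents
  \<open>e(A)\<close> do not suffice, since several conditions must be met at once. They are
  therefore enlarged to all idempotents of the ideal whose image lies in the Serre ideal; their
  complements form a set closed under products, so finitely many conditions are absorbed by one
  \<open>w\<close>. Neither target is known to be a tensor category from its definition, and the
  operations of both are unions over representatives. Computations with roofs and formal tensors are
  kept to a minimum by describing each class as a fibre: of the condition
  \<open>f \<doteq> g \<cdot> s\<close> over an arrow \<open>g\<close> for roofs, of an additive map
  into the quotient for tensors. The unions collapse once the congruence is compatible with the
  operations, and every axiom is inherited from \<open>C\<close> along a map that is the identity on
  objects and surjective on arrows.\<close>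

lemma homs_iff [simp]: "f \<in> homs C A B \<longleftrightarrow> f \<in> Ar C \<and> Dom C f = A \<and> Cod C f = B"
  by (auto simp: homs_def)

section \<open>Plain categories: rewriting of composites, inverses, monos and epis\<close>

context category
begin

declare dom_closed [simp] cod_closed [simp]

lemma idt_simps [simp]:
  assumes "A \<in> Ob C"
  shows "idt C A \<in> Ar C" "Dom C (idt C A) = A" "Cod C (idt C A) = A"
  using idt_closed[OF assms] by auto

lemma cmp_simps [simp]:
  assumes "f \<in> Ar C" "g \<in> Ar C" "Dom C g = Cod C f"
  shows "g \<cdot> f \<in> Ar C" "Dom C (g \<cdot> f) = Dom C f" "Cod C (g \<cdot> f) = Cod C g"
  using cmp_closed[of f "Dom C f" "Cod C f" g "Cod C g"] assms by auto

lemma cmp_idt_simp [simp]: "f \<in> Ar C \<Longrightarrow> Dom C f = A \<Longrightarrow> f \<cdot> idt C A = f"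
  using cmp_idt by auto

lemma idt_cmp_simp [simp]: "f \<in> Ar C \<Longrightarrow> Cod C f = B \<Longrightarrow> idt C B \<cdot> f = f"
  using idt_cmp by auto

lemma cmp_assoc_simp [simp]:
  assumes "f \<in> Ar C" "g \<in> Ar C" "h \<in> Ar C" "Dom C g = Cod C f" "Dom C h = Cod C g"
  shows "(h \<cdot> g) \<cdot> f = h \<cdot> (g \<cdot> f)"
  using cmp_assoc[of f "Dom C f" "Cod C f" g "Cod C g" h "Cod C h"] assms by auto

text \<open>The simp set nests composites to the right, which hides a left-hand side
  \<open>a \<cdot> b\<close> as soon as something is composed before it; this form and the next one
  apply an equation in front of a tail \<open>x\<close>.\<close>

lemma cmp_reassoc:
  assumes "a \<cdot> b = c \<cdot> d" "a \<in> Ar C" "b \<in> Ar C" "c \<in> Ar C" "d \<in> Ar C"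
    "Dom C a = Cod C b" "Dom C c = Cod C d" "x \<in> Ar C" "Cod C x = Dom C b" "Cod C x = Dom C d"
  shows "a \<cdot> (b \<cdot> x) = c \<cdot> (d \<cdot> x)"
  by (metis assms cmp_assoc_simp)

lemma cmp_reassoc1:
  assumes "a \<cdot> b = c" "a \<in> Ar C" "b \<in> Ar C"
    "Dom C a = Cod C b" "x \<in> Ar C" "Cod C x = Dom C b"
  shows "a \<cdot> (b \<cdot> x) = c \<cdot> x"
  by (metis assms cmp_assoc_simp)

lemma inverse_unique:
  assumes "is_inverse C f g" "is_inverse C f h"
  shows "g = h"
proof -
  have "(g \<cdot> f) \<cdot> h = g \<cdot> (f \<cdot> h)"
    using assms unfolding is_inverse_def by (intro cmp_assoc_simp) auto
  then show ?thesis
    using assms by (simp add: is_inverse_def)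
qed

lemma inv_ar_eq:
  assumes "is_inverse C f g"
  shows "inv_ar C f = g"
  unfolding inv_ar_def using assms inverse_unique by blast

lemma is_inverse_inv_ar:
  assumes "f \<in> isos C A B"
  shows "is_inverse C f (inv_ar C f)"
  using assms inv_ar_eq by (auto simp: isos_def)

lemma inv_ar_simps:
  assumes "f \<in> isos C A B"
  shows "f \<in> Ar C" "Dom C f = A" "Cod C f = B"
    "inv_ar C f \<in> Ar C" "Dom C (inv_ar C f) = B" "Cod C (inv_ar C f) = A"
    "inv_ar C f \<cdot> f = idt C A" "f \<cdot> inv_ar C f = idt C B"
    "x \<in> Ar C \<Longrightarrow> Cod C x = A \<Longrightarrow> inv_ar C f \<cdot> (f \<cdot> x) = x"
    "y \<in> Ar C \<Longrightarrow> Cod C y = B \<Longrightarrow> f \<cdot> (inv_ar C f \<cdot> y) = y"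
proof -
  note * = is_inverse_inv_ar[OF assms, unfolded is_inverse_def]
  show 1: "f \<in> Ar C" "Dom C f = A" "Cod C f = B"
    using assms by (auto simp: isos_def)
  then show 2: "inv_ar C f \<in> Ar C" "Dom C (inv_ar C f) = B" "Cod C (inv_ar C f) = A"
    "inv_ar C f \<cdot> f = idt C A" "f \<cdot> inv_ar C f = idt C B"
    using * by auto
  show "x \<in> Ar C \<Longrightarrow> Cod C x = A \<Longrightarrow> inv_ar C f \<cdot> (f \<cdot> x) = x"
    using cmp_reassoc1[OF 2(4)] 1 2 by auto
  show "y \<in> Ar C \<Longrightarrow> Cod C y = B \<Longrightarrow> f \<cdot> (inv_ar C f \<cdot> y) = y"
    using cmp_reassoc1[OF 2(5)] 1 2 by auto
qed

lemma isosI: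
  assumes "f \<in> homs C A B" "g \<in> homs C B A" "g \<cdot> f = idt C A" "f \<cdot> g = idt C B"
  shows "f \<in> isos C A B" "inv_ar C f = g"
proof -
  have "is_inverse C f g"
    using assms by (auto simp: is_inverse_def)
  then show "f \<in> isos C A B" "inv_ar C f = g"
    using assms inv_ar_eq by (auto simp: isos_def)
qed

lemma idt_iso:
  assumes "A \<in> Ob C"
  shows "idt C A \<in> isos C A A" "inv_ar C (idt C A) = idt C A"
  using isosI[of "idt C A" A A "idt C A"] assms by auto

lemma inv_ar_iso:
  assumes "f \<in> isos C A B"
  shows "inv_ar C f \<in> isos C B A"
  by (rule isosI(1)[where g = f]) (use inv_ar_simps[OF assms] in auto)

lemma iso_cancel_right:
  assumes "f \<in> isos C A B" "g \<in> Ar C" "h \<in> Ar C" "Dom C g = B" "Dom C h = B" "g \<cdot> f = h \<cdot> f"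
  shows "g = h"
proof -
  note * = inv_ar_simps[OF assms(1)]
  have "g \<cdot> (f \<cdot> inv_ar C f) = h \<cdot> (f \<cdot> inv_ar C f)"
    by (metis assms(2-6) *(1-6) cmp_assoc_simp)
  then show ?thesis
    using assms * by simp
qed

lemma iso_cancel_left:
  assumes "f \<in> isos C A B" "g \<in> Ar C" "h \<in> Ar C" "Cod C g = A" "Cod C h = A" "f \<cdot> g = f \<cdot> h"
  shows "g = h"
  by (metis assms inv_ar_simps(9))

lemma monoD:
  assumes "is_mono C f" "g \<in> Ar C" "h \<in> Ar C" "Dom C g = Dom C h" "Cod C g = Dom C f" "Cod C h = Dom C f"
    "f \<cdot> g = f \<cdot> h"
  shows "g = h"
  using assms unfolding is_mono_def by (metis homs_iff)

lemma epiD: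
  assumes "is_epi C f" "g \<in> Ar C" "h \<in> Ar C" "Cod C g = Cod C h" "Dom C g = Cod C f" "Dom C h = Cod C f"
    "g \<cdot> f = h \<cdot> f"
  shows "g = h"
  using assms unfolding is_epi_def by (metis homs_iff)

lemma iso_mono: "f \<in> isos C A B \<Longrightarrow> is_mono C f"
  unfolding is_mono_def by (metis homs_iff inv_ar_simps(1,2) iso_cancel_left)

lemma iso_epi: "f \<in> isos C A B \<Longrightarrow> is_epi C f"
  unfolding is_epi_def by (metis homs_iff inv_ar_simps(1,3) iso_cancel_right)

lemma mono_cmp:
  assumes "is_mono C f" "is_mono C g" "Dom C g = Cod C f"
  shows "is_mono C (g \<cdot> f)"
  unfolding is_mono_def
proof (intro conjI allI ballI impI)
  have [simp]: "f \<in> Ar C" "g \<in> Ar C"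
    using assms by (auto simp: is_mono_def)
  show "g \<cdot> f \<in> Ar C"
    using assms by simp
  fix X x y
  assume "x \<in> homs C X (Dom C (g \<cdot> f))" "y \<in> homs C X (Dom C (g \<cdot> f))" "(g \<cdot> f) \<cdot> x = (g \<cdot> f) \<cdot> y"
  then show "x = y"
    using assms by (rule_tac monoD[OF assms(1), of x y, OF _ _ _ _ _ monoD[OF assms(2), of "f \<cdot> x" "f \<cdot> y"]]) auto
qed

lemma epi_cmp:
  assumes "is_epi C f" "is_epi C g" "Dom C g = Cod C f"
  shows "is_epi C (g \<cdot> f)"
  unfolding is_epi_def
proof (intro conjI allI ballI impI)
  have [simp]: "f \<in> Ar C" "g \<in> Ar C"
    using assms by (auto simp: is_epi_def)
  show "g \<cdot> f \<in> Ar C"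
    using assms by simp
  fix X x y
  assume "x \<in> homs C (Cod C (g \<cdot> f)) X" "y \<in> homs C (Cod C (g \<cdot> f)) X" "x \<cdot> (g \<cdot> f) = y \<cdot> (g \<cdot> f)"
  then show "x = y"
    using assms by (rule_tac epiD[OF assms(2), of x y, OF _ _ _ _ _ epiD[OF assms(1), of "x \<cdot> g" "y \<cdot> g"]]) auto
qed

lemma mono_cancel:
  assumes "is_mono C (g \<cdot> f)" "f \<in> Ar C" "g \<in> Ar C" "Dom C g = Cod C f"
  shows "is_mono C f"
  unfolding is_mono_def
proof (intro conjI allI ballI impI)
  fix X x y
  assume *: "x \<in> homs C X (Dom C f)" "y \<in> homs C X (Dom C f)" "f \<cdot> x = f \<cdot> y"
  have "(g \<cdot> f) \<cdot> x = (g \<cdot> f) \<cdot> y"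
    using * assms(2-4) by simp
  then show "x = y"
    by (rule monoD[OF assms(1), rotated -1]) (use *(1,2) assms(2-4) in simp_all)
qed (rule assms)

lemma epi_cancel:
  assumes "is_epi C (g \<cdot> f)" "f \<in> Ar C" "g \<in> Ar C" "Dom C g = Cod C f"
  shows "is_epi C g"
  unfolding is_epi_def
proof (intro conjI allI ballI impI)
  fix X x y
  assume *: "x \<in> homs C (Cod C g) X" "y \<in> homs C (Cod C g) X" "x \<cdot> g = y \<cdot> g"
  have "x \<cdot> (g \<cdot> f) = y \<cdot> (g \<cdot> f)"
    by (rule cmp_reassoc[OF *(3)]) (use *(1,2) assms(2-4) in simp_all)
  then show "x = y"
    by (rule epiD[OF assms(1), rotated -1]) (use *(1,2) assms(2-4) in simp_all)
qed (rule assms)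

end

section \<open>Additive categories: negatives, zero objects, kernels and biproducts\<close>

context additive_category
begin

lemma hom_group_simps [simp]:
  "carrier (hom_group C A B) = homs C A B" "mult (hom_group C A B) = hadd C"
  "one (hom_group C A B) = hzero C A B"
  by (auto simp: hom_group_def)

lemma hzero_simps [simp]:
  assumes "A \<in> Ob C" "B \<in> Ob C"
  shows "hzero C A B \<in> Ar C" "Dom C (hzero C A B) = A" "Cod C (hzero C A B) = B"
proof -
  interpret comm_group "hom_group C A B"
    by (rule hom_comm_group[OF assms])
  show "hzero C A B \<in> Ar C" "Dom C (hzero C A B) = A" "Cod C (hzero C A B) = B"
    using one_closed by auto
qed

lemma hadd_simps [simp]:
  assumes "f \<in> Ar C" "g \<in> Ar C" "Dom C g = Dom C f" "Cod C g = Cod C f"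
  shows "hadd C f g \<in> Ar C" "Dom C (hadd C f g) = Dom C f" "Cod C (hadd C f g) = Cod C f"
proof -
  interpret comm_group "hom_group C (Dom C f) (Cod C f)"
    by (rule hom_comm_group) (use assms in auto)
  show "hadd C f g \<in> Ar C" "Dom C (hadd C f g) = Dom C f" "Cod C (hadd C f g) = Cod C f"
    using m_closed[of f g] assms by auto
qed

lemma hadd_assoc:
  assumes "f \<in> Ar C" "g \<in> Ar C" "h \<in> Ar C" "Dom C g = Dom C f" "Cod C g = Cod C f"
    "Dom C h = Dom C f" "Cod C h = Cod C f"
  shows "hadd C (hadd C f g) h = hadd C f (hadd C g h)"
proof -
  interpret comm_group "hom_group C (Dom C f) (Cod C f)"
    by (rule hom_comm_group) (use assms in auto)
  show ?thesis
    using m_assoc[of f g h] assms by auto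
qed

lemma hadd_comm:
  assumes "f \<in> Ar C" "g \<in> Ar C" "Dom C g = Dom C f" "Cod C g = Cod C f"
  shows "hadd C f g = hadd C g f"
proof -
  interpret comm_group "hom_group C (Dom C f) (Cod C f)"
    by (rule hom_comm_group) (use assms in auto)
  show ?thesis
    using m_comm[of f g] assms by auto
qed

lemma hadd_zero [simp]:
  assumes "f \<in> Ar C" "Dom C f = A" "Cod C f = B"
  shows "hadd C f (hzero C A B) = f" "hadd C (hzero C A B) f = f"
proof -
  interpret comm_group "hom_group C (Dom C f) (Cod C f)"
    by (rule hom_comm_group) (use assms in auto)
  show "hadd C f (hzero C A B) = f" "hadd C (hzero C A B) f = f"
    using r_one[of f] l_one[of f] assms by auto
qed

text \<open>The record of an additive category has only zero and addition, so negatives are taken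
  from the hom group selected by the endpoints of \<open>f\<close>.\<close>

definition hneg :: "'m \<Rightarrow> 'm" where
  "hneg f = m_inv (hom_group C (Dom C f) (Cod C f)) f"

lemma hneg_simps [simp]:
  assumes "f \<in> Ar C"
  shows "hneg f \<in> Ar C" "Dom C (hneg f) = Dom C f" "Cod C (hneg f) = Cod C f"
    "hadd C f (hneg f) = hzero C (Dom C f) (Cod C f)" "hadd C (hneg f) f = hzero C (Dom C f) (Cod C f)"
proof -
  interpret comm_group "hom_group C (Dom C f) (Cod C f)"
    by (rule hom_comm_group) (use assms in auto)
  show "hneg f \<in> Ar C" "Dom C (hneg f) = Dom C f" "Cod C (hneg f) = Cod C f"
    "hadd C f (hneg f) = hzero C (Dom C f) (Cod C f)" "hadd C (hneg f) f = hzero C (Dom C f) (Cod C f)"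
    using inv_closed[of f] r_inv[of f] l_inv[of f] assms by (auto simp: hneg_def)
qed

lemma hadd_cancel:
  assumes "hadd C f g = hadd C f h" "f \<in> Ar C" "g \<in> Ar C" "h \<in> Ar C" "Dom C g = Dom C f"
    "Cod C g = Cod C f" "Dom C h = Dom C f" "Cod C h = Cod C f"
  shows "g = h"
proof -
  interpret comm_group "hom_group C (Dom C f) (Cod C f)"
    by (rule hom_comm_group) (use assms in auto)
  show ?thesis
    using Units_l_cancel[of f g h] assms by auto
qed

lemma cmp_hadd_simp:
  assumes "f \<in> Ar C" "f' \<in> Ar C" "Dom C f' = Dom C f" "Cod C f' = Cod C f" "g \<in> Ar C" "Dom C g = Cod C f"
  shows "g \<cdot> hadd C f f' = hadd C (g \<cdot> f) (g \<cdot> f')"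
  using cmp_hadd[of f "Dom C f" "Cod C f" f' g "Cod C g"] assms by auto

lemma hadd_cmp_simp:
  assumes "f \<in> Ar C" "g \<in> Ar C" "g' \<in> Ar C" "Dom C g' = Dom C g" "Cod C g' = Cod C g" "Dom C g = Cod C f"
  shows "hadd C g g' \<cdot> f = hadd C (g \<cdot> f) (g' \<cdot> f)"
  using hadd_cmp[of f "Dom C f" "Cod C f" g "Cod C g" g'] assms by auto

text \<open>By biadditivity the composite \<open>x\<close> satisfies \<open>x + x = x\<close>, and
  cancellation gives zero.\<close>

lemma cmp_hzero [simp]:
  assumes "g \<in> Ar C" "A \<in> Ob C" "Dom C g = B"
  shows "g \<cdot> hzero C A B = hzero C A (Cod C g)"
proof -
  have B: "B \<in> Ob C"
    using assms by auto
  let ?x = "g \<cdot> hzero C A B"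
  have "hadd C ?x ?x = hadd C ?x (hzero C A (Cod C g))"
    using assms B by (simp flip: cmp_hadd_simp)
  then show ?thesis
    using assms B by (rule_tac hadd_cancel[of ?x]) auto
qed

lemma hzero_cmp [simp]:
  assumes "g \<in> Ar C" "B \<in> Ob C" "Cod C g = A"
  shows "hzero C A B \<cdot> g = hzero C (Dom C g) B"
proof -
  have A: "A \<in> Ob C"
    using assms by auto
  let ?x = "hzero C A B \<cdot> g"
  have "hadd C ?x ?x = hadd C ?x (hzero C (Dom C g) B)"
    using assms A by (simp flip: hadd_cmp_simp)
  then show ?thesis
    using assms A by (rule_tac hadd_cancel[of ?x]) auto
qed

lemma cmp_hneg:
  assumes "f \<in> Ar C" "g \<in> Ar C" "Dom C g = Cod C f"
  shows "g \<cdot> hneg f = hneg (g \<cdot> f)"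
  using assms by (rule_tac hadd_cancel[of "g \<cdot> f"]) (auto simp flip: cmp_hadd_simp)

lemma hneg_cmp:
  assumes "f \<in> Ar C" "g \<in> Ar C" "Dom C g = Cod C f"
  shows "hneg g \<cdot> f = hneg (g \<cdot> f)"
  using assms by (rule_tac hadd_cancel[of "g \<cdot> f"]) (auto simp flip: hadd_cmp_simp)

lemma hadd_hneg_eq_zero:
  assumes "f \<in> Ar C" "g \<in> Ar C" "Dom C g = Dom C f" "Cod C g = Cod C f"
    "hadd C f (hneg g) = hzero C (Dom C f) (Cod C f)"
  shows "f = g"
proof -
  have "hadd C (hneg g) f = hadd C (hneg g) g"
    using assms hadd_comm[of "hneg g" f] by simp
  then show ?thesis
    using assms by (rule_tac hadd_cancel[of "hneg g"]) auto
qed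

lemma monoI:
  assumes "f \<in> Ar C"
    and "\<And>g. g \<in> Ar C \<Longrightarrow> Cod C g = Dom C f \<Longrightarrow> f \<cdot> g = hzero C (Dom C g) (Cod C f) \<Longrightarrow>
      g = hzero C (Dom C g) (Dom C f)"
  shows "is_mono C f"
  unfolding is_mono_def
proof (intro conjI allI ballI impI)
  fix X g h
  assume gh: "g \<in> homs C X (Dom C f)" "h \<in> homs C X (Dom C f)" "f \<cdot> g = f \<cdot> h"
  have "f \<cdot> hadd C g (hneg h) = hzero C X (Cod C f)"
    using gh assms(1) by (auto simp: cmp_hadd_simp cmp_hneg)
  then have "hadd C g (hneg h) = hzero C X (Dom C f)"
    using assms(2)[of "hadd C g (hneg h)"] gh assms(1) by auto
  then show "g = h"
    using gh by (rule_tac hadd_hneg_eq_zero) auto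
qed (use assms in auto)

lemma epiI:
  assumes "f \<in> Ar C"
    and "\<And>g. g \<in> Ar C \<Longrightarrow> Dom C g = Cod C f \<Longrightarrow> g \<cdot> f = hzero C (Dom C f) (Cod C g) \<Longrightarrow>
      g = hzero C (Cod C f) (Cod C g)"
  shows "is_epi C f"
  unfolding is_epi_def
proof (intro conjI allI ballI impI)
  fix X g h
  assume gh: "g \<in> homs C (Cod C f) X" "h \<in> homs C (Cod C f) X" "g \<cdot> f = h \<cdot> f"
  have "hadd C g (hneg h) \<cdot> f = hzero C (Dom C f) X"
    using gh assms(1) by (auto simp: hadd_cmp_simp hneg_cmp)
  then have "hadd C g (hneg h) = hzero C (Cod C f) X"
    using assms(2)[of "hadd C g (hneg h)"] gh assms(1) by auto
  then show "g = h"
    using gh by (rule_tac hadd_hneg_eq_zero) auto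
qed (use assms in auto)

lemma mono_zeroD:
  assumes "is_mono C f" "g \<in> Ar C" "Cod C g = Dom C f" "f \<cdot> g = hzero C (Dom C g) (Cod C f)"
  shows "g = hzero C (Dom C g) (Dom C f)"
proof -
  have "f \<in> Ar C"
    using assms by (simp add: is_mono_def)
  with assms show ?thesis
    by (rule_tac monoD[OF assms(1)]) auto
qed

lemma epi_zeroD:
  assumes "is_epi C f" "g \<in> Ar C" "Dom C g = Cod C f" "g \<cdot> f = hzero C (Dom C f) (Cod C g)"
  shows "g = hzero C (Cod C f) (Cod C g)"
proof -
  have "f \<in> Ar C"
    using assms by (simp add: is_epi_def)
  with assms show ?thesis
    by (rule_tac epiD[OF assms(1)]) auto
qed

text \<open>Vanishing is encoded by one equation between endomorphisms rather than by unique arrows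
  as in \<open>is_zero_object\<close>: such an equation passes directly to tensor products and along
  monos, epis and isomorphisms.\<close>

definition null_ob :: "'o \<Rightarrow> bool" where
  "null_ob X \<longleftrightarrow> X \<in> Ob C \<and> idt C X = hzero C X X"

lemma null_ob_dom:
  assumes "null_ob X" "f \<in> Ar C" "Dom C f = X"
  shows "f = hzero C X (Cod C f)"
  by (metis assms cmp_hzero cmp_idt_simp null_ob_def)

lemma null_ob_cod:
  assumes "null_ob X" "f \<in> Ar C" "Cod C f = X"
  shows "f = hzero C (Dom C f) X"
  by (metis assms hzero_cmp idt_cmp_simp null_ob_def)

lemma null_ob_mono:
  assumes "is_mono C f" "f = hzero C (Dom C f) (Cod C f)"
  shows "null_ob (Dom C f)"
proof -
  have f: "f \<in> Ar C"
    using assms by (auto simp: is_mono_def)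
  have "f \<cdot> idt C (Dom C f) = hzero C (Dom C f) (Cod C f)"
    using f assms(2) by simp
  then have "idt C (Dom C f) = hzero C (Dom C f) (Dom C f)"
    using mono_zeroD[OF assms(1), of "idt C (Dom C f)"] f by simp
  then show ?thesis
    using f by (auto simp: null_ob_def)
qed

lemma null_ob_epi:
  assumes "is_epi C f" "f = hzero C (Dom C f) (Cod C f)"
  shows "null_ob (Cod C f)"
proof -
  have f: "f \<in> Ar C"
    using assms by (auto simp: is_epi_def)
  have "idt C (Cod C f) \<cdot> f = hzero C (Dom C f) (Cod C f)"
    using f assms(2) by simp
  then have "idt C (Cod C f) = hzero C (Cod C f) (Cod C f)"
    using epi_zeroD[OF assms(1), of "idt C (Cod C f)"] f by simp
  then show ?thesis
    using f by (auto simp: null_ob_def)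
qed

lemma null_ob_mono_into:
  assumes "is_mono C f" "null_ob (Cod C f)"
  shows "null_ob (Dom C f)"
proof (rule null_ob_mono[OF assms(1)])
  show "f = hzero C (Dom C f) (Cod C f)"
    using assms null_ob_cod[of "Cod C f" f] by (auto simp: is_mono_def)
qed

lemma null_ob_epi_from:
  assumes "is_epi C f" "null_ob (Dom C f)"
  shows "null_ob (Cod C f)"
proof (rule null_ob_epi[OF assms(1)])
  show "f = hzero C (Dom C f) (Cod C f)"
    using assms null_ob_dom[of "Dom C f" f] by (auto simp: is_epi_def)
qed

lemma null_ob_iso:
  assumes "f \<in> isos C X Y"
  shows "null_ob X \<longleftrightarrow> null_ob Y"
  using null_ob_mono_into[OF iso_mono[OF assms]] null_ob_epi_from[OF iso_epi[OF assms]]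
    inv_ar_simps[OF assms] by auto

lemma kernelD:
  assumes "is_kernel C f k"
  shows "f \<in> Ar C" "k \<in> Ar C" "Cod C k = Dom C f" "f \<cdot> k = hzero C (Dom C k) (Cod C f)"
    "h \<in> Ar C \<Longrightarrow> Cod C h = Dom C f \<Longrightarrow> f \<cdot> h = hzero C (Dom C h) (Cod C f) \<Longrightarrow>
      \<exists>l. l \<in> Ar C \<and> Dom C l = Dom C h \<and> Cod C l = Dom C k \<and> k \<cdot> l = h"
proof -
  show "f \<in> Ar C" "k \<in> Ar C" "Cod C k = Dom C f" "f \<cdot> k = hzero C (Dom C k) (Cod C f)"
    using assms by (auto simp: is_kernel_def)
  show "\<exists>l. l \<in> Ar C \<and> Dom C l = Dom C h \<and> Cod C l = Dom C k \<and> k \<cdot> l = h"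
    if "h \<in> Ar C" "Cod C h = Dom C f" "f \<cdot> h = hzero C (Dom C h) (Cod C f)"
  proof -
    have "h \<in> homs C (Dom C h) (Dom C f)"
      using that by simp
    then have "\<exists>!l. l \<in> homs C (Dom C h) (Dom C k) \<and> k \<cdot> l = h"
      using assms that(3) unfolding is_kernel_def by blast
    then show ?thesis
      by auto
  qed
qed

lemma cokernelD:
  assumes "is_cokernel C f c"
  shows "f \<in> Ar C" "c \<in> Ar C" "Dom C c = Cod C f" "c \<cdot> f = hzero C (Dom C f) (Cod C c)"
    "h \<in> Ar C \<Longrightarrow> Dom C h = Cod C f \<Longrightarrow> h \<cdot> f = hzero C (Dom C f) (Cod C h) \<Longrightarrow>
      \<exists>l. l \<in> Ar C \<and> Cod C l = Cod C h \<and> Dom C l = Cod C c \<and> l \<cdot> c = h"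
proof -
  show "f \<in> Ar C" "c \<in> Ar C" "Dom C c = Cod C f" "c \<cdot> f = hzero C (Dom C f) (Cod C c)"
    using assms by (auto simp: is_cokernel_def)
  show "\<exists>l. l \<in> Ar C \<and> Cod C l = Cod C h \<and> Dom C l = Cod C c \<and> l \<cdot> c = h"
    if "h \<in> Ar C" "Dom C h = Cod C f" "h \<cdot> f = hzero C (Dom C f) (Cod C h)"
  proof -
    have "h \<in> homs C (Cod C f) (Cod C h)"
      using that by simp
    then have "\<exists>!l. l \<in> homs C (Cod C c) (Cod C h) \<and> l \<cdot> c = h"
      using assms that(3) unfolding is_cokernel_def by blast
    then show ?thesis
      by auto
  qed
qed

lemma kernel_mono:
  assumes "is_kernel C f k"
  shows "is_mono C k"
  unfolding is_mono_def
proof (intro conjI allI ballI impI)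
  fix X g h
  assume gh: "g \<in> homs C X (Dom C k)" "h \<in> homs C X (Dom C k)" "k \<cdot> g = k \<cdot> h"
  have "\<exists>!l. l \<in> homs C X (Dom C k) \<and> k \<cdot> l = k \<cdot> g"
  proof -
    have "k \<cdot> g \<in> homs C X (Dom C f)"
      using gh kernelD[OF assms] by auto
    moreover have "f \<cdot> (k \<cdot> g) = hzero C X (Cod C f)"
      using gh kernelD(1-3)[OF assms] cmp_reassoc1[OF kernelD(4)[OF assms], of g] by auto
    ultimately show ?thesis
      using assms unfolding is_kernel_def by blast
  qed
  with gh show "g = h"
    by metis
qed (use kernelD[OF assms] in auto)

lemma cokernel_epi:
  assumes "is_cokernel C f c"
  shows "is_epi C c"
  unfolding is_epi_def
proof (intro conjI allI ballI impI)
  fix X g h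
  assume gh: "g \<in> homs C (Cod C c) X" "h \<in> homs C (Cod C c) X" "g \<cdot> c = h \<cdot> c"
  have "\<exists>!l. l \<in> homs C (Cod C c) X \<and> l \<cdot> c = g \<cdot> c"
  proof -
    have "g \<cdot> c \<in> homs C (Cod C f) X"
      using gh cokernelD[OF assms] by auto
    moreover have "(g \<cdot> c) \<cdot> f = hzero C (Dom C f) X"
      using gh cokernelD[OF assms] by auto
    ultimately show ?thesis
      using assms unfolding is_cokernel_def by blast
  qed
  with gh show "g = h"
    by metis
qed (use cokernelD[OF assms] in auto)

text \<open>Uniqueness of the factorisation is the mono property of \<open>k\<close>, so only
  existence has to be supplied.\<close>

lemma is_kernelI:
  assumes "f \<in> Ar C" "is_mono C k" "Cod C k = Dom C f" "f \<cdot> k = hzero C (Dom C k) (Cod C f)"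
    "\<And>h. h \<in> Ar C \<Longrightarrow> Cod C h = Dom C f \<Longrightarrow> f \<cdot> h = hzero C (Dom C h) (Cod C f) \<Longrightarrow>
      \<exists>l. l \<in> Ar C \<and> Dom C l = Dom C h \<and> Cod C l = Dom C k \<and> k \<cdot> l = h"
  shows "is_kernel C f k"
proof -
  have "k \<in> Ar C"
    using assms by (auto simp: is_mono_def)
  moreover have "\<exists>!l. l \<in> homs C X (Dom C k) \<and> k \<cdot> l = h"
    if h: "h \<in> homs C X (Dom C f)" "f \<cdot> h = hzero C X (Cod C f)" for X h
  proof -
    obtain l where l: "l \<in> Ar C" "Dom C l = Dom C h" "Cod C l = Dom C k" "k \<cdot> l = h"
      using assms(5)[of h] h by auto
    show ?thesis
    proof (rule ex1I[of _ l])
      fix l'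
      assume "l' \<in> homs C X (Dom C k) \<and> k \<cdot> l' = h"
      then show "l' = l"
        using l h by (rule_tac monoD[OF assms(2)]) auto
    qed (use l h in auto)
  qed
  ultimately show ?thesis
    using assms(1-4) unfolding is_kernel_def by blast
qed

lemma is_cokernelI:
  assumes "f \<in> Ar C" "is_epi C c" "Dom C c = Cod C f" "c \<cdot> f = hzero C (Dom C f) (Cod C c)"
    "\<And>h. h \<in> Ar C \<Longrightarrow> Dom C h = Cod C f \<Longrightarrow> h \<cdot> f = hzero C (Dom C f) (Cod C h) \<Longrightarrow>
      \<exists>l. l \<in> Ar C \<and> Cod C l = Cod C h \<and> Dom C l = Cod C c \<and> l \<cdot> c = h"
  shows "is_cokernel C f c"
proof -
  have "c \<in> Ar C"
    using assms by (auto simp: is_epi_def)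
  moreover have "\<exists>!l. l \<in> homs C (Cod C c) X \<and> l \<cdot> c = h"
    if h: "h \<in> homs C (Cod C f) X" "h \<cdot> f = hzero C (Dom C f) X" for X h
  proof -
    obtain l where l: "l \<in> Ar C" "Cod C l = Cod C h" "Dom C l = Cod C c" "l \<cdot> c = h"
      using assms(5)[of h] h by auto
    show ?thesis
    proof (rule ex1I[of _ l])
      fix l'
      assume "l' \<in> homs C (Cod C c) X \<and> l' \<cdot> c = h"
      then show "l' = l"
        using l h by (rule_tac epiD[OF assms(2)]) auto
    qed (use l h in auto)
  qed
  ultimately show ?thesis
    using assms(1-4) unfolding is_cokernel_def by blast
qed

lemma biproductD:
  assumes "is_biproduct C A B P i j p q"
  shows "i \<in> Ar C" "j \<in> Ar C" "p \<in> Ar C" "q \<in> Ar C" "Dom C i = A" "Dom C j = B" "Cod C i = P" "Cod C j = P"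
    "Dom C p = P" "Dom C q = P" "Cod C p = A" "Cod C q = B" "A \<in> Ob C" "B \<in> Ob C" "P \<in> Ob C"
    "p \<cdot> i = idt C A" "q \<cdot> j = idt C B" "p \<cdot> j = hzero C B A" "q \<cdot> i = hzero C A B"
    "hadd C (i \<cdot> p) (j \<cdot> q) = idt C P"
  using assms unfolding is_biproduct_def by auto

lemma biproduct_swap:
  assumes "is_biproduct C A B P i j p q"
  shows "is_biproduct C B A P j i q p"
proof -
  note * = biproductD[OF assms]
  have "hadd C (j \<cdot> q) (i \<cdot> p) = idt C P"
    using hadd_comm[of "i \<cdot> p" "j \<cdot> q"] * by auto
  then show ?thesis
    using * by (auto simp: is_biproduct_def)
qed

lemma split_mono:
  assumes "f \<in> Ar C" "g \<in> Ar C" "Dom C g = Cod C f" "g \<cdot> f = idt C (Dom C f)"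
  shows "is_mono C f"
proof (rule monoI)
  have cg: "Cod C g = Dom C f"
    using assms by (metis cmp_simps(3) dom_closed idt_simps(3))
  fix x
  assume x: "x \<in> Ar C" "Cod C x = Dom C f" "f \<cdot> x = hzero C (Dom C x) (Cod C f)"
  have "g \<cdot> (f \<cdot> x) = x"
    using cmp_reassoc1[OF assms(4), of x] assms x cg by simp
  then show "x = hzero C (Dom C x) (Dom C f)"
    using assms x cg by simp
qed (use assms in auto)

lemma split_epi:
  assumes "f \<in> Ar C" "g \<in> Ar C" "Dom C g = Cod C f" "g \<cdot> f = idt C (Dom C f)"
  shows "is_epi C g"
proof (rule epiI)
  have cg: "Cod C g = Dom C f"
    using assms by (metis cmp_simps(3) dom_closed idt_simps(3))
  fix x
  assume x: "x \<in> Ar C" "Dom C x = Cod C g" "x \<cdot> g = hzero C (Dom C g) (Cod C x)"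
  have "x \<cdot> (g \<cdot> f) = hzero C (Dom C g) (Cod C x) \<cdot> f"
    using cmp_reassoc1[OF x(3), of f] assms x cg by simp
  then show "x = hzero C (Cod C g) (Cod C x)"
    using assms x cg by simp
qed (use assms in auto)

lemma biproduct_short_exact:
  assumes "is_biproduct C A B P i j p q"
  shows "short_exact C i q"
proof -
  note * [simp] = biproductD[OF assms]
  show ?thesis
    unfolding short_exact_def
  proof
    show "is_kernel C q i"
    proof (rule is_kernelI)
      show "is_mono C i"
        by (rule split_mono[where g = p]) auto
      fix h
      assume h: "h \<in> Ar C" "Cod C h = Dom C q" "q \<cdot> h = hzero C (Dom C h) (Cod C q)"
      have "h = hadd C (i \<cdot> p) (j \<cdot> q) \<cdot> h"
        using h by simp
      also have "\<dots> = i \<cdot> (p \<cdot> h)"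
        using h by (simp add: hadd_cmp_simp del: *(20))
      finally show "\<exists>l. l \<in> Ar C \<and> Dom C l = Dom C h \<and> Cod C l = Dom C i \<and> i \<cdot> l = h"
        using h by (intro exI[of _ "p \<cdot> h"]) auto
    qed auto
    show "is_cokernel C i q"
    proof (rule is_cokernelI)
      show "is_epi C q"
        by (rule split_epi[where f = j]) auto
      fix h
      assume h: "h \<in> Ar C" "Dom C h = Cod C i" "h \<cdot> i = hzero C (Dom C i) (Cod C h)"
      have "h = h \<cdot> hadd C (i \<cdot> p) (j \<cdot> q)"
        using h by simp
      also have "\<dots> = h \<cdot> (j \<cdot> q)"
        using h cmp_reassoc1[OF h(3), of p] by (simp add: cmp_hadd_simp del: *(20))
      finally show "\<exists>l. l \<in> Ar C \<and> Cod C l = Cod C h \<and> Dom C l = Cod C q \<and> l \<cdot> q = h"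
        using h by (intro exI[of _ "h \<cdot> j"]) auto
    qed auto
  qed
qed

end

section \<open>Abelian categories: normal monos and epis, image factorisation\<close>

context abelian_category
begin

text \<open>Some \<open>g\<close> has \<open>f\<close> as kernel. It kills \<open>f\<close>, hence
  factors through \<open>c\<close>; so whatever \<open>c\<close> kills is killed by \<open>g\<close>
  and factors through \<open>f\<close>.\<close>

lemma mono_short_exact:
  assumes "is_mono C f" "is_cokernel C f c"
  shows "short_exact C f c"
proof -
  obtain g where g: "is_kernel C g f"
    using mono_normal assms by auto
  note G = kernelD[OF g] and K = cokernelD[OF assms(2)]
  obtain g' where g': "g' \<in> Ar C" "Cod C g' = Cod C g" "Dom C g' = Cod C c" "g' \<cdot> c = g"
    using K(5)[of g] G by auto
  have "is_kernel C c f"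
  proof (rule is_kernelI)
    fix h
    assume h: "h \<in> Ar C" "Cod C h = Dom C c" "c \<cdot> h = hzero C (Dom C h) (Cod C c)"
    have "g \<cdot> h = g' \<cdot> (c \<cdot> h)"
      using g' h K by (metis cmp_assoc_simp)
    then show "\<exists>l. l \<in> Ar C \<and> Dom C l = Dom C h \<and> Cod C l = Dom C f \<and> f \<cdot> l = h"
      using G(5)[of h] G h K g' by auto
  qed (use K assms in auto)
  then show ?thesis
    using assms by (simp add: short_exact_def)
qed

lemma epi_short_exact:
  assumes "is_epi C f" "is_kernel C f k"
  shows "short_exact C k f"
proof -
  obtain g where g: "is_cokernel C g f"
    using epi_normal assms by auto
  note G = cokernelD[OF g] and K = kernelD[OF assms(2)]
  obtain g' where g': "g' \<in> Ar C" "Dom C g' = Dom C g" "Cod C g' = Dom C k" "k \<cdot> g' = g"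
    using K(5)[of g] G by auto
  have "is_cokernel C k f"
  proof (rule is_cokernelI)
    fix h
    assume h: "h \<in> Ar C" "Dom C h = Cod C k" "h \<cdot> k = hzero C (Dom C k) (Cod C h)"
    have "h \<cdot> g = (h \<cdot> k) \<cdot> g'"
      using g' h K by (metis cmp_assoc_simp)
    then show "\<exists>l. l \<in> Ar C \<and> Cod C l = Cod C h \<and> Dom C l = Cod C f \<and> l \<cdot> f = h"
      using G(5)[of h] G h K g' by auto
  qed (use K assms in auto)
  then show ?thesis
    using assms by (simp add: short_exact_def)
qed

text \<open>A mono is the kernel of some \<open>g\<close>, and \<open>f\<close> being epi forces
  \<open>g = 0\<close>; the identity of the codomain then factors through \<open>f\<close>.\<close>

lemma mono_epi_iso:
  assumes "is_mono C f" "is_epi C f"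
  shows "f \<in> isos C (Dom C f) (Cod C f)"
proof -
  obtain g where g: "is_kernel C g f"
    using mono_normal assms by auto
  note G = kernelD[OF g]
  have g0: "g = hzero C (Cod C f) (Cod C g)"
    using epi_zeroD[OF assms(2), of g] G by simp
  have "g \<cdot> idt C (Cod C f) = hzero C (Cod C f) (Cod C g)"
    using G g0 by simp
  then obtain l where l: "l \<in> Ar C" "Dom C l = Cod C f" "Cod C l = Dom C f" "f \<cdot> l = idt C (Cod C f)"
    using G(1-4) G(5)[of "idt C (Cod C f)"] by auto
  have "l \<cdot> f = idt C (Dom C f)"
    using l G by (rule_tac monoD[OF assms(1)]) (auto simp: cmp_reassoc1[OF l(4)])
  then show ?thesis
    using l G by (intro isosI(1)[where g = l]) auto
qed

text \<open>Take for \<open>m\<close> the kernel of the cokernel. The content is that the induced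
  \<open>e\<close> is epi; it is then the cokernel of its kernel, which is \<open>k\<close> because
  \<open>m\<close> is mono.\<close>

lemma image_factor:
  assumes k: "is_kernel C f k" and c: "is_cokernel C f c"
  shows "\<exists>m e. is_kernel C c m \<and> is_cokernel C k e \<and> Dom C e = Dom C f \<and> Cod C m = Cod C f \<and>
    Dom C m = Cod C e \<and> f = m \<cdot> e"
proof -
  note K = kernelD[OF k] and L = cokernelD[OF c]
  obtain m where m: "is_kernel C c m"
    using ex_kernel L by auto
  note M = kernelD[OF m]
  obtain e where e: "e \<in> Ar C" "Dom C e = Dom C f" "Cod C e = Dom C m" "m \<cdot> e = f"
    using M(5)[of f] L by auto
  have me: "is_mono C m"
    by (rule kernel_mono[OF m])
  have ee: "is_epi C e"
  proof (rule epiI)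
    fix x
    assume x: "x \<in> Ar C" "Dom C x = Cod C e" "x \<cdot> e = hzero C (Dom C e) (Cod C x)"
    obtain n where n: "is_kernel C x n"
      using ex_kernel x by auto
    note N = kernelD[OF n]
    obtain e' where e': "e' \<in> Ar C" "Dom C e' = Dom C e" "Cod C e' = Dom C n" "n \<cdot> e' = e"
      using N(5)[of e] x e by auto
    \<comment> \<open>The mono \<open>m \<cdot> n\<close> is the kernel of some \<open>g\<close>.
      Since \<open>f\<close> factors through it, \<open>g\<close> kills \<open>f\<close>, hence
      factors through \<open>c\<close> and kills \<open>m\<close>. So \<open>m\<close> factors
      through \<open>m \<cdot> n\<close>, which makes \<open>n\<close> a split epi, and
      \<open>x \<cdot> n = 0\<close> gives \<open>x = 0\<close>.\<close>
    have "is_mono C (m \<cdot> n)"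
      using mono_cmp[OF kernel_mono[OF n] me] N x e by auto
    then obtain g where g: "is_kernel C g (m \<cdot> n)"
      using mono_normal by auto
    note G = kernelD[OF g]
    have gN: "Dom C g = Cod C f" "Dom C n \<in> Ob C"
      using G M N x e L by auto
    have "g \<cdot> f = (g \<cdot> (m \<cdot> n)) \<cdot> e'"
      using G(1) N M e e' x gN L by (simp del: G(4))
    also have "\<dots> = hzero C (Dom C f) (Cod C g)"
      using G(1) G(4) N(1-3) M(1-3) e e' x by simp
    finally obtain g' where g': "g' \<in> Ar C" "Cod C g' = Cod C g" "Dom C g' = Cod C c" "g' \<cdot> c = g"
      using L(5)[of g] G(1) gN by auto
    have "g \<cdot> m = g' \<cdot> (c \<cdot> m)"
      using g' L M by (metis cmp_assoc_simp)
    also have "\<dots> = hzero C (Dom C m) (Cod C g)"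
      using g' L M by simp
    finally obtain y where y: "y \<in> Ar C" "Dom C y = Dom C m" "Cod C y = Dom C (m \<cdot> n)" "(m \<cdot> n) \<cdot> y = m"
      using G(5)[of m] M L gN by auto
    have y': "Cod C y = Dom C n" "m \<cdot> (n \<cdot> y) = m"
      using y N M x e by auto
    have ny: "n \<cdot> y = idt C (Dom C m)"
      using y y' N x e M by (rule_tac monoD[OF me]) auto
    have "x = x \<cdot> (n \<cdot> y)"
      using ny x e by simp
    also have "\<dots> = hzero C (Cod C e) (Cod C x)"
      using cmp_reassoc1[OF N(4), of y] N x e y y' M by simp
    finally show "x = hzero C (Cod C e) (Cod C x)" .
  qed (use e in auto)
  have "is_kernel C e k"
  proof (rule is_kernelI)
    show "is_mono C k"
      by (rule kernel_mono[OF k])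
    have "m \<cdot> (e \<cdot> k) = hzero C (Dom C k) (Cod C m)"
      using K L M e by (metis cmp_assoc_simp)
    then show "e \<cdot> k = hzero C (Dom C k) (Cod C e)"
      using mono_zeroD[OF me, of "e \<cdot> k"] K M e by auto
    fix h
    assume h: "h \<in> Ar C" "Cod C h = Dom C e" "e \<cdot> h = hzero C (Dom C h) (Cod C e)"
    have "f \<cdot> h = m \<cdot> (e \<cdot> h)"
      using h e M by (metis cmp_assoc_simp)
    also have "\<dots> = hzero C (Dom C h) (Cod C f)"
      using h e M L by simp
    finally show "\<exists>l. l \<in> Ar C \<and> Dom C l = Dom C h \<and> Cod C l = Dom C k \<and> k \<cdot> l = h"
      using K(5)[of h] h e by auto
  qed (use e K in auto)
  then have "is_cokernel C k e"
    using epi_short_exact[OF ee] by (simp add: short_exact_def)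
  then show ?thesis
    using m e M L by (intro exI[of _ m] exI[of _ e]) auto
qed

end

section \<open>Coherence and exactness of the tensor product\<close>

context category
begin

lemma iso_cmp:
  assumes "f \<in> isos C A B" "g \<in> isos C B D"
  shows "g \<cdot> f \<in> isos C A D"
  by (rule isosI(1)[where g = "inv_ar C f \<cdot> inv_ar C g"])
    (use inv_ar_simps[OF assms(1)] inv_ar_simps[OF assms(2)] in simp_all)

end

section \<open>Naturality and coherence of the unitors, and duals\<close>

context tensor_category
begin

abbreviation "I \<equiv> unt C"
abbreviation "iasc A B D \<equiv> inv_ar C (asc C A B D)"
abbreviation "ilun A \<equiv> inv_ar C (lun C A)"
abbreviation "irun A \<equiv> inv_ar C (run C A)"

declare tob_closed [simp] unt_closed [simp] tar_idt [simp] brd_symmetric [simp]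

lemma tar_simps [simp]:
  assumes "f \<in> Ar C" "g \<in> Ar C"
  shows "f \<otimes>\<^sub>a g \<in> Ar C" "Dom C (f \<otimes>\<^sub>a g) = Dom C f \<otimes>\<^sub>o Dom C g" "Cod C (f \<otimes>\<^sub>a g) = Cod C f \<otimes>\<^sub>o Cod C g"
  using tar_closed[of f "Dom C f" "Cod C f" g "Dom C g" "Cod C g"] assms by auto

lemmas asc_simps [simp] = inv_ar_simps[OF asc_iso]
lemmas lun_simps [simp] = inv_ar_simps[OF lun_iso]
lemmas run_simps [simp] = inv_ar_simps[OF run_iso]
lemmas brd_simps [simp] = inv_ar_simps(1-3)[OF brd_iso]

lemma tar_cmp_simp:
  assumes "f \<in> Ar C" "f' \<in> Ar C" "g \<in> Ar C" "g' \<in> Ar C" "Dom C f' = Cod C f" "Dom C g' = Cod C g"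
  shows "(f' \<otimes>\<^sub>a g') \<cdot> (f \<otimes>\<^sub>a g) = (f' \<cdot> f) \<otimes>\<^sub>a (g' \<cdot> g)"
  using tar_cmp[of f "Dom C f" "Cod C f" f' "Cod C f'" g "Dom C g" "Cod C g" g' "Cod C g'"] assms by auto

lemma tar_cmp_reassoc:
  assumes "f \<in> Ar C" "f' \<in> Ar C" "g \<in> Ar C" "g' \<in> Ar C" "Dom C f' = Cod C f" "Dom C g' = Cod C g"
    "x \<in> Ar C" "Cod C x = Dom C f \<otimes>\<^sub>o Dom C g"
  shows "(f' \<otimes>\<^sub>a g') \<cdot> ((f \<otimes>\<^sub>a g) \<cdot> x) = ((f' \<cdot> f) \<otimes>\<^sub>a (g' \<cdot> g)) \<cdot> x"
  by (rule cmp_reassoc1[OF tar_cmp_simp]) (use assms in simp_all)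

lemmas tar_merge = tar_cmp_simp tar_cmp_reassoc

lemma whisker_left:
  assumes "A \<in> Ob C" "f \<in> Ar C" "g \<in> Ar C" "Dom C g = Cod C f"
  shows "idt C A \<otimes>\<^sub>a (g \<cdot> f) = (idt C A \<otimes>\<^sub>a g) \<cdot> (idt C A \<otimes>\<^sub>a f)"
  using assms by (simp add: tar_cmp_simp)

lemma whisker_right:
  assumes "A \<in> Ob C" "f \<in> Ar C" "g \<in> Ar C" "Dom C g = Cod C f"
  shows "(g \<cdot> f) \<otimes>\<^sub>a idt C A = (g \<otimes>\<^sub>a idt C A) \<cdot> (f \<otimes>\<^sub>a idt C A)"
  using assms by (simp add: tar_cmp_simp)

lemma tar_iso:
  assumes "f \<in> isos C A A'" "g \<in> isos C B B'"
  shows "f \<otimes>\<^sub>a g \<in> isos C (A \<otimes>\<^sub>o B) (A' \<otimes>\<^sub>o B')"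
proof -
  note * = inv_ar_simps[OF assms(1)] inv_ar_simps[OF assms(2)]
  have ob: "A \<in> Ob C" "A' \<in> Ob C" "B \<in> Ob C" "B' \<in> Ob C"
    using *(1-3,11-13) dom_closed cod_closed by metis+
  show ?thesis
    by (rule isosI(1)[where g = "inv_ar C f \<otimes>\<^sub>a inv_ar C g"]) (use * ob in \<open>simp_all add: tar_cmp_simp\<close>)
qed

lemma asc_nat:
  assumes "f \<in> Ar C" "g \<in> Ar C" "h \<in> Ar C" "Cod C f = A'" "Cod C g = B'" "Cod C h = D'"
  shows "asc C A' B' D' \<cdot> ((f \<otimes>\<^sub>a g) \<otimes>\<^sub>a h) = (f \<otimes>\<^sub>a (g \<otimes>\<^sub>a h)) \<cdot> asc C (Dom C f) (Dom C g) (Dom C h)"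
  using asc_natural[of f "Dom C f" A' g "Dom C g" B' h "Dom C h" D'] assms by simp

lemma asc_nat_reassoc:
  assumes "f \<in> Ar C" "g \<in> Ar C" "h \<in> Ar C" "Cod C f = A'" "Cod C g = B'" "Cod C h = D'"
    "x \<in> Ar C" "Cod C x = (Dom C f \<otimes>\<^sub>o Dom C g) \<otimes>\<^sub>o Dom C h"
  shows "asc C A' B' D' \<cdot> (((f \<otimes>\<^sub>a g) \<otimes>\<^sub>a h) \<cdot> x) =
    (f \<otimes>\<^sub>a (g \<otimes>\<^sub>a h)) \<cdot> (asc C (Dom C f) (Dom C g) (Dom C h) \<cdot> x)"
  by (rule cmp_reassoc[OF asc_nat]) (use assms in auto)

lemma iasc_nat:
  assumes "f \<in> Ar C" "g \<in> Ar C" "h \<in> Ar C" "Cod C f = A'" "Cod C g = B'" "Cod C h = D'"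
  shows "iasc A' B' D' \<cdot> (f \<otimes>\<^sub>a (g \<otimes>\<^sub>a h)) = ((f \<otimes>\<^sub>a g) \<otimes>\<^sub>a h) \<cdot> iasc (Dom C f) (Dom C g) (Dom C h)"
proof -
  have ob: "Dom C f \<in> Ob C" "Dom C g \<in> Ob C" "Dom C h \<in> Ob C" "A' \<in> Ob C" "B' \<in> Ob C" "D' \<in> Ob C"
    using assms by auto
  show ?thesis
    by (rule iso_cancel_left[OF asc_iso[of A' B' D']])
      (use ob assms in \<open>simp_all add: asc_nat_reassoc\<close>)
qed

lemma lun_nat: "f \<in> Ar C \<Longrightarrow> Cod C f = B \<Longrightarrow> lun C B \<cdot> (idt C I \<otimes>\<^sub>a f) = f \<cdot> lun C (Dom C f)"
  using lun_natural[of f "Dom C f" B] by simp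

lemma run_nat: "f \<in> Ar C \<Longrightarrow> Cod C f = B \<Longrightarrow> run C B \<cdot> (f \<otimes>\<^sub>a idt C I) = f \<cdot> run C (Dom C f)"
  using run_natural[of f "Dom C f" B] by simp

lemma lun_nat_reassoc:
  assumes "f \<in> Ar C" "Cod C f = B" "x \<in> Ar C" "Cod C x = I \<otimes>\<^sub>o Dom C f"
  shows "lun C B \<cdot> ((idt C I \<otimes>\<^sub>a f) \<cdot> x) = f \<cdot> (lun C (Dom C f) \<cdot> x)"
  by (rule cmp_reassoc[OF lun_nat]) (use assms in auto)

lemma ilun_nat:
  assumes "f \<in> Ar C" "Cod C f = B"
  shows "ilun B \<cdot> f = (idt C I \<otimes>\<^sub>a f) \<cdot> ilun (Dom C f)"
proof -
  have ob: "Dom C f \<in> Ob C" "B \<in> Ob C"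
    using assms by auto
  show ?thesis
    by (rule iso_cancel_left[OF lun_iso[of B]]) (use ob assms in \<open>simp_all add: lun_nat_reassoc\<close>)
qed

text \<open>Naturality of the invertible unitor conjugates
  \<open>idt C I \<otimes>\<^sub>a f\<close> into \<open>f\<close>; an identity may therefore be
  proved after tensoring with the unit.\<close>

lemma lun_faithful:
  assumes "idt C I \<otimes>\<^sub>a f = idt C I \<otimes>\<^sub>a g" "f \<in> Ar C" "g \<in> Ar C" "Dom C f = Dom C g" "Cod C f = Cod C g"
  shows "f = g"
proof (rule iso_cancel_right[OF lun_iso[of "Dom C f"]])
  show "f \<cdot> lun C (Dom C f) = g \<cdot> lun C (Dom C f)"
    using lun_nat[of f "Cod C f"] lun_nat[of g "Cod C f"] assms by simp
qed (use assms in auto)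

lemma run_faithful:
  assumes "f \<otimes>\<^sub>a idt C I = g \<otimes>\<^sub>a idt C I" "f \<in> Ar C" "g \<in> Ar C" "Dom C f = Dom C g" "Cod C f = Cod C g"
  shows "f = g"
proof (rule iso_cancel_right[OF run_iso[of "Dom C f"]])
  show "f \<cdot> run C (Dom C f) = g \<cdot> run C (Dom C f)"
    using run_nat[of f "Cod C f"] run_nat[of g "Cod C f"] assms by simp
qed (use assms in auto)

lemmas triangle_reassoc = cmp_reassoc1[OF triangle]

text \<open>The next three lemmas are Kelly's: these identities follow from the pentagon and the triangle.\<close>

lemma lun_tensor:
  assumes [simp]: "A \<in> Ob C" "B \<in> Ob C"
  shows "lun C (A \<otimes>\<^sub>o B) \<cdot> asc C I A B = lun C A \<otimes>\<^sub>a idt C B"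
proof -
  \<comment> \<open>Tensoring with the unit makes room for the pentagon on
    \<open>I, I, A, B\<close>; this invertible composite is the tail of its right-hand side and is
    cancelled at the end.\<close>
  let ?X = "asc C I (I \<otimes>\<^sub>o A) B \<cdot> (asc C I I A \<otimes>\<^sub>a idt C B)"
  have X: "?X \<in> isos C (((I \<otimes>\<^sub>o I) \<otimes>\<^sub>o A) \<otimes>\<^sub>o B) (I \<otimes>\<^sub>o ((I \<otimes>\<^sub>o A) \<otimes>\<^sub>o B))"
    by (rule iso_cmp[OF tar_iso[OF asc_iso idt_iso(1)] asc_iso]) auto
  have "(idt C I \<otimes>\<^sub>a (lun C (A \<otimes>\<^sub>o B) \<cdot> asc C I A B)) \<cdot> ?X =
      (idt C I \<otimes>\<^sub>a lun C (A \<otimes>\<^sub>o B)) \<cdot> ((idt C I \<otimes>\<^sub>a asc C I A B) \<cdot> ?X)"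
    by (simp add: whisker_left)
  also have "\<dots> = (idt C I \<otimes>\<^sub>a lun C (A \<otimes>\<^sub>o B)) \<cdot> (asc C I I (A \<otimes>\<^sub>o B) \<cdot> asc C (I \<otimes>\<^sub>o I) A B)"
    by (simp add: pentagon)
  also have "\<dots> = (run C I \<otimes>\<^sub>a (idt C A \<otimes>\<^sub>a idt C B)) \<cdot> asc C (I \<otimes>\<^sub>o I) A B"
    by (simp add: triangle_reassoc)
  also have "\<dots> = asc C I A B \<cdot> ((run C I \<otimes>\<^sub>a idt C A) \<otimes>\<^sub>a idt C B)"
    by (subst asc_nat) (simp_all del: tar_idt)
  also have "\<dots> = asc C I A B \<cdot> (((idt C I \<otimes>\<^sub>a lun C A) \<otimes>\<^sub>a idt C B) \<cdot> (asc C I I A \<otimes>\<^sub>a idt C B))"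
    by (simp add: triangle flip: whisker_right)
  also have "\<dots> = (idt C I \<otimes>\<^sub>a (lun C A \<otimes>\<^sub>a idt C B)) \<cdot> ?X"
    by (simp add: asc_nat_reassoc)
  finally have "idt C I \<otimes>\<^sub>a (lun C (A \<otimes>\<^sub>o B) \<cdot> asc C I A B) = idt C I \<otimes>\<^sub>a (lun C A \<otimes>\<^sub>a idt C B)"
    by (rule iso_cancel_right[OF X, rotated -1]) simp_all
  then show ?thesis
    by (rule lun_faithful) simp_all
qed

lemma run_tensor:
  assumes [simp]: "A \<in> Ob C" "B \<in> Ob C"
  shows "(idt C A \<otimes>\<^sub>a run C B) \<cdot> asc C A B I = run C (A \<otimes>\<^sub>o B)"
proof -
  have "asc C A B I \<cdot> (((idt C A \<otimes>\<^sub>a run C B) \<cdot> asc C A B I) \<otimes>\<^sub>a idt C I) =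
      asc C A B I \<cdot> (((idt C A \<otimes>\<^sub>a run C B) \<otimes>\<^sub>a idt C I) \<cdot> (asc C A B I \<otimes>\<^sub>a idt C I))"
    by (simp add: whisker_right)
  also have "\<dots> = (idt C A \<otimes>\<^sub>a (run C B \<otimes>\<^sub>a idt C I)) \<cdot> (asc C A (B \<otimes>\<^sub>o I) I \<cdot> (asc C A B I \<otimes>\<^sub>a idt C I))"
    by (simp add: asc_nat_reassoc)
  also have "\<dots> = ((idt C A \<otimes>\<^sub>a (idt C B \<otimes>\<^sub>a lun C I)) \<cdot> (idt C A \<otimes>\<^sub>a asc C B I I)) \<cdot>
      (asc C A (B \<otimes>\<^sub>o I) I \<cdot> (asc C A B I \<otimes>\<^sub>a idt C I))"
    by (simp add: triangle flip: whisker_left del: cmp_assoc_simp)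
  also have "\<dots> = (idt C A \<otimes>\<^sub>a (idt C B \<otimes>\<^sub>a lun C I)) \<cdot> (asc C A B (I \<otimes>\<^sub>o I) \<cdot> asc C (A \<otimes>\<^sub>o B) I I)"
    by (simp add: pentagon)
  also have "\<dots> = asc C A B I \<cdot> (((idt C A \<otimes>\<^sub>a idt C B) \<otimes>\<^sub>a lun C I) \<cdot> asc C (A \<otimes>\<^sub>o B) I I)"
    by (subst asc_nat_reassoc) simp_all
  also have "\<dots> = asc C A B I \<cdot> (run C (A \<otimes>\<^sub>o B) \<otimes>\<^sub>a idt C I)"
    by (simp add: triangle)
  finally have "((idt C A \<otimes>\<^sub>a run C B) \<cdot> asc C A B I) \<otimes>\<^sub>a idt C I = run C (A \<otimes>\<^sub>o B) \<otimes>\<^sub>a idt C I"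
    by (rule iso_cancel_left[OF asc_iso, rotated -1]) simp_all
  then show ?thesis
    by (rule run_faithful) simp_all
qed

lemma lun_unit: "lun C I = run C I"
proof -
  have "lun C I \<cdot> (idt C I \<otimes>\<^sub>a lun C I) = lun C I \<cdot> lun C (I \<otimes>\<^sub>o I)"
    by (simp add: lun_nat)
  then have *: "idt C I \<otimes>\<^sub>a lun C I = lun C (I \<otimes>\<^sub>o I)"
    by (rule iso_cancel_left[OF lun_iso, rotated -1]) simp_all
  have "lun C I \<otimes>\<^sub>a idt C I = lun C (I \<otimes>\<^sub>o I) \<cdot> asc C I I I"
    by (simp add: lun_tensor)
  also have "\<dots> = run C I \<otimes>\<^sub>a idt C I"
    by (simp flip: * add: triangle)
  finally show ?thesis
    by (rule run_faithful) simp_all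
qed

lemma brd_nat:
  assumes "f \<in> Ar C" "g \<in> Ar C" "Cod C f = A'" "Cod C g = B'"
  shows "brd C A' B' \<cdot> (f \<otimes>\<^sub>a g) = (g \<otimes>\<^sub>a f) \<cdot> brd C (Dom C f) (Dom C g)"
  using brd_natural[of f "Dom C f" A' g "Dom C g" B'] assms by simp

lemma brd_reassoc [simp]:
  assumes "A \<in> Ob C" "B \<in> Ob C" "x \<in> Ar C" "Cod C x = A \<otimes>\<^sub>o B"
  shows "brd C B A \<cdot> (brd C A B \<cdot> x) = x"
  using cmp_reassoc1[OF brd_symmetric[of A B], of x] assms by simp

lemma tar_swap:
  assumes "f \<in> Ar C" "g \<in> Ar C"
  shows "f \<otimes>\<^sub>a g = brd C (Cod C g) (Cod C f) \<cdot> ((g \<otimes>\<^sub>a f) \<cdot> brd C (Dom C f) (Dom C g))"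
  using assms by (simp flip: brd_nat)

lemma tar_hzero [simp]:
  assumes "f \<in> Ar C" "A \<in> Ob C" "B \<in> Ob C"
  shows "f \<otimes>\<^sub>a hzero C A B = hzero C (Dom C f \<otimes>\<^sub>o A) (Cod C f \<otimes>\<^sub>o B)"
    "hzero C A B \<otimes>\<^sub>a f = hzero C (A \<otimes>\<^sub>o Dom C f) (B \<otimes>\<^sub>o Cod C f)"
proof -
  have "hadd C (f \<otimes>\<^sub>a hzero C A B) (f \<otimes>\<^sub>a hzero C A B) =
      hadd C (f \<otimes>\<^sub>a hzero C A B) (hzero C (Dom C f \<otimes>\<^sub>o A) (Cod C f \<otimes>\<^sub>o B))"
    using assms tar_hadd_right[of f "Dom C f" "Cod C f" "hzero C A B" A B "hzero C A B"] by simp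
  then show "f \<otimes>\<^sub>a hzero C A B = hzero C (Dom C f \<otimes>\<^sub>o A) (Cod C f \<otimes>\<^sub>o B)"
    by (rule hadd_cancel) (use assms in simp_all)
  have "hadd C (hzero C A B \<otimes>\<^sub>a f) (hzero C A B \<otimes>\<^sub>a f) =
      hadd C (hzero C A B \<otimes>\<^sub>a f) (hzero C (A \<otimes>\<^sub>o Dom C f) (B \<otimes>\<^sub>o Cod C f))"
    using assms tar_hadd_left[of "hzero C A B" A B "hzero C A B" f "Dom C f" "Cod C f"] by simp
  then show "hzero C A B \<otimes>\<^sub>a f = hzero C (A \<otimes>\<^sub>o Dom C f) (B \<otimes>\<^sub>o Cod C f)"
    by (rule hadd_cancel) (use assms in simp_all)
qed

lemma null_ob_tensor:
  assumes "null_ob X" "Y \<in> Ob C"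
  shows "null_ob (X \<otimes>\<^sub>o Y)" "null_ob (Y \<otimes>\<^sub>o X)"
proof -
  have X: "X \<in> Ob C" "idt C X = hzero C X X"
    using assms by (auto simp: null_ob_def)
  have "idt C X \<otimes>\<^sub>a idt C Y = hzero C (X \<otimes>\<^sub>o Y) (X \<otimes>\<^sub>o Y)" "idt C Y \<otimes>\<^sub>a idt C X = hzero C (Y \<otimes>\<^sub>o X) (Y \<otimes>\<^sub>o X)"
    unfolding X(2) using X(1) assms(2) by simp_all
  then show "null_ob (X \<otimes>\<^sub>o Y)" "null_ob (Y \<otimes>\<^sub>o X)"
    using X(1) assms(2) by (simp_all add: null_ob_def)
qed

lemma dualD:
  assumes "is_dual C A D \<eta> \<epsilon>"
  shows "D \<in> Ob C" "\<eta> \<in> Ar C" "Dom C \<eta> = I" "Cod C \<eta> = D \<otimes>\<^sub>o A" "\<epsilon> \<in> Ar C" "Dom C \<epsilon> = A \<otimes>\<^sub>o D" "Cod C \<epsilon> = I"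
    "lun C A \<cdot> ((\<epsilon> \<otimes>\<^sub>a idt C A) \<cdot> (iasc A D A \<cdot> (idt C A \<otimes>\<^sub>a \<eta>))) = run C A"
  using assms by (auto simp: is_dual_def)

text \<open>The pentagon solved for the two composites that arise when a coevaluation is moved past
  \<open>Y\<close> and when an evaluation is moved past \<open>X\<close> in the two zigzag lemmas
  below.\<close>

lemma pentagon_inv:
  assumes [simp]: "A \<in> Ob C" "B \<in> Ob C" "D \<in> Ob C" "E \<in> Ob C"
  shows "iasc A B (D \<otimes>\<^sub>o E) \<cdot> (idt C A \<otimes>\<^sub>a asc C B D E) =
    asc C (A \<otimes>\<^sub>o B) D E \<cdot> ((iasc A B D \<otimes>\<^sub>a idt C E) \<cdot> iasc A (B \<otimes>\<^sub>o D) E)"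
    "(asc C A B D \<otimes>\<^sub>a idt C E) \<cdot> iasc (A \<otimes>\<^sub>o B) D E =
    iasc A (B \<otimes>\<^sub>o D) E \<cdot> ((idt C A \<otimes>\<^sub>a iasc B D E) \<cdot> asc C A B (D \<otimes>\<^sub>o E))"
proof -
  show "iasc A B (D \<otimes>\<^sub>o E) \<cdot> (idt C A \<otimes>\<^sub>a asc C B D E) =
    asc C (A \<otimes>\<^sub>o B) D E \<cdot> ((iasc A B D \<otimes>\<^sub>a idt C E) \<cdot> iasc A (B \<otimes>\<^sub>o D) E)"
    by (rule iso_cancel_left[OF asc_iso[of A B "D \<otimes>\<^sub>o E"]])
      (simp_all add: cmp_reassoc[OF pentagon] tar_merge)
  have "asc C A (B \<otimes>\<^sub>o D) E \<cdot> ((asc C A B D \<otimes>\<^sub>a idt C E) \<cdot> iasc (A \<otimes>\<^sub>o B) D E) =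
      (idt C A \<otimes>\<^sub>a iasc B D E) \<cdot> (((idt C A \<otimes>\<^sub>a asc C B D E) \<cdot> (asc C A (B \<otimes>\<^sub>o D) E \<cdot> (asc C A B D \<otimes>\<^sub>a idt C E))) \<cdot>
        iasc (A \<otimes>\<^sub>o B) D E)"
    by (simp add: tar_merge)
  also have "\<dots> = (idt C A \<otimes>\<^sub>a iasc B D E) \<cdot> asc C A B (D \<otimes>\<^sub>o E)"
    by (simp flip: pentagon)
  finally have *: "asc C A (B \<otimes>\<^sub>o D) E \<cdot> ((asc C A B D \<otimes>\<^sub>a idt C E) \<cdot> iasc (A \<otimes>\<^sub>o B) D E) =
    (idt C A \<otimes>\<^sub>a iasc B D E) \<cdot> asc C A B (D \<otimes>\<^sub>o E)" .
  show "(asc C A B D \<otimes>\<^sub>a idt C E) \<cdot> iasc (A \<otimes>\<^sub>o B) D E =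
    iasc A (B \<otimes>\<^sub>o D) E \<cdot> ((idt C A \<otimes>\<^sub>a iasc B D E) \<cdot> asc C A B (D \<otimes>\<^sub>o E))"
    by (rule iso_cancel_left[OF asc_iso[of A "B \<otimes>\<^sub>o D" E]]) (simp_all add: *)
qed

text \<open>The triangle identity on \<open>A\<close> tensored with \<open>Y\<close>, which is the
  triangle identity at \<open>Y\<close> of the adjunction between \<open>A \<otimes> -\<close> and
  \<open>D \<otimes> -\<close>.\<close>

lemma dual_zigzag_left:
  assumes "is_dual C A D \<eta> \<epsilon>" and [simp]: "A \<in> Ob C" "Y \<in> Ob C"
  shows "lun C (A \<otimes>\<^sub>o Y) \<cdot> ((\<epsilon> \<otimes>\<^sub>a idt C (A \<otimes>\<^sub>o Y)) \<cdot>
    (iasc A D (A \<otimes>\<^sub>o Y) \<cdot> (idt C A \<otimes>\<^sub>a (asc C D A Y \<cdot> (\<eta> \<otimes>\<^sub>a idt C Y))))) = idt C A \<otimes>\<^sub>a lun C Y"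
proof -
  note D [simp] = dualD(1-7)[OF assms(1)]
  have "iasc A D (A \<otimes>\<^sub>o Y) \<cdot> (idt C A \<otimes>\<^sub>a (asc C D A Y \<cdot> (\<eta> \<otimes>\<^sub>a idt C Y))) =
      (iasc A D (A \<otimes>\<^sub>o Y) \<cdot> (idt C A \<otimes>\<^sub>a asc C D A Y)) \<cdot> (idt C A \<otimes>\<^sub>a (\<eta> \<otimes>\<^sub>a idt C Y))"
    by (simp add: whisker_left)
  also have "\<dots> = asc C (A \<otimes>\<^sub>o D) A Y \<cdot> ((iasc A D A \<otimes>\<^sub>a idt C Y) \<cdot>
      (((idt C A \<otimes>\<^sub>a \<eta>) \<otimes>\<^sub>a idt C Y) \<cdot> iasc A I Y))"
    by (simp add: pentagon_inv(1) iasc_nat)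
  finally have 1: "iasc A D (A \<otimes>\<^sub>o Y) \<cdot> (idt C A \<otimes>\<^sub>a (asc C D A Y \<cdot> (\<eta> \<otimes>\<^sub>a idt C Y))) =
    asc C (A \<otimes>\<^sub>o D) A Y \<cdot> (((iasc A D A \<cdot> (idt C A \<otimes>\<^sub>a \<eta>)) \<otimes>\<^sub>a idt C Y) \<cdot> iasc A I Y)" (is "_ = _ \<cdot> ?u")
    by (simp add: whisker_right)
  have 2: "lun C (A \<otimes>\<^sub>o Y) \<cdot> ((\<epsilon> \<otimes>\<^sub>a idt C (A \<otimes>\<^sub>o Y)) \<cdot> asc C (A \<otimes>\<^sub>o D) A Y) =
    (lun C A \<cdot> (\<epsilon> \<otimes>\<^sub>a idt C A)) \<otimes>\<^sub>a idt C Y"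
  proof -
    have "(\<epsilon> \<otimes>\<^sub>a idt C (A \<otimes>\<^sub>o Y)) \<cdot> asc C (A \<otimes>\<^sub>o D) A Y = asc C I A Y \<cdot> ((\<epsilon> \<otimes>\<^sub>a idt C A) \<otimes>\<^sub>a idt C Y)"
      by (subst asc_nat) simp_all
    then have "lun C (A \<otimes>\<^sub>o Y) \<cdot> ((\<epsilon> \<otimes>\<^sub>a idt C (A \<otimes>\<^sub>o Y)) \<cdot> asc C (A \<otimes>\<^sub>o D) A Y) =
        (lun C (A \<otimes>\<^sub>o Y) \<cdot> asc C I A Y) \<cdot> ((\<epsilon> \<otimes>\<^sub>a idt C A) \<otimes>\<^sub>a idt C Y)"
      by simp
    then show ?thesis
      by (simp add: lun_tensor whisker_right)
  qed
  have "lun C (A \<otimes>\<^sub>o Y) \<cdot> ((\<epsilon> \<otimes>\<^sub>a idt C (A \<otimes>\<^sub>o Y)) \<cdot>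
    (iasc A D (A \<otimes>\<^sub>o Y) \<cdot> (idt C A \<otimes>\<^sub>a (asc C D A Y \<cdot> (\<eta> \<otimes>\<^sub>a idt C Y))))) =
      (lun C (A \<otimes>\<^sub>o Y) \<cdot> ((\<epsilon> \<otimes>\<^sub>a idt C (A \<otimes>\<^sub>o Y)) \<cdot> asc C (A \<otimes>\<^sub>o D) A Y)) \<cdot> ?u"
    unfolding 1 by simp
  also have "\<dots> = ((lun C A \<cdot> ((\<epsilon> \<otimes>\<^sub>a idt C A) \<cdot> (iasc A D A \<cdot> (idt C A \<otimes>\<^sub>a \<eta>)))) \<otimes>\<^sub>a idt C Y) \<cdot> iasc A I Y"
    unfolding 2 by (simp add: tar_merge)
  also have "\<dots> = (run C A \<otimes>\<^sub>a idt C Y) \<cdot> iasc A I Y"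
    unfolding dualD(8)[OF assms(1)] ..
  also have "\<dots> = idt C A \<otimes>\<^sub>a lun C Y"
    by (simp flip: triangle)
  finally show ?thesis .
qed

text \<open>The same triangle identity tensored with \<open>X\<close> on the left; it belongs to the
  adjunction in which \<open>- \<otimes> A\<close> is right adjoint to
  \<open>- \<otimes> D\<close>.\<close>

lemma dual_zigzag_right:
  assumes "is_dual C A D \<eta> \<epsilon>" and [simp]: "A \<in> Ob C" "X \<in> Ob C"
  shows "(run C X \<otimes>\<^sub>a idt C A) \<cdot> ((((idt C X \<otimes>\<^sub>a \<epsilon>) \<cdot> asc C X A D) \<otimes>\<^sub>a idt C A) \<cdot>
    (iasc (X \<otimes>\<^sub>o A) D A \<cdot> (idt C (X \<otimes>\<^sub>o A) \<otimes>\<^sub>a \<eta>))) = run C (X \<otimes>\<^sub>o A)"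
proof -
  note D [simp] = dualD(1-7)[OF assms(1)]
  have 1: "asc C X A (D \<otimes>\<^sub>o A) \<cdot> (idt C (X \<otimes>\<^sub>o A) \<otimes>\<^sub>a \<eta>) = (idt C X \<otimes>\<^sub>a (idt C A \<otimes>\<^sub>a \<eta>)) \<cdot> asc C X A I"
    using asc_nat[of "idt C X" "idt C A" \<eta> X A "D \<otimes>\<^sub>o A"] by simp
  have "(((idt C X \<otimes>\<^sub>a \<epsilon>) \<cdot> asc C X A D) \<otimes>\<^sub>a idt C A) \<cdot>
      (iasc (X \<otimes>\<^sub>o A) D A \<cdot> (idt C (X \<otimes>\<^sub>o A) \<otimes>\<^sub>a \<eta>)) =
    ((idt C X \<otimes>\<^sub>a \<epsilon>) \<otimes>\<^sub>a idt C A) \<cdot> (((asc C X A D \<otimes>\<^sub>a idt C A) \<cdot> iasc (X \<otimes>\<^sub>o A) D A) \<cdot>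
      (idt C (X \<otimes>\<^sub>o A) \<otimes>\<^sub>a \<eta>))"
    by (simp add: whisker_right)
  also have "\<dots> = (((idt C X \<otimes>\<^sub>a \<epsilon>) \<otimes>\<^sub>a idt C A) \<cdot> iasc X (A \<otimes>\<^sub>o D) A) \<cdot> ((idt C X \<otimes>\<^sub>a iasc A D A) \<cdot>
      (asc C X A (D \<otimes>\<^sub>o A) \<cdot> (idt C (X \<otimes>\<^sub>o A) \<otimes>\<^sub>a \<eta>)))"
    unfolding pentagon_inv(2)[OF assms(3,2) D(1) assms(2)] by simp
  also have "((idt C X \<otimes>\<^sub>a \<epsilon>) \<otimes>\<^sub>a idt C A) \<cdot> iasc X (A \<otimes>\<^sub>o D) A = iasc X I A \<cdot> (idt C X \<otimes>\<^sub>a (\<epsilon> \<otimes>\<^sub>a idt C A))"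
    by (simp add: iasc_nat)
  finally have 2: "(((idt C X \<otimes>\<^sub>a \<epsilon>) \<cdot> asc C X A D) \<otimes>\<^sub>a idt C A) \<cdot>
      (iasc (X \<otimes>\<^sub>o A) D A \<cdot> (idt C (X \<otimes>\<^sub>o A) \<otimes>\<^sub>a \<eta>)) =
    iasc X I A \<cdot> ((idt C X \<otimes>\<^sub>a ((\<epsilon> \<otimes>\<^sub>a idt C A) \<cdot> (iasc A D A \<cdot> (idt C A \<otimes>\<^sub>a \<eta>)))) \<cdot> asc C X A I)"
    unfolding 1 by (simp add: tar_merge)
  have "run C X \<otimes>\<^sub>a idt C A = (idt C X \<otimes>\<^sub>a lun C A) \<cdot> asc C X I A"
    by (simp add: triangle)
  then have "(run C X \<otimes>\<^sub>a idt C A) \<cdot> ((((idt C X \<otimes>\<^sub>a \<epsilon>) \<cdot> asc C X A D) \<otimes>\<^sub>a idt C A) \<cdot>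
      (iasc (X \<otimes>\<^sub>o A) D A \<cdot> (idt C (X \<otimes>\<^sub>o A) \<otimes>\<^sub>a \<eta>))) =
    (idt C X \<otimes>\<^sub>a (lun C A \<cdot> ((\<epsilon> \<otimes>\<^sub>a idt C A) \<cdot> (iasc A D A \<cdot> (idt C A \<otimes>\<^sub>a \<eta>))))) \<cdot> asc C X A I"
    unfolding 2 by (simp add: tar_merge)
  also have "\<dots> = run C (X \<otimes>\<^sub>o A)"
    unfolding dualD(8)[OF assms(1)] by (simp add: run_tensor)
  finally show ?thesis .
qed

end

section \<open>Exactness of the tensor product from duality\<close>

context rigid_tensor_category
begin

text \<open>\<open>A \<otimes> -\<close> has the right adjoint \<open>D \<otimes> -\<close>, and
  left adjoints preserve epis.\<close>

lemma tensor_epi_left: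
  assumes A [simp]: "A \<in> Ob C" and f: "is_epi C f"
  shows "is_epi C (idt C A \<otimes>\<^sub>a f)"
proof (rule epiI)
  obtain D \<eta> \<epsilon> where dual: "is_dual C A D \<eta> \<epsilon>"
    using rigid A by blast
  note D [simp] = dualD(1-7)[OF dual]
  have [simp]: "f \<in> Ar C"
    using f by (simp add: is_epi_def)
  let ?X = "Dom C f" and ?Y = "Cod C f"
  show "idt C A \<otimes>\<^sub>a f \<in> Ar C"
    by simp
  fix h
  assume "h \<in> Ar C" "Dom C h = Cod C (idt C A \<otimes>\<^sub>a f)"
    and h0: "h \<cdot> (idt C A \<otimes>\<^sub>a f) = hzero C (Dom C (idt C A \<otimes>\<^sub>a f)) (Cod C h)"
  then have h [simp]: "h \<in> Ar C" "Dom C h = A \<otimes>\<^sub>o ?Y"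
    by auto
  have [simp]: "Cod C h \<in> Ob C"
    using cod_closed h by blast
  \<comment> \<open>The transpose of \<open>h\<close>, up to the unitor of \<open>?Y\<close>. It
    kills \<open>idt C I \<otimes>\<^sub>a f\<close> because \<open>h\<close> kills
    \<open>idt C A \<otimes>\<^sub>a f\<close>, and the zigzag recovers \<open>h\<close> from
    it.\<close>
  define g where "g = (idt C D \<otimes>\<^sub>a h) \<cdot> (asc C D A ?Y \<cdot> (\<eta> \<otimes>\<^sub>a idt C ?Y))"
  have g [simp]: "g \<in> Ar C" "Dom C g = I \<otimes>\<^sub>o ?Y" "Cod C g = D \<otimes>\<^sub>o Cod C h"
    by (simp_all add: g_def)
  have "is_epi C (ilun ?Y \<cdot> (f \<cdot> lun C ?X))"
    by (intro epi_cmp iso_epi[OF lun_iso] iso_epi[OF inv_ar_iso[OF lun_iso]] f) simp_all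
  moreover have "ilun ?Y \<cdot> (f \<cdot> lun C ?X) = idt C I \<otimes>\<^sub>a f"
    using cmp_reassoc[OF ilun_nat, of f ?Y "lun C ?X"] by simp
  ultimately have epi: "is_epi C (idt C I \<otimes>\<^sub>a f)"
    by simp
  have "(\<eta> \<otimes>\<^sub>a idt C ?Y) \<cdot> (idt C I \<otimes>\<^sub>a f) = ((idt C D \<otimes>\<^sub>a idt C A) \<otimes>\<^sub>a f) \<cdot> (\<eta> \<otimes>\<^sub>a idt C ?X)"
    by (simp add: tar_merge)
  then have "g \<cdot> (idt C I \<otimes>\<^sub>a f) = (idt C D \<otimes>\<^sub>a h) \<cdot>
      (asc C D A ?Y \<cdot> (((idt C D \<otimes>\<^sub>a idt C A) \<otimes>\<^sub>a f) \<cdot> (\<eta> \<otimes>\<^sub>a idt C ?X)))"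
    by (simp add: g_def)
  also have "\<dots> = (idt C D \<otimes>\<^sub>a (h \<cdot> (idt C A \<otimes>\<^sub>a f))) \<cdot> (asc C D A ?X \<cdot> (\<eta> \<otimes>\<^sub>a idt C ?X))"
    by (subst asc_nat_reassoc) (simp_all add: tar_merge)
  also have "\<dots> = hzero C (I \<otimes>\<^sub>o ?X) (D \<otimes>\<^sub>o Cod C h)"
    unfolding h0 by simp
  finally have g0: "g = hzero C (I \<otimes>\<^sub>o ?Y) (D \<otimes>\<^sub>o Cod C h)"
    using epi_zeroD[OF epi, of g] by simp
  have "h \<cdot> (idt C A \<otimes>\<^sub>a lun C ?Y) = (h \<cdot> lun C (A \<otimes>\<^sub>o ?Y)) \<cdot> ((\<epsilon> \<otimes>\<^sub>a idt C (A \<otimes>\<^sub>o ?Y)) \<cdot>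
      (iasc A D (A \<otimes>\<^sub>o ?Y) \<cdot> (idt C A \<otimes>\<^sub>a (asc C D A ?Y \<cdot> (\<eta> \<otimes>\<^sub>a idt C ?Y)))))"
    by (simp flip: dual_zigzag_left[OF dual])
  also have "\<dots> = lun C (Cod C h) \<cdot> ((\<epsilon> \<otimes>\<^sub>a idt C (Cod C h)) \<cdot> (((idt C (A \<otimes>\<^sub>o D) \<otimes>\<^sub>a h) \<cdot>
      iasc A D (A \<otimes>\<^sub>o ?Y)) \<cdot> (idt C A \<otimes>\<^sub>a (asc C D A ?Y \<cdot> (\<eta> \<otimes>\<^sub>a idt C ?Y)))))"
    using lun_nat[of h "Cod C h", symmetric] by (simp add: tar_merge)
  also have "(idt C (A \<otimes>\<^sub>o D) \<otimes>\<^sub>a h) \<cdot> iasc A D (A \<otimes>\<^sub>o ?Y) = iasc A D (Cod C h) \<cdot> (idt C A \<otimes>\<^sub>a (idt C D \<otimes>\<^sub>a h))"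
    by (simp add: iasc_nat)
  also have "lun C (Cod C h) \<cdot> ((\<epsilon> \<otimes>\<^sub>a idt C (Cod C h)) \<cdot> ((iasc A D (Cod C h) \<cdot> (idt C A \<otimes>\<^sub>a (idt C D \<otimes>\<^sub>a h))) \<cdot>
      (idt C A \<otimes>\<^sub>a (asc C D A ?Y \<cdot> (\<eta> \<otimes>\<^sub>a idt C ?Y))))) =
    lun C (Cod C h) \<cdot> ((\<epsilon> \<otimes>\<^sub>a idt C (Cod C h)) \<cdot> (iasc A D (Cod C h) \<cdot> (idt C A \<otimes>\<^sub>a g)))"
    by (simp add: g_def tar_merge)
  also have "\<dots> = hzero C (A \<otimes>\<^sub>o (I \<otimes>\<^sub>o ?Y)) (Cod C h)"
    unfolding g0 by simp
  finally have "h \<cdot> (idt C A \<otimes>\<^sub>a lun C ?Y) = hzero C (A \<otimes>\<^sub>o ?Y) (Cod C h) \<cdot> (idt C A \<otimes>\<^sub>a lun C ?Y)"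
    by simp
  then have "h = hzero C (A \<otimes>\<^sub>o ?Y) (Cod C h)"
    by (rule iso_cancel_right[OF tar_iso[OF idt_iso(1)[OF A] lun_iso[of ?Y]], rotated -1]) simp_all
  then show "h = hzero C (Cod C (idt C A \<otimes>\<^sub>a f)) (Cod C h)"
    by simp
qed

text \<open>\<open>- \<otimes> A\<close> is right adjoint to \<open>- \<otimes> D\<close>, and right
  adjoints preserve monos.\<close>

lemma tensor_mono_right:
  assumes A [simp]: "A \<in> Ob C" and f: "is_mono C f"
  shows "is_mono C (f \<otimes>\<^sub>a idt C A)"
proof (rule monoI)
  obtain D \<eta> \<epsilon> where dual: "is_dual C A D \<eta> \<epsilon>"
    using rigid A by blast
  note D [simp] = dualD(1-7)[OF dual]
  have [simp]: "f \<in> Ar C"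
    using f by (simp add: is_mono_def)
  let ?X = "Dom C f" and ?Y = "Cod C f"
  show "f \<otimes>\<^sub>a idt C A \<in> Ar C"
    by simp
  fix h
  assume "h \<in> Ar C" "Cod C h = Dom C (f \<otimes>\<^sub>a idt C A)"
    and h0: "(f \<otimes>\<^sub>a idt C A) \<cdot> h = hzero C (Dom C h) (Cod C (f \<otimes>\<^sub>a idt C A))"
  then have h [simp]: "h \<in> Ar C" "Cod C h = ?X \<otimes>\<^sub>o A"
    by auto
  define Z where "Z = Dom C h"
  have Z [simp]: "Dom C h = Z" "Z \<in> Ob C"
    using dom_closed h by (auto simp: Z_def)
  \<comment> \<open>The transpose of \<open>h\<close> under this adjunction, up to the unitor of
    \<open>?X\<close>.\<close>
  define g where "g = (idt C ?X \<otimes>\<^sub>a \<epsilon>) \<cdot> (asc C ?X A D \<cdot> (h \<otimes>\<^sub>a idt C D))"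
  have g [simp]: "g \<in> Ar C" "Dom C g = Z \<otimes>\<^sub>o D" "Cod C g = ?X \<otimes>\<^sub>o I"
    by (simp_all add: g_def)
  have "is_mono C (irun ?Y \<cdot> (f \<cdot> run C ?X))"
    by (intro mono_cmp iso_mono[OF run_iso] iso_mono[OF inv_ar_iso[OF run_iso]] f) simp_all
  moreover have "irun ?Y \<cdot> (f \<cdot> run C ?X) = f \<otimes>\<^sub>a idt C I"
    by (simp flip: run_nat[of f ?Y])
  ultimately have mono: "is_mono C (f \<otimes>\<^sub>a idt C I)"
    by simp
  have "(f \<otimes>\<^sub>a idt C I) \<cdot> g = (idt C ?Y \<otimes>\<^sub>a \<epsilon>) \<cdot> ((f \<otimes>\<^sub>a (idt C A \<otimes>\<^sub>a idt C D)) \<cdot> (asc C ?X A D \<cdot> (h \<otimes>\<^sub>a idt C D)))"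
    by (simp add: g_def tar_merge)
  also have "\<dots> = (idt C ?Y \<otimes>\<^sub>a \<epsilon>) \<cdot> (asc C ?Y A D \<cdot> (((f \<otimes>\<^sub>a idt C A) \<cdot> h) \<otimes>\<^sub>a idt C D))"
    using asc_nat_reassoc[of f "idt C A" "idt C D" ?Y A D "h \<otimes>\<^sub>a idt C D"] by (simp add: whisker_right)
  also have "\<dots> = hzero C (Z \<otimes>\<^sub>o D) (?Y \<otimes>\<^sub>o I)"
    unfolding h0 by simp
  finally have g0: "g = hzero C (Z \<otimes>\<^sub>o D) (?X \<otimes>\<^sub>o I)"
    using mono_zeroD[OF mono, of g] by simp
  have 1: "iasc (?X \<otimes>\<^sub>o A) D A \<cdot> (h \<otimes>\<^sub>a idt C (D \<otimes>\<^sub>o A)) = ((h \<otimes>\<^sub>a idt C D) \<otimes>\<^sub>a idt C A) \<cdot> iasc Z D A"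
    using iasc_nat[of h "idt C D" "idt C A" "?X \<otimes>\<^sub>o A" D A] by simp
  have "h \<cdot> run C Z = run C (?X \<otimes>\<^sub>o A) \<cdot> (h \<otimes>\<^sub>a idt C I)"
    by (simp add: run_nat)
  also have "\<dots> = (run C ?X \<otimes>\<^sub>a idt C A) \<cdot> ((((idt C ?X \<otimes>\<^sub>a \<epsilon>) \<cdot> asc C ?X A D) \<otimes>\<^sub>a idt C A) \<cdot>
    ((iasc (?X \<otimes>\<^sub>o A) D A \<cdot> (h \<otimes>\<^sub>a idt C (D \<otimes>\<^sub>o A))) \<cdot> (idt C Z \<otimes>\<^sub>a \<eta>)))"
    by (simp flip: dual_zigzag_right[OF dual] add: tar_merge)
  also have "\<dots> = (run C ?X \<otimes>\<^sub>a idt C A) \<cdot> ((g \<otimes>\<^sub>a idt C A) \<cdot> (iasc Z D A \<cdot> (idt C Z \<otimes>\<^sub>a \<eta>)))"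
    unfolding 1 by (simp add: tar_merge g_def)
  also have "\<dots> = hzero C Z (?X \<otimes>\<^sub>o A) \<cdot> run C Z"
    unfolding g0 by simp
  finally have "h = hzero C Z (?X \<otimes>\<^sub>o A)"
    by (rule iso_cancel_right[OF run_iso[of Z], rotated -1]) simp_all
  then show "h = hzero C (Dom C h) (Dom C (f \<otimes>\<^sub>a idt C A))"
    by simp
qed

lemma tensor_epi_right:
  assumes "A \<in> Ob C" "is_epi C f"
  shows "is_epi C (f \<otimes>\<^sub>a idt C A)"
proof -
  have [simp]: "f \<in> Ar C"
    using assms by (simp add: is_epi_def)
  have "is_epi C (brd C A (Cod C f) \<cdot> ((idt C A \<otimes>\<^sub>a f) \<cdot> brd C (Dom C f) A))"
    using assms by (intro epi_cmp tensor_epi_left iso_epi[OF brd_iso]) simp_all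
  then show ?thesis
    using assms tar_swap[of f "idt C A"] by simp
qed

lemma tensor_mono_left:
  assumes "A \<in> Ob C" "is_mono C f"
  shows "is_mono C (idt C A \<otimes>\<^sub>a f)"
proof -
  have [simp]: "f \<in> Ar C"
    using assms by (simp add: is_mono_def)
  have "is_mono C (brd C (Cod C f) A \<cdot> ((f \<otimes>\<^sub>a idt C A) \<cdot> brd C A (Dom C f)))"
    using assms by (intro mono_cmp tensor_mono_right iso_mono[OF brd_iso]) simp_all
  then show ?thesis
    using assms tar_swap[of "idt C A" f] by simp
qed

text \<open>The triangle identity factors the unitor of \<open>X\<close> through
  \<open>X \<otimes> (D \<otimes> X)\<close>, which up to braiding contains
  \<open>X \<otimes> X\<close> as a factor.\<close>

lemma null_ob_square:
  assumes "null_ob (X \<otimes>\<^sub>o X)" and X [simp]: "X \<in> Ob C"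
  shows "null_ob X"
proof -
  obtain D \<eta> \<epsilon> where dual: "is_dual C X D \<eta> \<epsilon>"
    using rigid X by blast
  note D [simp] = dualD(1-7)[OF dual]
  have "null_ob (X \<otimes>\<^sub>o (X \<otimes>\<^sub>o D))"
    using null_ob_tensor(1)[OF assms(1), of D] null_ob_iso[OF asc_iso[of X X D]] by simp
  then have "null_ob (X \<otimes>\<^sub>o (D \<otimes>\<^sub>o X))"
    using null_ob_iso[OF tar_iso[OF idt_iso(1) brd_iso], of X X D] by simp
  then have "idt C X \<otimes>\<^sub>a \<eta> = hzero C (X \<otimes>\<^sub>o I) (X \<otimes>\<^sub>o (D \<otimes>\<^sub>o X))"
    using null_ob_cod[of _ "idt C X \<otimes>\<^sub>a \<eta>"] by simp
  then have "run C X = hzero C (X \<otimes>\<^sub>o I) X"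
    using dualD(8)[OF dual] by simp
  then show ?thesis
    using null_ob_epi[OF iso_epi[OF run_iso[of X]]] by simp
qed

end

section \<open>Scalars and supports\<close>

context tensor_category
begin

text \<open>The endomorphism of \<open>A\<close> by which the scalar \<open>z\<close> acts. Acting
  on an arrow is composing with it, so arguments about scalars become arguments about
  composites.\<close>

definition scal :: "'m \<Rightarrow> 'o \<Rightarrow> 'm" where
  "scal z A = lun C A \<cdot> ((z \<otimes>\<^sub>a idt C A) \<cdot> ilun A)"

lemma scal_simps [simp]:
  assumes "z \<in> Ar C" "Dom C z = I" "Cod C z = I" "A \<in> Ob C"
  shows "scal z A \<in> Ar C" "Dom C (scal z A) = A" "Cod C (scal z A) = A"
  using assms by (simp_all add: scal_def)

lemma Z_act_eq_scal:
  assumes "z \<in> Ar C" "Dom C z = I" "Cod C z = I" "f \<in> Ar C" "Cod C f = B"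
  shows "Z_act C z f = scal z B \<cdot> f"
proof -
  have "B \<in> Ob C"
    using assms by auto
  then show ?thesis
    using assms by (simp add: scal_def Z_act_def ilun_nat tar_merge)
qed

lemma scal_nat:
  assumes "z \<in> Ar C" "Dom C z = I" "Cod C z = I" "f \<in> Ar C" "Cod C f = B"
  shows "scal z B \<cdot> f = f \<cdot> scal z (Dom C f)"
proof -
  have "B \<in> Ob C" "Dom C f \<in> Ob C"
    using assms by auto
  moreover have "(z \<otimes>\<^sub>a f) \<cdot> ilun (Dom C f) = (idt C I \<otimes>\<^sub>a f) \<cdot> ((z \<otimes>\<^sub>a idt C (Dom C f)) \<cdot> ilun (Dom C f))"
    using calculation assms by (simp add: tar_merge)
  ultimately show ?thesis
    using assms by (simp add: scal_def ilun_nat tar_merge flip: lun_nat_reassoc)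
qed

lemma scal_nat_reassoc:
  assumes "z \<in> Ar C" "Dom C z = I" "Cod C z = I" "f \<in> Ar C" "Cod C f = B" "x \<in> Ar C" "Cod C x = Dom C f"
  shows "scal z B \<cdot> (f \<cdot> x) = f \<cdot> (scal z (Dom C f) \<cdot> x)"
proof -
  have "B \<in> Ob C" "Dom C f \<in> Ob C"
    using assms by auto
  then show ?thesis
    by (intro cmp_reassoc[OF scal_nat]) (use assms in simp_all)
qed

text \<open>Rests on the coincidence of the two unitors at the unit object.\<close>

lemma scal_unit [simp]:
  assumes "z \<in> Ar C" "Dom C z = I" "Cod C z = I"
  shows "scal z I = z"
proof -
  have "lun C I \<cdot> (z \<otimes>\<^sub>a idt C I) = z \<cdot> lun C I"
    using run_nat[of z I] assms by (simp add: lun_unit)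
  from cmp_reassoc[OF this, of "ilun I"] show ?thesis
    using assms by (simp add: scal_def)
qed

text \<open>A scalar that factors through \<open>U\<close> acts on \<open>A\<close> through
  \<open>U \<otimes> A\<close>. This is used to place \<open>A\<close> in a Serre ideal containing
  \<open>U\<close>, and to see that \<open>z \<otimes>\<^sub>a idt C A = 0\<close> makes the scalar
  act as zero.\<close>

lemma scal_cmp:
  assumes "z \<in> Ar C" "Dom C z = U" "Cod C z = I" "y \<in> Ar C" "Dom C y = I" "Cod C y = U" "A \<in> Ob C"
  shows "scal (z \<cdot> y) A = (lun C A \<cdot> (z \<otimes>\<^sub>a idt C A)) \<cdot> ((y \<otimes>\<^sub>a idt C A) \<cdot> ilun A)"
  using assms by (simp add: scal_def tar_merge)

lemma scal_mult:
  assumes "z \<in> Ar C" "Dom C z = I" "Cod C z = I" "y \<in> Ar C" "Dom C y = I" "Cod C y = I" "A \<in> Ob C"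
  shows "scal (z \<cdot> y) A = scal z A \<cdot> scal y A"
  using assms by (simp add: scal_def tar_merge)

lemma scal_idt [simp]: "A \<in> Ob C \<Longrightarrow> scal (idt C I) A = idt C A"
  by (simp add: scal_def)

lemma scal_hzero [simp]: "A \<in> Ob C \<Longrightarrow> scal (hzero C I I) A = hzero C A A"
  by (simp add: scal_def)

lemma scal_hadd:
  assumes "z \<in> Ar C" "Dom C z = I" "Cod C z = I" "y \<in> Ar C" "Dom C y = I" "Cod C y = I" "A \<in> Ob C"
  shows "scal (hadd C z y) A = hadd C (scal z A) (scal y A)"
  using assms tar_hadd_left[of z I I y "idt C A" A A] by (simp add: scal_def cmp_hadd_simp hadd_cmp_simp)

text \<open>Acting on the left factor is the compatibility of the left unitor with the associator;
  the right factor follows by braiding and naturality.\<close>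

lemma scal_tensor:
  assumes z: "z \<in> Ar C" "Dom C z = I" "Cod C z = I" and [simp]: "A \<in> Ob C" "B \<in> Ob C"
  shows "scal z (A \<otimes>\<^sub>o B) = scal z A \<otimes>\<^sub>a idt C B" "scal z (A \<otimes>\<^sub>o B) = idt C A \<otimes>\<^sub>a scal z B"
proof -
  have *: "scal z (A \<otimes>\<^sub>o B) = scal z A \<otimes>\<^sub>a idt C B" if [simp]: "A \<in> Ob C" "B \<in> Ob C" for A B
  proof (rule iso_cancel_right[OF tar_iso[OF lun_iso[of A] idt_iso(1)[of B]]])
    have "scal z (A \<otimes>\<^sub>o B) \<cdot> (lun C A \<otimes>\<^sub>a idt C B) = scal z (A \<otimes>\<^sub>o B) \<cdot> (lun C (A \<otimes>\<^sub>o B) \<cdot> asc C I A B)"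
      by (simp add: lun_tensor)
    also have "\<dots> = lun C (A \<otimes>\<^sub>o B) \<cdot> ((z \<otimes>\<^sub>a (idt C A \<otimes>\<^sub>a idt C B)) \<cdot> asc C I A B)"
      using z by (simp add: scal_def)
    also have "\<dots> = lun C (A \<otimes>\<^sub>o B) \<cdot> (asc C I A B \<cdot> ((z \<otimes>\<^sub>a idt C A) \<otimes>\<^sub>a idt C B))"
      using asc_nat[of z "idt C A" "idt C B" I A B] z by simp
    also have "\<dots> = (lun C A \<otimes>\<^sub>a idt C B) \<cdot> ((z \<otimes>\<^sub>a idt C A) \<otimes>\<^sub>a idt C B)"
      using z cmp_reassoc1[OF lun_tensor[of A B]] by simp
    also have "\<dots> = (scal z A \<otimes>\<^sub>a idt C B) \<cdot> (lun C A \<otimes>\<^sub>a idt C B)"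
      using z by (simp add: scal_def tar_merge)
    finally show "scal z (A \<otimes>\<^sub>o B) \<cdot> (lun C A \<otimes>\<^sub>a idt C B) = (scal z A \<otimes>\<^sub>a idt C B) \<cdot> (lun C A \<otimes>\<^sub>a idt C B)" .
  qed (use z in simp_all)
  show "scal z (A \<otimes>\<^sub>o B) = scal z A \<otimes>\<^sub>a idt C B"
    by (rule *) simp_all
  have "idt C A \<otimes>\<^sub>a scal z B = brd C B A \<cdot> (scal z (B \<otimes>\<^sub>o A) \<cdot> brd C A B)"
    using z by (subst tar_swap) (simp_all add: *)
  also have "\<dots> = scal z (A \<otimes>\<^sub>o B)"
    using z by (simp add: scal_nat)
  finally show "scal z (A \<otimes>\<^sub>o B) = idt C A \<otimes>\<^sub>a scal z B" ..
qed

text \<open>An Eckmann-Hilton argument: the action of \<open>z\<close> is natural, and on the unit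
  it is \<open>z\<close> itself.\<close>

lemma unit_commute:
  assumes "z \<in> Ar C" "Dom C z = I" "Cod C z = I" "y \<in> Ar C" "Dom C y = I" "Cod C y = I"
  shows "z \<cdot> y = y \<cdot> z"
  using scal_nat[of z y I] assms by simp

lemma Z_ring_simps [simp]:
  "carrier (Z_ring C) = homs C I I" "mult (Z_ring C) = Cmp C" "one (Z_ring C) = idt C I"
  "zero (Z_ring C) = hzero C I I" "add (Z_ring C) = hadd C"
  by (simp_all add: Z_ring_def)

lemma Z_ring_cring: "cring (Z_ring C)"
proof (rule cringI)
  show "abelian_group (Z_ring C)"
  proof (rule abelian_groupI)
    show "\<exists>y\<in>carrier (Z_ring C). y \<oplus>\<^bsub>Z_ring C\<^esub> x = \<zero>\<^bsub>Z_ring C\<^esub>" if "x \<in> carrier (Z_ring C)" for x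
      using that by (intro bexI[of _ "hneg x"]) auto
  qed (auto simp: hadd_assoc intro: hadd_comm)
  show "comm_monoid (Z_ring C)"
    by unfold_locales (auto intro: unit_commute)
qed (auto simp: hadd_cmp_simp)

end

section \<open>Complements of split subobjects and their idempotents\<close>

context additive_category
begin

text \<open>The complement is the kernel \<open>v\<close> of the retraction \<open>p\<close>.
  Existence of kernels is a hypothesis because this context is merely additive.\<close>

lemma retract_complement:
  assumes ker: "\<And>f. f \<in> Ar C \<Longrightarrow> \<exists>k. is_kernel C f k"
    and "k \<in> Ar C" "p \<in> Ar C" "Dom C p = Cod C k" "p \<cdot> k = idt C (Dom C k)"
  shows "\<exists>v. is_complement C k v"
proof -
  have cp: "Cod C p = Dom C k"
    using assms by (metis cmp_simps(3) dom_closed idt_simps(3))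
  obtain v where v: "is_kernel C p v"
    using ker assms by blast
  note V = kernelD[OF v]
  define X where "X = Cod C k"
  have X [simp]: "Cod C k = X" "Dom C p = X" "X \<in> Ob C" "Cod C v = X"
    using assms V by (auto simp: X_def)
  note [simp] = assms(2,3,5) cp V(2,4)
  \<comment> \<open>The complementary idempotent \<open>1 - k p\<close>. It is killed by
    \<open>p\<close>, so it factors through \<open>v\<close>, and the factor \<open>q\<close> is the
    second projection.\<close>
  define h where "h = hadd C (idt C X) (hneg (k \<cdot> p))"
  have h [simp]: "h \<in> Ar C" "Dom C h = X" "Cod C h = X"
    by (simp_all add: h_def)
  have hk: "hadd C (k \<cdot> p) h = idt C X"
  proof -
    have "hadd C (k \<cdot> p) h = hadd C h (k \<cdot> p)"
      by (rule hadd_comm) simp_all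
    also have "\<dots> = idt C X"
      by (simp add: h_def hadd_assoc)
    finally show ?thesis .
  qed
  have "p \<cdot> h = hzero C X (Dom C k)"
    by (simp add: h_def cmp_hadd_simp cmp_hneg cmp_reassoc1[OF assms(5)])
  then obtain q where q [simp]: "q \<in> Ar C" "Dom C q = X" "Cod C q = Dom C v" and vq: "v \<cdot> q = h"
    using V(5)[of h] by auto
  note [simp] = vq cmp_reassoc1[OF vq]
  have mono: "is_mono C v"
    by (rule kernel_mono[OF v])
  have "v \<cdot> (q \<cdot> k) = hzero C (Dom C k) X"
    by (simp add: h_def hadd_cmp_simp hneg_cmp)
  then have "q \<cdot> k = hzero C (Dom C k) (Dom C v)"
    using mono_zeroD[OF mono, of "q \<cdot> k"] by simp
  moreover have "v \<cdot> (q \<cdot> v) = v \<cdot> idt C (Dom C v)"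
  proof -
    have "v \<cdot> (q \<cdot> v) = hadd C (k \<cdot> (p \<cdot> v)) (h \<cdot> v)"
      by simp
    also have "\<dots> = hadd C (k \<cdot> p) h \<cdot> v"
      by (simp add: hadd_cmp_simp)
    finally show ?thesis
      by (simp add: hk)
  qed
  then have "q \<cdot> v = idt C (Dom C v)"
    by (rule monoD[OF mono, rotated -1]) simp_all
  ultimately have "is_biproduct C (Dom C k) (Dom C v) X k v p q"
    by (simp add: is_biproduct_def hk)
  then show ?thesis
    by (auto simp: is_complement_def)
qed

text \<open>The projection of a splitting meets the description by image and kernel in
  \<open>e_sub\<close>; the next lemma supplies the uniqueness that a definite description
  needs.\<close>

lemma biproduct_idempotent_image_kernel:
  assumes "is_biproduct C A B P i j p q"
  shows "is_image C (i \<cdot> p) i" "is_kernel C (i \<cdot> p) j"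
proof -
  note * [simp] = biproductD[OF assms]
  have ex: "is_kernel C q i" "is_cokernel C i q" "is_kernel C p j"
    using biproduct_short_exact[OF assms] biproduct_short_exact[OF biproduct_swap[OF assms]]
    by (auto simp: short_exact_def)
  have "is_cokernel C (i \<cdot> p) q"
  proof (rule is_cokernelI)
    show "is_epi C q"
      by (rule cokernel_epi[OF ex(2)])
    show "q \<cdot> (i \<cdot> p) = hzero C (Dom C (i \<cdot> p)) (Cod C q)"
      using cmp_reassoc1[OF *(19), of p] by simp
    fix h
    assume h: "h \<in> Ar C" "Dom C h = Cod C (i \<cdot> p)" "h \<cdot> (i \<cdot> p) = hzero C (Dom C (i \<cdot> p)) (Cod C h)"
    have "h \<cdot> i = (h \<cdot> (i \<cdot> p)) \<cdot> i"
      using h(1,2) by simp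
    also have "\<dots> = hzero C A (Cod C h)"
      unfolding h(3) using h(1,2) by simp
    finally show "\<exists>l. l \<in> Ar C \<and> Cod C l = Cod C h \<and> Dom C l = Cod C q \<and> l \<cdot> q = h"
      using cokernelD(5)[OF ex(2), of h] h(1,2) by simp
  qed simp_all
  then show "is_image C (i \<cdot> p) i"
    using ex by (auto simp: is_image_def)
  show "is_kernel C (i \<cdot> p) j"
  proof (rule is_kernelI)
    show "is_mono C j"
      by (rule kernel_mono[OF ex(3)])
    fix h
    assume h: "h \<in> Ar C" "Cod C h = Dom C (i \<cdot> p)" "(i \<cdot> p) \<cdot> h = hzero C (Dom C h) (Cod C (i \<cdot> p))"
    have "i \<cdot> (p \<cdot> h) = hzero C (Dom C h) P"
      using h by simp
    then have "p \<cdot> h = hzero C (Dom C h) A"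
      using mono_zeroD[OF kernel_mono[OF ex(1)], of "p \<cdot> h"] h(1,2) by simp
    then show "\<exists>l. l \<in> Ar C \<and> Dom C l = Dom C h \<and> Cod C l = Dom C j \<and> j \<cdot> l = h"
      using kernelD(5)[OF ex(3), of h] h(1,2) by simp
  qed simp_all
qed

text \<open>An idempotent is the identity on its image and zero on its kernel, which fixes it on
  both summands.\<close>

lemma idempotent_unique:
  assumes "is_biproduct C A B P i j p q" and e: "e \<in> Ar C" "e \<cdot> e = e" "is_image C e i" "is_kernel C e j"
  shows "e = i \<cdot> p"
proof -
  note * [simp] = biproductD[OF assms(1)]
  obtain c where c: "is_cokernel C e c" "is_kernel C c i"
    using e by (auto simp: is_image_def)
  note c1 = cokernelD[OF c(1)] and c2 = kernelD(1-4)[OF c(2)]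
  have de [simp]: "Dom C e = P" "Cod C e = P" "e \<in> Ar C"
    using kernelD(3)[OF e(4)] c1(3) c2(3) e by auto
  have [simp]: "Dom C c = P"
    using c2 by simp
  \<comment> \<open>\<open>1 - e\<close> kills \<open>e\<close>, hence factors through the cokernel
    \<open>c\<close>. Since \<open>c\<close> kills \<open>i\<close>, so does \<open>1 - e\<close>,
    that is, \<open>e \<cdot> i = i\<close>.\<close>
  define h where "h = hadd C (idt C P) (hneg e)"
  have h [simp]: "h \<in> Ar C" "Dom C h = P" "Cod C h = P"
    by (simp_all add: h_def)
  have "h \<cdot> e = hzero C P P"
    by (simp add: h_def hadd_cmp_simp hneg_cmp e(2))
  then obtain l where l: "l \<in> Ar C" "Cod C l = P" "Dom C l = Cod C c" "l \<cdot> c = h"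
    using c1(5)[of h] by auto
  have "h \<cdot> i = l \<cdot> (c \<cdot> i)"
    unfolding l(4)[symmetric] by (rule cmp_assoc_simp) (use l c1 c2 in simp_all)
  also have "\<dots> = hzero C A P"
    unfolding c2(4) using l c2 by simp
  finally have "hadd C i (hneg (e \<cdot> i)) = hzero C A P"
    by (simp add: h_def hadd_cmp_simp hneg_cmp)
  then have ei: "i = e \<cdot> i"
    using hadd_hneg_eq_zero[of i "e \<cdot> i"] by simp
  have "e = e \<cdot> hadd C (i \<cdot> p) (j \<cdot> q)"
    by simp
  also have "\<dots> = hadd C (e \<cdot> (i \<cdot> p)) (e \<cdot> (j \<cdot> q))"
    by (subst cmp_hadd_simp) (simp_all del: *(20))
  also have "e \<cdot> (i \<cdot> p) = i \<cdot> p"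
    using cmp_reassoc1[OF ei[symmetric], of p] by simp
  also have "e \<cdot> (j \<cdot> q) = hzero C P P"
    using cmp_reassoc1[OF kernelD(4)[OF e(4)], of q] by simp
  finally show ?thesis
    by simp
qed

end

section \<open>The support idempotent of an object\<close>

context rigid_abelian_tensor_category
begin

text \<open>The triangle identity writes the unitor of \<open>A\<close> as a composite through
  \<open>A \<otimes> \<eta>\<close> and \<open>\<epsilon> \<otimes> A\<close>; composing with
  \<open>x\<close> or \<open>y\<close> brings \<open>\<eta> \<cdot> x\<close> or
  \<open>y \<cdot> \<epsilon>\<close> into it.\<close>

lemma dual_annihilates:
  assumes dual: "is_dual C A D \<eta> \<epsilon>" and [simp]: "A \<in> Ob C"
  shows "x \<in> Ar C \<Longrightarrow> Cod C x = I \<Longrightarrow> \<eta> \<cdot> x = hzero C (Dom C x) (D \<otimes>\<^sub>o A) \<Longrightarrow>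
      idt C A \<otimes>\<^sub>a x = hzero C (A \<otimes>\<^sub>o Dom C x) (A \<otimes>\<^sub>o I)"
    and "y \<in> Ar C \<Longrightarrow> Dom C y = I \<Longrightarrow> y \<cdot> \<epsilon> = hzero C (A \<otimes>\<^sub>o D) (Cod C y) \<Longrightarrow>
      y \<otimes>\<^sub>a idt C A = hzero C (I \<otimes>\<^sub>o A) (Cod C y \<otimes>\<^sub>o A)"
proof -
  note D [simp] = dualD(1-7)[OF dual] and D8 = dualD(8)[OF dual]
  show "idt C A \<otimes>\<^sub>a x = hzero C (A \<otimes>\<^sub>o Dom C x) (A \<otimes>\<^sub>o I)"
    if x: "x \<in> Ar C" "Cod C x = I" "\<eta> \<cdot> x = hzero C (Dom C x) (D \<otimes>\<^sub>o A)"
  proof -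
    have [simp]: "Dom C x \<in> Ob C"
      using x by simp
    have "run C A \<cdot> (idt C A \<otimes>\<^sub>a x) = lun C A \<cdot> ((\<epsilon> \<otimes>\<^sub>a idt C A) \<cdot> (iasc A D A \<cdot> (idt C A \<otimes>\<^sub>a (\<eta> \<cdot> x))))"
      unfolding D8[symmetric] using x(1,2) by (simp add: tar_merge)
    also have "\<dots> = run C A \<cdot> hzero C (A \<otimes>\<^sub>o Dom C x) (A \<otimes>\<^sub>o I)"
      unfolding x(3) by simp
    finally show ?thesis
      by (rule iso_cancel_left[OF run_iso, rotated -1]) (use x in simp_all)
  qed
  show "y \<otimes>\<^sub>a idt C A = hzero C (I \<otimes>\<^sub>o A) (Cod C y \<otimes>\<^sub>o A)"
    if y: "y \<in> Ar C" "Dom C y = I" "y \<cdot> \<epsilon> = hzero C (A \<otimes>\<^sub>o D) (Cod C y)"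
  proof -
    have [simp]: "Cod C y \<in> Ob C"
      using y by simp
    have "(y \<otimes>\<^sub>a idt C A) \<cdot> (ilun A \<cdot> run C A) =
        ((y \<cdot> \<epsilon>) \<otimes>\<^sub>a idt C A) \<cdot> (iasc A D A \<cdot> (idt C A \<otimes>\<^sub>a \<eta>))"
      unfolding D8[symmetric] using y(1,2) by (simp add: tar_merge)
    also have "\<dots> = hzero C (I \<otimes>\<^sub>o A) (Cod C y \<otimes>\<^sub>o A) \<cdot> (ilun A \<cdot> run C A)"
      unfolding y(3) by simp
    finally show ?thesis
      by (rule iso_cancel_right[OF iso_cmp[OF run_iso inv_ar_iso[OF lun_iso]], rotated -1]) (use y in simp_all)
  qed
qed

lemma null_ob_asc_brd:
  assumes "null_ob (N \<otimes>\<^sub>o A)" and [simp]: "N \<in> Ob C" "A \<in> Ob C" "D \<in> Ob C"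
  shows "null_ob (A \<otimes>\<^sub>o N)" "null_ob (N \<otimes>\<^sub>o (A \<otimes>\<^sub>o D))" "null_ob (N \<otimes>\<^sub>o (D \<otimes>\<^sub>o A))"
proof -
  show "null_ob (A \<otimes>\<^sub>o N)"
    using assms null_ob_iso[OF brd_iso[of N A]] by simp
  show *: "null_ob (N \<otimes>\<^sub>o (A \<otimes>\<^sub>o D))"
    using null_ob_tensor(1)[OF assms(1), of D] null_ob_iso[OF asc_iso[of N A D]] by simp
  show "null_ob (N \<otimes>\<^sub>o (D \<otimes>\<^sub>o A))"
    using * null_ob_iso[OF tar_iso[OF idt_iso(1) brd_iso], of N A D] by simp
qed

text \<open>
  The kernel of \<open>\<eta>\<close> and the cokernel of \<open>\<epsilon>\<close> are both annihilated by \<open>A\<close>, whereas \<open>1 / Ker \<eta>\<close> and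
  \<open>Im \<epsilon>\<close> are a subobject and a quotient of \<open>D \<otimes> A\<close> and \<open>A \<otimes> D\<close>. Hence the kernel and the cokernel of
  \<open>Ker \<eta> \<rightarrow> 1 \<rightarrow> Coker \<epsilon>\<close> have tensor square zero.
\<close>

lemma coev_kernel_retract:
  assumes dual: "is_dual C A D \<eta> \<epsilon>" and [simp]: "A \<in> Ob C" and k: "is_kernel C \<eta> k"
  shows "\<exists>p. p \<in> Ar C \<and> Dom C p = Cod C k \<and> p \<cdot> k = idt C (Dom C k)"
proof -
  note D [simp] = dualD(1-7)[OF dual]
  note K = kernelD[OF k]
  have [simp]: "k \<in> Ar C" "Cod C k = I"
    using K by simp_all
  obtain c where c: "is_cokernel C \<epsilon> c"
    using ex_cokernel D by blast
  note L = cokernelD[OF c]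
  have [simp]: "c \<in> Ar C" "Dom C c = I"
    using L by simp_all
  obtain k' where k': "is_kernel C \<epsilon> k'"
    using ex_kernel D by blast
  obtain c' where c': "is_cokernel C \<eta> c'"
    using ex_cokernel D by blast
  obtain j r where jr: "is_kernel C c j" "is_cokernel C k' r" "Dom C r = Dom C \<epsilon>" "Cod C j = Cod C \<epsilon>"
    "Dom C j = Cod C r" "\<epsilon> = j \<cdot> r"
    using image_factor[OF k' c] by blast
  obtain m \<pi> where m\<pi>: "is_kernel C c' m" "is_cokernel C k \<pi>" "Dom C \<pi> = Dom C \<eta>" "Cod C m = Cod C \<eta>"
    "Dom C m = Cod C \<pi>" "\<eta> = m \<cdot> \<pi>"
    using image_factor[OF k c'] by blast
  have [simp]: "j \<in> Ar C" "r \<in> Ar C" "m \<in> Ar C" "\<pi> \<in> Ar C"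
    using kernelD[OF jr(1)] cokernelD[OF jr(2)] kernelD[OF m\<pi>(1)] cokernelD[OF m\<pi>(2)] by auto
  \<comment> \<open>Once this arrow from the kernel of \<open>\<eta>\<close> to the cokernel of
    \<open>\<epsilon>\<close> is invertible, its inverse after \<open>c\<close> is the desired
    retraction.\<close>
  let ?g = "c \<cdot> k"
  obtain n where n: "is_kernel C ?g n"
    using ex_kernel[of ?g] by auto
  note N = kernelD[OF n]
  have [simp]: "n \<in> Ar C" "Cod C n = Dom C k"
    using N by simp_all
  let ?N = "Dom C n"
  have kn: "is_mono C (k \<cdot> n)"
    by (rule mono_cmp[OF kernel_mono[OF n] kernel_mono[OF k]]) simp
  have "idt C A \<otimes>\<^sub>a (k \<cdot> n) = hzero C (A \<otimes>\<^sub>o ?N) (A \<otimes>\<^sub>o I)"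
    using dual_annihilates(1)[OF dual, of "k \<cdot> n"] cmp_reassoc1[OF K(4), of n] by simp
  then have "null_ob (A \<otimes>\<^sub>o ?N)"
    using null_ob_mono[OF tensor_mono_left[OF assms(2) kn]] by simp
  then have "null_ob (?N \<otimes>\<^sub>o A)"
    using null_ob_iso[OF brd_iso[of A ?N]] by simp
  then have "null_ob (?N \<otimes>\<^sub>o (A \<otimes>\<^sub>o D))"
    by (rule null_ob_asc_brd(2)) simp_all
  then have nr: "null_ob (?N \<otimes>\<^sub>o Cod C r)"
    using null_ob_epi_from[OF tensor_epi_left[OF _ cokernel_epi[OF jr(2)], of ?N]] jr(3) by simp
  \<comment> \<open>\<open>k \<cdot> n\<close> lands in the kernel \<open>j\<close> of
    \<open>c\<close>, which is the image of \<open>\<epsilon>\<close>; so \<open>?N\<close> embeds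
    into an object whose tensor product with \<open>?N\<close> is zero.\<close>
  have "c \<cdot> (k \<cdot> n) = hzero C ?N (Cod C c)"
    using N(4) by simp
  then obtain n' where n': "n' \<in> Ar C" "Dom C n' = ?N" "Cod C n' = Dom C j" "j \<cdot> n' = k \<cdot> n"
    using kernelD(5)[OF jr(1), of "k \<cdot> n"] by auto
  have "is_mono C n'"
    by (rule mono_cancel[of j]) (use n' kn in simp_all)
  then have "null_ob (?N \<otimes>\<^sub>o ?N)"
    using null_ob_mono_into[OF tensor_mono_left[of ?N n']] nr n' jr(5) by simp
  then have "null_ob ?N"
    by (rule null_ob_square) simp
  then have n0: "n = hzero C ?N (Dom C k)"
    using null_ob_dom[of ?N n] by simp
  have g_mono: "is_mono C ?g"
  proof (rule monoI)
    fix x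
    assume x: "x \<in> Ar C" "Cod C x = Dom C ?g" "?g \<cdot> x = hzero C (Dom C x) (Cod C ?g)"
    then obtain l where "l \<in> Ar C" "Dom C l = Dom C x" "Cod C l = ?N" "n \<cdot> l = x"
      using N(5)[of x] by auto
    then show "x = hzero C (Dom C x) (Dom C ?g)"
      using n0 by (metis cmp_simps(2) dom_closed \<open>k \<in> Ar C\<close> \<open>c \<in> Ar C\<close> \<open>Cod C k = I\<close> \<open>Dom C c = I\<close> hzero_cmp)
  qed simp
  obtain q where q: "is_cokernel C ?g q"
    using ex_cokernel[of ?g] by auto
  note Q = cokernelD[OF q]
  have [simp]: "q \<in> Ar C" "Dom C q = Cod C c"
    using Q by simp_all
  let ?R = "Cod C q"
  have qc: "is_epi C (q \<cdot> c)"
    by (rule epi_cmp[OF cokernel_epi[OF c] cokernel_epi[OF q]]) simp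
  have "(q \<cdot> c) \<otimes>\<^sub>a idt C A = hzero C (I \<otimes>\<^sub>o A) (?R \<otimes>\<^sub>o A)"
    using dual_annihilates(2)[OF dual, of "q \<cdot> c"] L(4) by simp
  then have "null_ob (?R \<otimes>\<^sub>o A)"
    using null_ob_epi[OF tensor_epi_right[OF assms(2) qc]] by simp
  then have "null_ob (?R \<otimes>\<^sub>o (D \<otimes>\<^sub>o A))"
    by (rule null_ob_asc_brd(3)) simp_all
  then have rm: "null_ob (?R \<otimes>\<^sub>o Dom C m)"
    using null_ob_mono_into[OF tensor_mono_left[OF _ kernel_mono[OF m\<pi>(1)], of ?R]] m\<pi>(4) by simp
  \<comment> \<open>Dually, \<open>q \<cdot> c\<close> kills \<open>k\<close> and factors through
    the coimage of \<open>\<eta>\<close>; so \<open>?R\<close> is a quotient of an object whose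
    tensor product with \<open>?R\<close> is zero.\<close>
  have "(q \<cdot> c) \<cdot> k = hzero C (Dom C k) ?R"
    using Q(4) by simp
  then obtain q' where q': "q' \<in> Ar C" "Cod C q' = ?R" "Dom C q' = Cod C \<pi>" "q' \<cdot> \<pi> = q \<cdot> c"
    using cokernelD(5)[OF m\<pi>(2), of "q \<cdot> c"] by auto
  have "is_epi C q'"
    by (rule epi_cancel[of _ \<pi>]) (use q' qc in simp_all)
  then have "null_ob (?R \<otimes>\<^sub>o ?R)"
    using null_ob_epi_from[OF tensor_epi_left[of ?R q']] rm q' m\<pi>(5) by simp
  then have "null_ob ?R"
    by (rule null_ob_square) simp
  then have q0: "q = hzero C (Cod C c) ?R"
    using null_ob_cod[of ?R q] by simp
  have g_epi: "is_epi C ?g"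
  proof (rule epiI)
    fix x
    assume x: "x \<in> Ar C" "Dom C x = Cod C ?g" "x \<cdot> ?g = hzero C (Dom C ?g) (Cod C x)"
    then obtain l where "l \<in> Ar C" "Cod C l = Cod C x" "Dom C l = ?R" "l \<cdot> q = x"
      using Q(5)[of x] by auto
    then show "x = hzero C (Cod C ?g) (Cod C x)"
      using q0 by (metis cmp_simps(3) cod_closed \<open>k \<in> Ar C\<close> \<open>c \<in> Ar C\<close> \<open>Cod C k = I\<close> \<open>Dom C c = I\<close> cmp_hzero)
  qed simp
  note G = inv_ar_simps[OF mono_epi_iso[OF g_mono g_epi]]
  show ?thesis
    using G by (intro exI[of _ "inv_ar C ?g \<cdot> c"]) simp
qed

lemma coev_dual:
  assumes "A \<in> Ob C"
  shows "\<exists>D \<epsilon>. is_dual C A D (coev C A) \<epsilon>"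
  unfolding coev_def by (rule someI_ex) (use rigid[OF assms] in blast)

text \<open>The kernel \<open>k\<close> of the coevaluation and the support are complementary
  summands of the unit. The first is annihilated by \<open>A\<close>, so the projection to the
  second acts on \<open>A\<close> as the identity; the second meets the kernel trivially, so the
  coevaluation embeds it.\<close>

lemma e_obj_factor:
  assumes [simp]: "A \<in> Ob C"
  shows "\<exists>i j. i \<in> Ar C \<and> j \<in> Ar C \<and> Cod C i = I \<and> Dom C j = I \<and> Cod C j = Dom C i \<and> j \<cdot> i = idt C (Dom C i) \<and>
    e_obj C A = i \<cdot> j \<and> is_mono C (coev C A \<cdot> i) \<and> scal (e_obj C A) A = idt C A"
proof -
  obtain D \<epsilon> where dual: "is_dual C A D (coev C A) \<epsilon>"
    using coev_dual[OF assms] by blast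
  note D [simp] = dualD(1-7)[OF dual]
  define k where "k = (SOME k. is_kernel C (coev C A) k)"
  have k: "is_kernel C (coev C A) k"
    unfolding k_def by (rule someI_ex) (use ex_kernel in simp)
  note K = kernelD[OF k]
  have [simp]: "Cod C k = I" "k \<in> Ar C"
    using K by simp_all
  obtain p where "p \<in> Ar C" "Dom C p = Cod C k" "p \<cdot> k = idt C (Dom C k)"
    using coev_kernel_retract[OF dual assms k] by blast
  then have "\<exists>v. is_complement C k v"
    by (intro retract_complement[of k p]) (simp_all add: ex_kernel)
  then have "is_complement C k (complement C k)"
    unfolding complement_def by (rule someI_ex)
  moreover have supp: "supp C A = complement C k"
    by (simp add: supp_def k_def)
  ultimately obtain p0 q0 where b0: "is_biproduct C (Dom C k) (Dom C (supp C A)) I k (supp C A) p0 q0"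
    by (auto simp: is_complement_def)
  define v where "v = supp C A"
  note b0' = b0[folded v_def]
  note B = biproductD[OF b0'] and [simp] = biproductD(1-4,7-20)[OF b0']
  have "\<exists>v'. is_complement C v v'"
    by (intro retract_complement[of v q0]) (simp_all add: ex_kernel)
  then have "is_complement C v (complement C v)"
    unfolding complement_def by (rule someI_ex)
  then obtain p q where b: "is_biproduct C (Dom C v) (Dom C (complement C v)) I v (complement C v) p q"
    by (auto simp: is_complement_def)
  note B' = biproductD[OF b]
  note [simp] = B'(3,9,11,16)
  have "e_obj C A = (THE e. e \<in> carrier (Z_ring C) \<and> e \<cdot> e = e \<and> is_image C e v \<and> is_kernel C e (complement C v))"
    by (simp add: e_obj_def e_sub_def v_def)
  also have "\<dots> = v \<cdot> p"
  proof (rule the_equality)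
    show "v \<cdot> p \<in> carrier (Z_ring C) \<and> (v \<cdot> p) \<cdot> (v \<cdot> p) = v \<cdot> p \<and> is_image C (v \<cdot> p) v \<and>
        is_kernel C (v \<cdot> p) (complement C v)"
      using biproduct_idempotent_image_kernel[OF b] by (simp add: cmp_reassoc1[OF B'(16)])
    show "e = v \<cdot> p" if "e \<in> carrier (Z_ring C) \<and> e \<cdot> e = e \<and> is_image C e v \<and> is_kernel C e (complement C v)" for e
      by (rule idempotent_unique[OF b]) (use that in auto)
  qed
  \<comment> \<open>The second use of \<open>complement\<close> may choose a summand other than
    \<open>k\<close>, which gives another projection \<open>p\<close> onto \<open>v\<close>. Two
    idempotents with the same image absorb each other, and scalars commute, so they agree.\<close>
  also have "\<dots> = v \<cdot> q0"
  proof -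
    have "(v \<cdot> p) \<cdot> (v \<cdot> q0) = (v \<cdot> q0) \<cdot> (v \<cdot> p)"
      by (rule unit_commute) simp_all
    then show ?thesis
      by (simp add: cmp_reassoc1[OF B'(16)] cmp_reassoc1[OF B(17)])
  qed
  finally have e: "e_obj C A = v \<cdot> q0" .
  have mono: "is_mono C (coev C A \<cdot> v)"
  proof (rule monoI)
    fix x
    assume x: "x \<in> Ar C" "Cod C x = Dom C (coev C A \<cdot> v)"
      "(coev C A \<cdot> v) \<cdot> x = hzero C (Dom C x) (Cod C (coev C A \<cdot> v))"
    then have x' [simp]: "x \<in> Ar C" "Cod C x = Dom C v"
      by simp_all
    obtain l where l [simp]: "l \<in> Ar C" "Dom C l = Dom C x" "Cod C l = Dom C k" and kl: "k \<cdot> l = v \<cdot> x"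
      using K(5)[of "v \<cdot> x"] x by auto
    have "x = q0 \<cdot> (v \<cdot> x)"
      by (simp add: cmp_reassoc1[OF B(17)])
    also have "\<dots> = hzero C (Dom C x) (Dom C v)"
      unfolding kl[symmetric] by (simp add: cmp_reassoc1[OF B(19)])
    finally show "x = hzero C (Dom C x) (Dom C (coev C A \<cdot> v))"
      by simp
  qed simp
  \<comment> \<open>\<open>1 - e(A)\<close> is \<open>k \<cdot> p0\<close>, and \<open>k\<close> is
    annihilated by \<open>A\<close>; so only the action of \<open>e(A)\<close> remains in the
    identity of \<open>A\<close>.\<close>
  have "idt C A \<otimes>\<^sub>a k = hzero C (A \<otimes>\<^sub>o Dom C k) (A \<otimes>\<^sub>o I)"
    using dual_annihilates(1)[OF dual, of k] K(4) by simp
  then have "k \<otimes>\<^sub>a idt C A = hzero C (Dom C k \<otimes>\<^sub>o A) (I \<otimes>\<^sub>o A)"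
    using tar_swap[of k "idt C A"] by simp
  then have "scal (k \<cdot> p0) A = hzero C A A"
    by (subst scal_cmp) simp_all
  moreover have "idt C A = scal (hadd C (k \<cdot> p0) (v \<cdot> q0)) A"
    by simp
  then have "idt C A = hadd C (scal (k \<cdot> p0) A) (scal (v \<cdot> q0) A)"
    by (subst (asm) scal_hadd) (simp_all del: B(20))
  ultimately have "scal (v \<cdot> q0) A = idt C A"
    by simp
  with e mono show ?thesis
    by (intro exI[of _ v] exI[of _ q0]) simp
qed

end

section \<open>The multiplicative set of a Serre ideal\<close>

locale serre_ideal = rigid_abelian_tensor_category C for C :: "('o, 'm, 'z) tensor_cat_scheme" (structure) +
  fixes J :: "'o set"
  assumes serre: "serre_tensor_ideal C J"
begin

lemma J_Ob [simp]: "A \<in> J \<Longrightarrow> A \<in> Ob C"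
  using serre by (auto simp: serre_tensor_ideal_def serre_subcategory_def)

lemma J_short_exact:
  assumes "short_exact C f g"
  shows "Cod C f \<in> J \<longleftrightarrow> Dom C f \<in> J \<and> Cod C g \<in> J"
  using assms serre by (auto simp: serre_tensor_ideal_def serre_subcategory_def)

lemma J_sub:
  assumes "is_mono C f" "Cod C f \<in> J"
  shows "Dom C f \<in> J"
proof -
  obtain c where "is_cokernel C f c"
    using ex_cokernel[of f] assms by (auto simp: is_mono_def)
  then show ?thesis
    using mono_short_exact[OF assms(1)] J_short_exact assms(2) by blast
qed

lemma J_biproduct:
  assumes "is_biproduct C A B P i j p q" "A \<in> J" "B \<in> J"
  shows "P \<in> J"
  using J_short_exact[OF biproduct_short_exact[OF assms(1)]] assms(2,3) biproductD[OF assms(1)] by simp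

lemma J_tensor:
  assumes "A \<in> Ob C" "B \<in> J"
  shows "A \<otimes>\<^sub>o B \<in> J" "B \<otimes>\<^sub>o A \<in> J"
proof -
  show *: "A \<otimes>\<^sub>o B \<in> J"
    using assms serre by (auto simp: serre_tensor_ideal_def)
  show "B \<otimes>\<^sub>o A \<in> J"
    using J_sub[OF iso_mono[OF brd_iso[of B A]]] assms * by simp
qed

text \<open>
  The scalars \<open>w = 1 - e\<close> with \<open>e \<in> I(J)\<close> an idempotent whose image lies in \<open>J\<close>; the condition on the image
  is expressed by a factorisation of \<open>e\<close> through an object of \<open>J\<close>. Inverting \<open>S\<close> is the same as localising at \<open>J\<close>.
\<close>

definition S :: "'m set" where
  "S = {w. w \<in> Ar C \<and> Dom C w = I \<and> Cod C w = I \<and> w \<cdot> w = w \<and>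
    (\<exists>i j. i \<in> Ar C \<and> j \<in> Ar C \<and> Dom C i \<in> J \<and> Cod C j = Dom C i \<and> Cod C i = I \<and> Dom C j = I \<and>
      i \<cdot> j \<in> I_ideal C J \<and> hadd C (i \<cdot> j) w = idt C I)}"

lemma S_intro:
  assumes "w \<in> Ar C" "Dom C w = I" "Cod C w = I" "w \<cdot> w = w"
    "i \<in> Ar C" "j \<in> Ar C" "Dom C i \<in> J" "Cod C j = Dom C i" "Cod C i = I" "Dom C j = I"
    "i \<cdot> j \<in> I_ideal C J" "hadd C (i \<cdot> j) w = idt C I"
  shows "w \<in> S"
  using assms unfolding S_def by blast

lemma S_elim:
  assumes "w \<in> S"
  obtains i j where "i \<in> Ar C" "j \<in> Ar C" "Cod C j = Dom C i" "Cod C i = I" "Dom C j = I"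
    "Dom C i \<in> J" "i \<cdot> j \<in> I_ideal C J" "hadd C (i \<cdot> j) w = idt C I"
  using assms unfolding S_def by blast

lemma S_simps [simp]:
  assumes "w \<in> S"
  shows "w \<in> Ar C" "Dom C w = I" "Cod C w = I"
  using assms by (auto simp: S_def)

lemma S_idem: "w \<in> S \<Longrightarrow> w \<cdot> w = w"
  unfolding S_def by blast

lemma e_obj_closed:
  assumes "A \<in> Ob C"
  shows "e_obj C A \<in> Ar C" "Dom C (e_obj C A) = I" "Cod C (e_obj C A) = I"
  using e_obj_factor[OF assms] by (elim exE conjE, simp)+

lemma I_ideal_ideal: "ideal (I_ideal C J) (Z_ring C)"
proof -
  interpret cring "Z_ring C"
    by (rule Z_ring_cring)
  show ?thesis
    unfolding I_ideal_def by (rule genideal_ideal) (use e_obj_closed in auto)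
qed

lemma I_ideal_simps [simp]:
  assumes "z \<in> I_ideal C J"
  shows "z \<in> Ar C" "Dom C z = I" "Cod C z = I"
  using ideal.Icarr[OF I_ideal_ideal assms] by auto

lemma I_ideal_closed:
  shows "hzero C I I \<in> I_ideal C J"
    and "x \<in> I_ideal C J \<Longrightarrow> y \<in> I_ideal C J \<Longrightarrow> hadd C x y \<in> I_ideal C J"
    and "x \<in> I_ideal C J \<Longrightarrow> z \<in> Ar C \<Longrightarrow> Dom C z = I \<Longrightarrow> Cod C z = I \<Longrightarrow> z \<cdot> x \<in> I_ideal C J"
    and "x \<in> I_ideal C J \<Longrightarrow> z \<in> Ar C \<Longrightarrow> Dom C z = I \<Longrightarrow> Cod C z = I \<Longrightarrow> x \<cdot> z \<in> I_ideal C J"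
proof -
  interpret ideal "I_ideal C J" "Z_ring C"
    by (rule I_ideal_ideal)
  show "hzero C I I \<in> I_ideal C J"
    using additive_subgroup.zero_closed[OF is_additive_subgroup] by simp
  show "x \<in> I_ideal C J \<Longrightarrow> y \<in> I_ideal C J \<Longrightarrow> hadd C x y \<in> I_ideal C J"
    using additive_subgroup.a_closed[OF is_additive_subgroup, of x y] by simp
  show "x \<in> I_ideal C J \<Longrightarrow> z \<in> Ar C \<Longrightarrow> Dom C z = I \<Longrightarrow> Cod C z = I \<Longrightarrow> z \<cdot> x \<in> I_ideal C J"
    using I_l_closed[of x z] by simp
  show "x \<in> I_ideal C J \<Longrightarrow> z \<in> Ar C \<Longrightarrow> Dom C z = I \<Longrightarrow> Cod C z = I \<Longrightarrow> x \<cdot> z \<in> I_ideal C J"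
    using I_r_closed[of x z] by simp
qed

lemma S_idt: "idt C I \<in> S"
proof -
  \<comment> \<open>A Serre subcategory is nonempty, and the zero scalar \<open>1 - 1\<close>
    factors through any of its objects.\<close>
  obtain U where U: "U \<in> J"
    using serre by (auto simp: serre_tensor_ideal_def serre_subcategory_def)
  then show ?thesis
    by (intro S_intro[where i = "hzero C U I" and j = "hzero C I U"]) (simp_all add: I_ideal_closed)
qed

text \<open>With \<open>e = 1 - w\<close> and \<open>e' = 1 - w'\<close> one has
  \<open>1 - w w' = e + w e'\<close>, which factors through the biproduct of the two objects of
  \<open>J\<close>.\<close>

lemma S_mult:
  assumes "w \<in> S" "w' \<in> S"
  shows "w \<cdot> w' \<in> S"
proof -
  note [simp] = assms
  obtain i j where ij [simp]: "i \<in> Ar C" "j \<in> Ar C" "Cod C j = Dom C i" "Cod C i = I" "Dom C j = I"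
    and ij': "Dom C i \<in> J" "i \<cdot> j \<in> I_ideal C J" "hadd C (i \<cdot> j) w = idt C I"
    using S_elim[OF assms(1)] by blast
  obtain i' j' where ij2 [simp]: "i' \<in> Ar C" "j' \<in> Ar C" "Cod C j' = Dom C i'" "Cod C i' = I" "Dom C j' = I"
    and ij2': "Dom C i' \<in> J" "i' \<cdot> j' \<in> I_ideal C J" "hadd C (i' \<cdot> j') w' = idt C I"
    using S_elim[OF assms(2)] by blast
  obtain P a b p q where bip: "is_biproduct C (Dom C i) (Dom C i') P a b p q"
    using ex_biproduct[of "Dom C i" "Dom C i'"] by auto
  note B [simp] = biproductD(1-19)[OF bip]
  note B' = B(16-19)[THEN cmp_reassoc1]
  define i2 where "i2 = hadd C (i \<cdot> p) (w \<cdot> (i' \<cdot> q))"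
  define j2 where "j2 = hadd C (a \<cdot> j) (b \<cdot> j')"
  have [simp]: "i2 \<in> Ar C" "Dom C i2 = P" "Cod C i2 = I" "j2 \<in> Ar C" "Dom C j2 = I" "Cod C j2 = P"
    by (simp_all add: i2_def j2_def)
  have e: "i2 \<cdot> j2 = hadd C (i \<cdot> j) (w \<cdot> (i' \<cdot> j'))"
    by (simp add: i2_def j2_def cmp_hadd_simp hadd_cmp_simp B')
  have "hadd C (i2 \<cdot> j2) (w \<cdot> w') = hadd C (i \<cdot> j) (w \<cdot> hadd C (i' \<cdot> j') w')"
    by (simp add: e hadd_assoc cmp_hadd_simp)
  then have "hadd C (i2 \<cdot> j2) (w \<cdot> w') = idt C I"
    by (simp add: ij'(3) ij2'(3))
  moreover have "i2 \<cdot> j2 \<in> I_ideal C J"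
    unfolding e using ij'(2) ij2'(2) by (simp add: I_ideal_closed)
  moreover have "Dom C i2 \<in> J"
    using J_biproduct[OF bip ij'(1) ij2'(1)] by simp
  moreover have "(w \<cdot> w') \<cdot> (w \<cdot> w') = w \<cdot> w'"
  proof -
    have "w' \<cdot> (w \<cdot> w') = w \<cdot> (w' \<cdot> w')"
      by (rule cmp_reassoc[OF unit_commute]) simp_all
    then have "(w \<cdot> w') \<cdot> (w \<cdot> w') = (w \<cdot> w) \<cdot> (w' \<cdot> w')"
      by simp
    then show ?thesis
      by (simp only: S_idem assms)
  qed
  ultimately show ?thesis
    by (intro S_intro[where i = i2 and j = j2]) simp_all
qed

text \<open>For \<open>A\<close> in \<open>J\<close> take \<open>w = 1 - e(A)\<close>: the image of
  \<open>e(A)\<close> embeds into \<open>D \<otimes> A\<close> and so lies in \<open>J\<close>.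
  Conversely, if \<open>w\<close> acts as zero, the identity of \<open>A\<close> is the action of
  \<open>1 - w\<close> and passes through \<open>U \<otimes> A\<close> for some \<open>U\<close> in
  \<open>J\<close>.\<close>

lemma S_kills_iff:
  assumes [simp]: "A \<in> Ob C"
  shows "A \<in> J \<longleftrightarrow> (\<exists>w\<in>S. scal w A = hzero C A A)"
proof
  assume A: "A \<in> J"
  obtain i j where ij [simp]: "i \<in> Ar C" "j \<in> Ar C" "Cod C i = I" "Dom C j = I" "Cod C j = Dom C i"
    "j \<cdot> i = idt C (Dom C i)" and e: "e_obj C A = i \<cdot> j" and mono: "is_mono C (coev C A \<cdot> i)"
    and sc: "scal (e_obj C A) A = idt C A"
    using e_obj_factor[OF assms] by blast
  obtain D \<epsilon> where dual: "is_dual C A D (coev C A) \<epsilon>"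
    using coev_dual[OF assms] by blast
  note D = dualD[OF dual]
  have U: "Dom C i \<in> J"
    using J_sub[OF mono] J_tensor(1)[OF D(1) A] D by simp
  define e where "e = i \<cdot> j"
  have e_simps [simp]: "e \<in> Ar C" "Dom C e = I" "Cod C e = I"
    by (simp_all add: e_def)
  have ee: "e \<cdot> e = e"
    by (simp add: e_def cmp_reassoc1[OF ij(6)])
  define w where "w = hadd C (idt C I) (hneg e)"
  have w [simp]: "w \<in> Ar C" "Dom C w = I" "Cod C w = I"
    by (simp_all add: w_def)
  have ew: "hadd C e w = idt C I"
  proof -
    have "hadd C e w = hadd C w e"
      by (rule hadd_comm) simp_all
    then show ?thesis
      by (simp add: w_def hadd_assoc)
  qed
  have "e \<cdot> w = hzero C I I"
    by (simp add: w_def cmp_hadd_simp cmp_hneg ee)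
  moreover have "hadd C (e \<cdot> w) (w \<cdot> w) = hadd C e w \<cdot> w"
    by (simp add: hadd_cmp_simp)
  ultimately have ww: "w \<cdot> w = w"
    by (simp add: ew)
  have "e_obj C A \<in> I_ideal C J"
  proof -
    interpret cring "Z_ring C"
      by (rule Z_ring_cring)
    have "e_obj C ` J \<subseteq> I_ideal C J"
      unfolding I_ideal_def by (rule genideal_self) (use e_obj_closed in auto)
    then show ?thesis
      using A by blast
  qed
  then have "w \<in> S"
    using U ww ew e by (intro S_intro[where i = i and j = j]) (simp_all add: e_def)
  moreover have "scal e A = idt C A"
    using sc by (simp add: e e_def)
  then have "hadd C (scal e A) (scal w A) = hadd C (scal e A) (hzero C A A)"
    using scal_hadd[of e w A] by (simp add: ew)
  then have "scal w A = hzero C A A"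
    by (rule hadd_cancel) simp_all
  ultimately show "\<exists>w\<in>S. scal w A = hzero C A A"
    by blast
next
  assume "\<exists>w\<in>S. scal w A = hzero C A A"
  then obtain w where w: "w \<in> S" "scal w A = hzero C A A"
    by blast
  obtain i j where ij [simp]: "i \<in> Ar C" "j \<in> Ar C" "Cod C j = Dom C i" "Cod C i = I" "Dom C j = I"
    and ij': "Dom C i \<in> J" "hadd C (i \<cdot> j) w = idt C I"
    using S_elim[OF w(1)] by blast
  have "idt C A = scal (i \<cdot> j) A"
    using scal_hadd[of "i \<cdot> j" w A] w by (simp add: ij'(2))
  also have "\<dots> = (lun C A \<cdot> (i \<otimes>\<^sub>a idt C A)) \<cdot> ((j \<otimes>\<^sub>a idt C A) \<cdot> ilun A)"
    by (rule scal_cmp) simp_all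
  finally have "is_mono C ((j \<otimes>\<^sub>a idt C A) \<cdot> ilun A)"
    by (intro split_mono[where g = "lun C A \<cdot> (i \<otimes>\<^sub>a idt C A)"]) simp_all
  then show "A \<in> J"
    using J_sub J_tensor(2)[OF assms ij'(1)] by force
qed

text \<open>The scalars annihilated by a member of \<open>S\<close> form an ideal, because
  \<open>S\<close> is closed under products. It contains each \<open>e(A)\<close>: a
  \<open>w\<close> that kills \<open>A\<close> kills \<open>D \<otimes> A\<close> and with it the
  image of \<open>e(A)\<close>. Conversely \<open>w z = 0\<close> gives
  \<open>z = (1 - w) z\<close>.\<close>

lemma S_killed_ideal:
  assumes "z \<in> Ar C" "Dom C z = I" "Cod C z = I"
  shows "z \<in> I_ideal C J \<longleftrightarrow> (\<exists>w\<in>S. w \<cdot> z = hzero C I I)"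
proof
  interpret cring "Z_ring C"
    by (rule Z_ring_cring)
  define T where "T = {z. z \<in> Ar C \<and> Dom C z = I \<and> Cod C z = I \<and> (\<exists>w\<in>S. w \<cdot> z = hzero C I I)}"
  assume "z \<in> I_ideal C J"
  moreover have "ideal T (Z_ring C)"
  proof (rule idealI)
    show "subgroup T (add_monoid (Z_ring C))"
    proof (rule add.subgroupI)
      show "T \<noteq> {}"
        using S_idt by (auto simp: T_def intro!: exI[of _ "hzero C I I"] bexI[of _ "idt C I"])
      show "\<ominus>\<^bsub>Z_ring C\<^esub> z \<in> T" if zT: "z \<in> T" for z
      proof -
        obtain w where w: "w \<in> S" "w \<cdot> z = hzero C I I"
          using zT by (auto simp: T_def)
        have "w \<cdot> (\<ominus>\<^bsub>Z_ring C\<^esub> z) = \<ominus>\<^bsub>Z_ring C\<^esub> (w \<cdot> z)"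
          using r_minus[of w z] w zT by (simp add: T_def)
        then have "w \<cdot> (\<ominus>\<^bsub>Z_ring C\<^esub> z) = hzero C I I"
          using minus_zero w by simp
        then show ?thesis
          using a_inv_closed[of z] w zT by (auto simp: T_def)
      qed
      show "x \<oplus>\<^bsub>Z_ring C\<^esub> y \<in> T" if xy: "x \<in> T" "y \<in> T" for x y
      proof -
        have [simp]: "x \<in> Ar C" "Dom C x = I" "Cod C x = I" "y \<in> Ar C" "Dom C y = I" "Cod C y = I"
          using xy by (auto simp: T_def)
        obtain w w' where w [simp]: "w \<in> S" "w' \<in> S" and wx: "w \<cdot> x = hzero C I I" "w' \<cdot> y = hzero C I I"
          using xy by (auto simp: T_def)
        have "(w \<cdot> w') \<cdot> x = hzero C I I"
          unfolding unit_commute[OF S_simps[OF w(1)] S_simps[OF w(2)]] by (simp add: wx)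
        moreover have "(w \<cdot> w') \<cdot> y = hzero C I I"
          by (simp add: wx)
        ultimately have "(w \<cdot> w') \<cdot> hadd C x y = hzero C I I"
          by (subst cmp_hadd_simp) simp_all
        then show ?thesis
          using S_mult[OF w] by (auto simp: T_def intro!: bexI[of _ "w \<cdot> w'"])
      qed
    qed (auto simp: T_def)
    fix a x
    assume a: "a \<in> T" and x: "x \<in> carrier (Z_ring C)"
    obtain w where w: "w \<in> S" "w \<cdot> a = hzero C I I"
      using a by (auto simp: T_def)
    have "w \<cdot> (a \<cdot> x) = hzero C I I"
      using cmp_reassoc1[OF w(2), of x] a x w(1) by (auto simp: T_def)
    then show "a \<otimes>\<^bsub>Z_ring C\<^esub> x \<in> T"
      using a x w by (auto simp: T_def)
    then show "x \<otimes>\<^bsub>Z_ring C\<^esub> a \<in> T"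
      using m_comm[of a x] a x by (auto simp: T_def)
  qed (rule ring_axioms)
  moreover have "e_obj C A \<in> T" if A: "A \<in> J" for A
  proof -
    obtain w where w: "w \<in> S" "scal w A = hzero C A A"
      using S_kills_iff[of A] A by auto
    obtain i j where ij [simp]: "i \<in> Ar C" "j \<in> Ar C" "Cod C i = I" "Dom C j = I" "Cod C j = Dom C i"
      "j \<cdot> i = idt C (Dom C i)" and e: "e_obj C A = i \<cdot> j" and mono: "is_mono C (coev C A \<cdot> i)"
      using e_obj_factor[of A] A by auto
    obtain D \<epsilon> where dual: "is_dual C A D (coev C A) \<epsilon>"
      using coev_dual[of A] A by auto
    note D = dualD[OF dual]
    have "(coev C A \<cdot> i) \<cdot> scal w (Dom C i) = scal w (D \<otimes>\<^sub>o A) \<cdot> (coev C A \<cdot> i)"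
      using scal_nat[of w "coev C A \<cdot> i" "D \<otimes>\<^sub>o A"] w(1) D by simp
    also have "\<dots> = hzero C (Dom C i) (D \<otimes>\<^sub>o A)"
      using scal_tensor(2)[of w D A] w D A by simp
    finally have "scal w (Dom C i) = hzero C (Dom C i) (Dom C i)"
      using mono_zeroD[OF mono, of "scal w (Dom C i)"] w(1) D by simp
    then have "w \<cdot> (i \<cdot> j) = hzero C I I"
      using scal_nat_reassoc[of w i I j] w(1) by simp
    then show ?thesis
      using w(1) e by (auto simp: T_def)
  qed
  ultimately have "z \<in> T"
    unfolding I_ideal_def using genideal_minimal[of T "e_obj C ` J"] by blast
  then show "\<exists>w\<in>S. w \<cdot> z = hzero C I I"
    by (simp add: T_def)
next
  assume "\<exists>w\<in>S. w \<cdot> z = hzero C I I"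
  then obtain w where w: "w \<in> S" "w \<cdot> z = hzero C I I"
    by blast
  obtain i j where ij [simp]: "i \<in> Ar C" "j \<in> Ar C" "Cod C j = Dom C i" "Cod C i = I" "Dom C j = I"
    and ij': "i \<cdot> j \<in> I_ideal C J" "hadd C (i \<cdot> j) w = idt C I"
    using S_elim[OF w(1)] by blast
  have "z = hadd C (i \<cdot> j) w \<cdot> z"
    using assms by (simp add: ij')
  also have "\<dots> = (i \<cdot> j) \<cdot> z"
    using assms w by (subst hadd_cmp_simp) simp_all
  finally show "z \<in> I_ideal C J"
    using I_ideal_closed(4)[OF ij'(1) assms] by simp
qed

text \<open>If \<open>w\<close> kills the kernel and the cokernel of \<open>s = m \<cdot> e\<close>,
  its action factors through the mono \<open>m\<close> on the target and through the epi
  \<open>e\<close> on the source, which inverts both up to \<open>w\<close>. Conversely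
  \<open>k \<cdot> w = t \<cdot> s \<cdot> k = 0\<close> shows that \<open>w\<close> kills the
  kernel, and dually for the cokernel.\<close>

lemma weq_iff:
  "s \<in> serre_weq C J \<longleftrightarrow> s \<in> Ar C \<and> (\<exists>w\<in>S. \<exists>t. t \<in> Ar C \<and> Dom C t = Cod C s \<and> Cod C t = Dom C s \<and>
    s \<cdot> t = scal w (Cod C s) \<and> t \<cdot> s = scal w (Dom C s))"
proof
  assume "s \<in> serre_weq C J"
  then obtain k c where s [simp]: "s \<in> Ar C" and k: "is_kernel C s k" and c: "is_cokernel C s c"
    and kc: "Dom C k \<in> J" "Cod C c \<in> J"
    by (auto simp: serre_weq_def)
  note K = kernelD[OF k] and L = cokernelD[OF c]
  have [simp]: "k \<in> Ar C" "Cod C k = Dom C s" "c \<in> Ar C" "Dom C c = Cod C s"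
    using K L by simp_all
  obtain w1 where w1 [simp]: "w1 \<in> S" and w1k: "scal w1 (Dom C k) = hzero C (Dom C k) (Dom C k)"
    using S_kills_iff[of "Dom C k"] kc by auto
  obtain w2 where w2 [simp]: "w2 \<in> S" and w2c: "scal w2 (Cod C c) = hzero C (Cod C c) (Cod C c)"
    using S_kills_iff[of "Cod C c"] kc by auto
  define w where "w = w1 \<cdot> w2"
  have w [simp]: "w \<in> S"
    by (simp add: w_def S_mult)
  have wk: "scal w (Dom C k) = hzero C (Dom C k) (Dom C k)" and wc: "scal w (Cod C c) = hzero C (Cod C c) (Cod C c)"
    by (simp_all add: w_def scal_mult w1k w2c)
  obtain m e where me: "is_kernel C c m" "is_cokernel C k e" "Dom C e = Dom C s" "Cod C m = Cod C s"
    "Dom C m = Cod C e" "s = m \<cdot> e"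
    using image_factor[OF k c] by blast
  note M = kernelD[OF me(1)] and E = cokernelD[OF me(2)]
  have [simp]: "m \<in> Ar C" "e \<in> Ar C" "Dom C m = Cod C e" "Dom C e = Dom C s" "Cod C m = Cod C s"
    using M(2) E(2) me(3-5) by simp_all
  have mono: "is_mono C m" and epi: "is_epi C e"
    using kernel_mono[OF me(1)] cokernel_epi[OF me(2)] by auto
  have "c \<cdot> scal w (Cod C s) = hzero C (Cod C s) (Cod C c)"
    using scal_nat[of w c "Cod C c"] by (simp add: wc)
  then obtain r where r [simp]: "r \<in> Ar C" "Dom C r = Cod C s" "Cod C r = Cod C e" and mr: "m \<cdot> r = scal w (Cod C s)"
    using M(5)[of "scal w (Cod C s)"] by auto
  have "scal w (Dom C s) \<cdot> k = hzero C (Dom C k) (Dom C s)"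
    using scal_nat[of w k "Dom C s"] by (simp add: wk)
  then obtain q where q [simp]: "q \<in> Ar C" "Dom C q = Cod C e" "Cod C q = Dom C s" and qe: "q \<cdot> e = scal w (Dom C s)"
    using E(5)[of "scal w (Dom C s)"] by auto
  have "m \<cdot> (r \<cdot> m) = m \<cdot> scal w (Cod C e)"
    using scal_nat[of w m "Cod C s"] by (simp add: cmp_reassoc1[OF mr])
  then have rm: "r \<cdot> m = scal w (Cod C e)"
    by (rule monoD[OF mono, rotated -1]) simp_all
  have "(e \<cdot> q) \<cdot> e = scal w (Cod C e) \<cdot> e"
    using scal_nat[of w e "Cod C e"] by (simp add: qe)
  then have eq: "e \<cdot> q = scal w (Cod C e)"
    by (rule epiD[OF epi, rotated -1]) simp_all
  \<comment> \<open>Inverting \<open>m\<close> and inverting \<open>e\<close> each contribute a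
    factor \<open>w\<close>; idempotence absorbs the square.\<close>
  have ww: "scal w A \<cdot> scal w A = scal w A" if "A \<in> Ob C" for A
    using that scal_mult[of w w A] by (simp add: S_idem)
  have "s \<cdot> (q \<cdot> r) = m \<cdot> ((e \<cdot> q) \<cdot> r)"
    unfolding me(6) by simp
  also have "\<dots> = scal w (Cod C s)"
    using scal_nat_reassoc[of w m "Cod C s" r] by (simp add: eq mr ww)
  finally have 1: "s \<cdot> (q \<cdot> r) = scal w (Cod C s)" .
  have "(q \<cdot> r) \<cdot> s = q \<cdot> ((r \<cdot> m) \<cdot> e)"
    unfolding me(6) by simp
  also have "\<dots> = scal w (Dom C s)"
    unfolding rm by (subst scal_nat) (simp_all add: cmp_reassoc1[OF qe] ww)
  finally show "s \<in> Ar C \<and> (\<exists>w\<in>S. \<exists>t. t \<in> Ar C \<and> Dom C t = Cod C s \<and> Cod C t = Dom C s \<and>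
    s \<cdot> t = scal w (Cod C s) \<and> t \<cdot> s = scal w (Dom C s))"
    using 1 by (intro conjI bexI[of _ w] exI[of _ "q \<cdot> r"]) simp_all
next
  assume "s \<in> Ar C \<and> (\<exists>w\<in>S. \<exists>t. t \<in> Ar C \<and> Dom C t = Cod C s \<and> Cod C t = Dom C s \<and>
    s \<cdot> t = scal w (Cod C s) \<and> t \<cdot> s = scal w (Dom C s))"
  then obtain w t where [simp]: "s \<in> Ar C" "w \<in> S" "t \<in> Ar C" "Dom C t = Cod C s" "Cod C t = Dom C s"
    and st: "s \<cdot> t = scal w (Cod C s)" and ts: "t \<cdot> s = scal w (Dom C s)"
    by blast
  obtain k where k: "is_kernel C s k"
    using ex_kernel[of s] by auto
  obtain c where c: "is_cokernel C s c"
    using ex_cokernel[of s] by auto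
  note K = kernelD[OF k] and L = cokernelD[OF c]
  have [simp]: "k \<in> Ar C" "Cod C k = Dom C s" "c \<in> Ar C" "Dom C c = Cod C s"
    using K L by simp_all
  have "k \<cdot> scal w (Dom C k) = t \<cdot> (s \<cdot> k)"
    using scal_nat[of w k "Dom C s"] by (simp add: cmp_reassoc1[OF ts])
  also have "\<dots> = hzero C (Dom C k) (Dom C s)"
    by (simp add: K(4))
  finally have "scal w (Dom C k) = hzero C (Dom C k) (Dom C k)"
    using mono_zeroD[OF kernel_mono[OF k], of "scal w (Dom C k)"] by simp
  then have 1: "Dom C k \<in> J"
    using S_kills_iff[of "Dom C k"] by auto
  have "scal w (Cod C c) \<cdot> c = c \<cdot> (s \<cdot> t)"
    using scal_nat[of w c "Cod C c"] by (simp add: st)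
  also have "\<dots> = hzero C (Cod C s) (Cod C c)"
    using cmp_reassoc1[OF L(4), of t] by simp
  finally have "scal w (Cod C c) = hzero C (Cod C c) (Cod C c)"
    using epi_zeroD[OF cokernel_epi[OF c], of "scal w (Cod C c)"] by simp
  then have 2: "Cod C c \<in> J"
    using S_kills_iff[of "Cod C c"] by auto
  show "s \<in> serre_weq C J"
    using k c 1 2 by (auto simp: serre_weq_def)
qed

end

section \<open>The Serre quotient by fractions\<close>

context serre_ideal
begin

text \<open>A product of commuting idempotents absorbs each factor. Equations that hold after
  multiplication by different members of \<open>S\<close> thus hold after multiplication by one
  common member.\<close>

lemma S_common:
  assumes "finite X" "X \<subseteq> S"
  shows "\<exists>w\<in>S. \<forall>x\<in>X. w \<cdot> x = w"
  using assms
proof (induction X)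
  case empty
  then show ?case
    using S_idt by auto
next
  case (insert y X)
  then obtain w where w: "w \<in> S" "\<forall>x\<in>X. w \<cdot> x = w" and y: "y \<in> S"
    by auto
  have "(y \<cdot> w) \<cdot> x = y \<cdot> w" if "x \<in> insert y X" for x
  proof (cases "x = y")
    case True
    have "y \<cdot> w = w \<cdot> y"
      by (rule unit_commute) (use w y in simp_all)
    then have "(y \<cdot> w) \<cdot> y = w \<cdot> (y \<cdot> y)"
      using w y by simp
    then show ?thesis
      using True \<open>y \<cdot> w = w \<cdot> y\<close> S_idem[OF y] by simp
  next
    case False
    then have "x \<in> X" "x \<in> S"
      using that insert.prems by auto
    then show ?thesis
      using w y by simp
  qed
  then show ?case
    using S_mult[OF y w(1)] by blast
qed

lemma scal_absorb:
  assumes "W \<cdot> w = W" "w \<in> S" "W \<in> S" "A \<in> Ob C"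
  shows "scal W A \<cdot> scal w A = scal W A" "scal w A \<cdot> scal W A = scal W A"
proof -
  show "scal W A \<cdot> scal w A = scal W A"
    using scal_mult[of W w A] assms by simp
  then show "scal w A \<cdot> scal W A = scal W A"
    using scal_nat[of w "scal W A" A] assms by simp
qed

lemma scal_absorb_eq:
  assumes "W \<cdot> w = W" "w \<in> S" "W \<in> S" "scal w B \<cdot> f = scal w B \<cdot> g"
    "f \<in> Ar C" "g \<in> Ar C" "Cod C f = B" "Cod C g = B"
  shows "scal W B \<cdot> f = scal W B \<cdot> g"
proof -
  have B: "B \<in> Ob C"
    using assms by auto
  have "scal W B \<cdot> h = scal W B \<cdot> (scal w B \<cdot> h)" if "h \<in> Ar C" "Cod C h = B" for h
    using cmp_reassoc1[OF scal_absorb(1)[OF assms(1-3) B], of h] that assms(2,3) B by simp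
  then show ?thesis
    using assms(4-8) by metis
qed

text \<open>Equality of arrows after localisation, expressed in \<open>C\<close>.\<close>

definition eqv :: "'m \<Rightarrow> 'm \<Rightarrow> bool" (infix \<open>\<doteq>\<close> 50) where
  "f \<doteq> g \<longleftrightarrow> f \<in> Ar C \<and> g \<in> Ar C \<and> Dom C g = Dom C f \<and> Cod C g = Cod C f \<and>
    (\<exists>w\<in>S. scal w (Cod C f) \<cdot> f = scal w (Cod C f) \<cdot> g)"

lemma eqvI:
  assumes "f \<in> Ar C" "g \<in> Ar C" "Dom C g = Dom C f" "Cod C g = Cod C f" "w \<in> S"
    "scal w (Cod C f) \<cdot> f = scal w (Cod C f) \<cdot> g"
  shows "f \<doteq> g"
  using assms unfolding eqv_def by auto

lemma eqvD:
  assumes "f \<doteq> g"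
  shows "f \<in> Ar C" "g \<in> Ar C" "Dom C g = Dom C f" "Cod C g = Cod C f"
    "\<exists>w\<in>S. scal w (Cod C f) \<cdot> f = scal w (Cod C f) \<cdot> g"
  using assms unfolding eqv_def by auto

lemma eqv_refl [simp]: "f \<in> Ar C \<Longrightarrow> f \<doteq> f"
  using S_idt by (auto simp: eqv_def)

lemma eqv_sym: "f \<doteq> g \<Longrightarrow> g \<doteq> f"
  unfolding eqv_def by metis

lemma eqv_trans [trans]:
  assumes "f \<doteq> g" "g \<doteq> h"
  shows "f \<doteq> h"
proof -
  note * = eqvD(1-4)[OF assms(1)] eqvD(1-4)[OF assms(2)]
  obtain w where w: "w \<in> S" "scal w (Cod C f) \<cdot> f = scal w (Cod C f) \<cdot> g"
    using eqvD(5)[OF assms(1)] by blast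
  obtain w' where w': "w' \<in> S" "scal w' (Cod C f) \<cdot> g = scal w' (Cod C f) \<cdot> h"
    using eqvD(5)[OF assms(2)] * by metis
  obtain W where W: "W \<in> S" "W \<cdot> w = W" "W \<cdot> w' = W"
    using S_common[of "{w, w'}"] w w' by auto
  have "scal W (Cod C f) \<cdot> f = scal W (Cod C f) \<cdot> g"
    by (rule scal_absorb_eq[OF W(2) w(1) W(1) w(2)]) (simp_all add: *)
  also have "\<dots> = scal W (Cod C f) \<cdot> h"
    by (rule scal_absorb_eq[OF W(3) w'(1) W(1) w'(2)]) (simp_all add: *)
  finally show ?thesis
    by (intro eqvI[where w = W]) (simp_all add: * W(1))
qed

lemma eqv_cmp_left:
  assumes "f \<doteq> f'" "g \<in> Ar C" "Dom C g = Cod C f"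
  shows "g \<cdot> f \<doteq> g \<cdot> f'"
proof -
  note * [simp] = eqvD(1-4)[OF assms(1)]
  obtain w where w: "w \<in> S" "scal w (Cod C f) \<cdot> f = scal w (Cod C f) \<cdot> f'"
    using eqvD(5)[OF assms(1)] by blast
  have "scal w (Cod C g) \<cdot> (g \<cdot> f) = scal w (Cod C g) \<cdot> (g \<cdot> f')"
    using assms(2,3) w by (simp add: scal_nat_reassoc)
  then show ?thesis
    by (intro eqvI[where w = w]) (use assms(2,3) w in simp_all)
qed

lemma eqv_cmp_right:
  assumes "g \<doteq> g'" "f \<in> Ar C" "Dom C g = Cod C f"
  shows "g \<cdot> f \<doteq> g' \<cdot> f"
proof -
  note * [simp] = eqvD(1-4)[OF assms(1)]
  obtain w where w: "w \<in> S" "scal w (Cod C g) \<cdot> g = scal w (Cod C g) \<cdot> g'"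
    using eqvD(5)[OF assms(1)] by blast
  have "scal w (Cod C g) \<cdot> (g \<cdot> f) = scal w (Cod C g) \<cdot> (g' \<cdot> f)"
    by (rule cmp_reassoc[OF w(2)]) (use assms(2,3) w in simp_all)
  then show ?thesis
    by (intro eqvI[where w = w]) (use assms(2,3) w in simp_all)
qed

lemma eqv_hadd_right:
  assumes "f \<doteq> f'" "g \<in> Ar C" "Dom C g = Dom C f" "Cod C g = Cod C f"
  shows "hadd C f g \<doteq> hadd C f' g"
proof -
  note * [simp] = eqvD(1-4)[OF assms(1)]
  obtain w where w: "w \<in> S" "scal w (Cod C f) \<cdot> f = scal w (Cod C f) \<cdot> f'"
    using eqvD(5)[OF assms(1)] by blast
  have [simp]: "Cod C f \<in> Ob C" "g \<in> Ar C" "Dom C g = Dom C f" "Cod C g = Cod C f" "w \<in> S"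
    using cod_closed * assms w by blast+
  have "scal w (Cod C f) \<cdot> hadd C f g = hadd C (scal w (Cod C f) \<cdot> f) (scal w (Cod C f) \<cdot> g)"
    by (rule cmp_hadd_simp) simp_all
  also have "\<dots> = scal w (Cod C f) \<cdot> hadd C f' g"
    unfolding w(2) by (rule cmp_hadd_simp[symmetric]) simp_all
  finally show ?thesis
    by (intro eqvI[where w = w]) simp_all
qed

lemma eqv_hadd:
  assumes "f \<doteq> f'" "g \<doteq> g'" "Dom C g = Dom C f" "Cod C g = Cod C f"
  shows "hadd C f g \<doteq> hadd C f' g'"
proof -
  note * [simp] = eqvD(1-4)[OF assms(1)] eqvD(1-4)[OF assms(2)]
  have "hadd C f g \<doteq> hadd C f' g"
    by (rule eqv_hadd_right[OF assms(1)]) (simp_all add: assms)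
  also have "hadd C f' g = hadd C g f'"
    by (rule hadd_comm) (simp_all add: assms)
  also have "hadd C g f' \<doteq> hadd C g' f'"
    by (rule eqv_hadd_right[OF assms(2)]) (simp_all add: assms)
  also have "hadd C g' f' = hadd C f' g'"
    by (rule hadd_comm) (simp_all add: assms)
  finally show ?thesis .
qed

lemma eqv_tar:
  assumes "f \<doteq> f'" "g \<doteq> g'"
  shows "f \<otimes>\<^sub>a g \<doteq> f' \<otimes>\<^sub>a g'"
proof -
  note * [simp] = eqvD(1-4)[OF assms(1)] eqvD(1-4)[OF assms(2)]
  have [simp]: "Cod C f \<in> Ob C" "Cod C g \<in> Ob C"
    using cod_closed * by blast+
  obtain w where w: "w \<in> S" "scal w (Cod C f) \<cdot> f = scal w (Cod C f) \<cdot> f'"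
    using eqvD(5)[OF assms(1)] by blast
  obtain v where v: "v \<in> S" "scal v (Cod C g) \<cdot> g = scal v (Cod C g) \<cdot> g'"
    using eqvD(5)[OF assms(2)] by blast
  have "f \<otimes>\<^sub>a g \<doteq> f' \<otimes>\<^sub>a g"
    by (intro eqvI[where w = w]) (use w in \<open>simp_all add: scal_tensor(1) tar_merge\<close>)
  also have "\<dots> \<doteq> f' \<otimes>\<^sub>a g'"
    by (intro eqvI[where w = v]) (use v in \<open>simp_all add: scal_tensor(2) tar_merge\<close>)
  finally show ?thesis .
qed

text \<open>Members of \<open>S\<close> become identities after localisation; since \<open>w\<close>
  is idempotent, it is its own witness.\<close>

lemma eqv_scal:
  assumes "w \<in> S" "f \<in> Ar C" "Cod C f = B"
  shows "scal w B \<cdot> f \<doteq> f"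
proof -
  have B: "B \<in> Ob C"
    using assms by auto
  have "scal w B \<cdot> scal w B = scal w B"
    using scal_mult[of w w B] assms B S_idem[OF assms(1)] by simp
  then show ?thesis
    by (intro eqvI[where w = w])
      (use assms B in \<open>simp_all add: cmp_reassoc1[OF \<open>scal w B \<cdot> scal w B = scal w B\<close>]\<close>)
qed

section \<open>Closure properties of weak equivalences\<close>

lemma weqE:
  assumes "s \<in> serre_weq C J"
  obtains w t where "s \<in> Ar C" "w \<in> S" "t \<in> Ar C" "Dom C t = Cod C s" "Cod C t = Dom C s"
    "s \<cdot> t = scal w (Cod C s)" "t \<cdot> s = scal w (Dom C s)"
  using assms unfolding weq_iff by blast

lemma weqI:
  assumes "s \<in> Ar C" "w \<in> S" "t \<in> Ar C" "Dom C t = Cod C s" "Cod C t = Dom C s"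
    "s \<cdot> t = scal w (Cod C s)" "t \<cdot> s = scal w (Dom C s)"
  shows "s \<in> serre_weq C J"
  using assms unfolding weq_iff by blast

lemma weq_Ar [simp]: "s \<in> serre_weq C J \<Longrightarrow> s \<in> Ar C"
  by (simp add: weq_iff)

lemma weq_idt [simp]: "A \<in> Ob C \<Longrightarrow> idt C A \<in> serre_weq C J"
  by (rule weqI[OF _ S_idt, of _ "idt C A"]) simp_all

lemma weq_scal: "w \<in> S \<Longrightarrow> A \<in> Ob C \<Longrightarrow> scal w A \<in> serre_weq C J"
  by (rule weqI[of _ w "idt C A"]) simp_all

text \<open>Quasi-inverses compose in reverse order; naturality moves the inner scalar outwards, so
  the product of the two scalars is the witness for the composite.\<close>

lemma weq_cmp:
  assumes "s \<in> serre_weq C J" "u \<in> serre_weq C J" "Dom C s = Cod C u"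
  shows "s \<cdot> u \<in> serre_weq C J"
proof -
  obtain w t where w [simp]: "s \<in> Ar C" "w \<in> S" "t \<in> Ar C" "Dom C t = Cod C s" "Cod C t = Dom C s"
    and st: "s \<cdot> t = scal w (Cod C s)" and ts: "t \<cdot> s = scal w (Dom C s)"
    using assms(1) by (rule weqE)
  obtain v r where v [simp]: "u \<in> Ar C" "v \<in> S" "r \<in> Ar C" "Dom C r = Cod C u" "Cod C r = Dom C u"
    and ur: "u \<cdot> r = scal v (Cod C u)" and ru: "r \<cdot> u = scal v (Dom C u)"
    using assms(2) by (rule weqE)
  note [simp] = assms(3)
  have "(s \<cdot> u) \<cdot> (r \<cdot> t) = s \<cdot> (scal v (Cod C u) \<cdot> t)"
    by (simp add: cmp_reassoc1[OF ur])
  also have "\<dots> = scal w (Cod C s) \<cdot> scal v (Cod C s)"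
    by (subst scal_nat) (simp_all add: cmp_reassoc1[OF st])
  finally have 1: "(s \<cdot> u) \<cdot> (r \<cdot> t) = scal (w \<cdot> v) (Cod C (s \<cdot> u))"
    by (simp add: scal_mult)
  have "(r \<cdot> t) \<cdot> (s \<cdot> u) = r \<cdot> (scal w (Cod C u) \<cdot> u)"
    by (simp add: cmp_reassoc1[OF ts])
  also have "\<dots> = scal v (Dom C u) \<cdot> scal w (Dom C u)"
    by (subst scal_nat) (simp_all add: cmp_reassoc1[OF ru])
  also have "\<dots> = scal w (Dom C u) \<cdot> scal v (Dom C u)"
    by (subst scal_nat) simp_all
  finally have 2: "(r \<cdot> t) \<cdot> (s \<cdot> u) = scal (w \<cdot> v) (Dom C (s \<cdot> u))"
    by (simp add: scal_mult)
  show ?thesis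
    by (rule weqI[OF _ _ _ _ _ 1 2]) (simp_all add: S_mult)
qed

lemma weq_tar:
  assumes "s \<in> serre_weq C J" "u \<in> serre_weq C J"
  shows "s \<otimes>\<^sub>a u \<in> serre_weq C J"
proof -
  obtain w t where w [simp]: "s \<in> Ar C" "w \<in> S" "t \<in> Ar C" "Dom C t = Cod C s" "Cod C t = Dom C s"
    and st: "s \<cdot> t = scal w (Cod C s)" and ts: "t \<cdot> s = scal w (Dom C s)"
    using assms(1) by (rule weqE)
  obtain v r where v [simp]: "u \<in> Ar C" "v \<in> S" "r \<in> Ar C" "Dom C r = Cod C u" "Cod C r = Dom C u"
    and ur: "u \<cdot> r = scal v (Cod C u)" and ru: "r \<cdot> u = scal v (Dom C u)"
    using assms(2) by (rule weqE)
  have *: "scal w A \<otimes>\<^sub>a scal v B = scal (w \<cdot> v) (A \<otimes>\<^sub>o B)" if [simp]: "A \<in> Ob C" "B \<in> Ob C" for A B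
  proof -
    have "scal (w \<cdot> v) (A \<otimes>\<^sub>o B) = (scal w A \<otimes>\<^sub>a idt C B) \<cdot> (idt C A \<otimes>\<^sub>a scal v B)"
      by (simp add: scal_mult flip: scal_tensor)
    then show ?thesis
      by (simp add: tar_merge)
  qed
  show ?thesis
    by (rule weqI[of _ "w \<cdot> v" "t \<otimes>\<^sub>a r"]) (simp_all add: S_mult tar_merge st ts ur ru *)
qed

section \<open>Roofs, their classes and the operations on them\<close>

lemma roofs_iff: "(s, f) \<in> roofs C J A B \<longleftrightarrow>
    s \<in> serre_weq C J \<and> f \<in> Ar C \<and> Cod C s = A \<and> Dom C s = Dom C f \<and> Cod C f = B"
  by (simp add: roofs_def)

text \<open>If \<open>t\<close> inverts \<open>s\<close> up to \<open>w\<close>, then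
  \<open>(f \<cdot> t) \<cdot> s\<close> is \<open>w\<close> acting on \<open>f\<close>, so the
  denominator can be removed. Fullness of the localisation originates here.\<close>

lemma roof_representative:
  assumes "(s, f) \<in> roofs C J A B"
  obtains f0 where "f0 \<in> Ar C" "Dom C f0 = A" "Cod C f0 = B" "f \<doteq> f0 \<cdot> s"
proof -
  have s: "s \<in> serre_weq C J" and f [simp]: "f \<in> Ar C" "Cod C s = A" "Dom C s = Dom C f" "Cod C f = B"
    using assms by (auto simp: roofs_iff)
  obtain w t where w [simp]: "s \<in> Ar C" "w \<in> S" "t \<in> Ar C" "Dom C t = Cod C s" "Cod C t = Dom C s"
    and st: "s \<cdot> t = scal w (Cod C s)" and ts: "t \<cdot> s = scal w (Dom C s)"
    using s by (rule weqE)
  have "(f \<cdot> t) \<cdot> s = scal w B \<cdot> f"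
    by (simp add: ts scal_nat)
  then have "f \<doteq> (f \<cdot> t) \<cdot> s"
    using eqv_sym[OF eqv_scal[of w f B]] by simp
  then show ?thesis
    by (intro that[of "f \<cdot> t"]) simp_all
qed

text \<open>In one direction the common refinement \<open>s \<cdot> u\<close> is a weak equivalence
  and can be cancelled up to a member of \<open>S\<close>. In the other the refining roof starts at
  \<open>A\<close> itself, through the quasi-inverses \<open>t\<close> and \<open>t'\<close>
  multiplied by a sufficiently absorbing \<open>W\<close>.\<close>

lemma roof_equiv_iff:
  assumes r: "(s, f) \<in> roofs C J A B" "(s', f') \<in> roofs C J A B"
    and g [simp]: "g \<in> Ar C" "Dom C g = A" "Cod C g = B" "g' \<in> Ar C" "Dom C g' = A" "Cod C g' = B"
    and fg: "f \<doteq> g \<cdot> s" "f' \<doteq> g' \<cdot> s'"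
  shows "roof_equiv C J (s, f) (s', f') \<longleftrightarrow> g \<doteq> g'"
proof
  have s: "s \<in> serre_weq C J" "s' \<in> serre_weq C J"
    and f [simp]: "f \<in> Ar C" "Cod C s = A" "Dom C s = Dom C f" "Cod C f = B"
    "f' \<in> Ar C" "Cod C s' = A" "Dom C s' = Dom C f'" "Cod C f' = B"
    using r by (auto simp: roofs_iff)
  have [simp]: "s \<in> Ar C" "s' \<in> Ar C"
    using s by simp_all
  have [simp]: "A \<in> Ob C" "B \<in> Ob C"
    using dom_closed[OF g(1)] cod_closed[OF g(1)] by simp_all
  {
    assume "roof_equiv C J (s, f) (s', f')"
    then obtain u v where uv [simp]: "u \<in> Ar C" "v \<in> Ar C" "Dom C u = Dom C v" "Cod C u = Dom C f" "Cod C v = Dom C f'"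
      and su: "s \<cdot> u = s' \<cdot> v" "s \<cdot> u \<in> serre_weq C J" "f \<cdot> u = f' \<cdot> v"
      by (auto simp: roof_equiv_def)
    obtain w t where w [simp]: "w \<in> S" "t \<in> Ar C" "Dom C t = A" "Cod C t = Dom C v"
      and st: "(s \<cdot> u) \<cdot> t = scal w A"
      using weqE[OF su(2)] by (metis cmp_simps(2,3) f(2,3) uv(1,3,4) \<open>s \<in> Ar C\<close>)
    have "g \<cdot> (s \<cdot> u) \<doteq> f \<cdot> u"
      using eqv_sym[OF eqv_cmp_right[OF fg(1), of u]] by simp
    also have "f \<cdot> u \<doteq> g' \<cdot> (s \<cdot> u)"
      unfolding su(1,3) using eqv_cmp_right[OF fg(2), of v] by simp
    finally have "(g \<cdot> (s \<cdot> u)) \<cdot> t \<doteq> (g' \<cdot> (s \<cdot> u)) \<cdot> t"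
      by (rule eqv_cmp_right) simp_all
    then have "g \<cdot> scal w A \<doteq> g' \<cdot> scal w A"
      using st by simp
    then have "scal w B \<cdot> g \<doteq> scal w B \<cdot> g'"
      by (simp add: scal_nat)
    then show "g \<doteq> g'"
      using eqv_trans[OF eqv_sym[OF eqv_scal[of w g B]] eqv_trans[OF _ eqv_scal[of w g' B]]] by simp
  }
  assume gg: "g \<doteq> g'"
  obtain w t where w [simp]: "w \<in> S" "t \<in> Ar C" "Dom C t = Cod C s" "Cod C t = Dom C s"
    and st: "s \<cdot> t = scal w (Cod C s)"
    using s(1) by (rule weqE)
  obtain w' t' where w' [simp]: "w' \<in> S" "t' \<in> Ar C" "Dom C t' = Cod C s'" "Cod C t' = Dom C s'"
    and st': "s' \<cdot> t' = scal w' (Cod C s')"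
    using s(2) by (rule weqE)
  obtain x where x [simp]: "x \<in> S" and xf: "scal x B \<cdot> f = scal x B \<cdot> (g \<cdot> s)"
    using eqvD(5)[OF fg(1)] by auto
  obtain x' where x' [simp]: "x' \<in> S" and xf': "scal x' B \<cdot> f' = scal x' B \<cdot> (g' \<cdot> s')"
    using eqvD(5)[OF fg(2)] by auto
  obtain y where y [simp]: "y \<in> S" and yg: "scal y B \<cdot> g = scal y B \<cdot> g'"
    using eqvD(5)[OF gg] by auto
  \<comment> \<open>\<open>W\<close> absorbs five scalars at once: the two from inverting
    \<open>s\<close> and \<open>s'\<close>, and the witnesses of the three congruences.\<close>
  obtain W where W [simp]: "W \<in> S" and Ws: "W \<cdot> w = W" "W \<cdot> w' = W" "W \<cdot> x = W" "W \<cdot> x' = W" "W \<cdot> y = W"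
    using S_common[of "{w, w', x, x', y}"] by auto
  have Wf: "scal W B \<cdot> f = scal W B \<cdot> (g \<cdot> s)" "scal W B \<cdot> f' = scal W B \<cdot> (g' \<cdot> s')" "scal W B \<cdot> g = scal W B \<cdot> g'"
    by (rule scal_absorb_eq[OF _ _ _ xf] scal_absorb_eq[OF _ _ _ xf'] scal_absorb_eq[OF _ _ _ yg]; simp add: Ws)+
  \<comment> \<open>Stated for a generic roof, since it is applied both to \<open>(s, f)\<close> and
    to \<open>(s', f')\<close>.\<close>
  have aux: "k \<cdot> (r \<cdot> scal W A) = scal W B \<cdot> h"
    if "k \<in> Ar C" "r \<in> Ar C" "q \<in> Ar C" "Dom C k = Dom C q" "Cod C k = B" "Dom C r = A" "Cod C r = Dom C q"
      "Cod C q = A" "h \<in> Ar C" "Dom C h = A" "Cod C h = B"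
      "scal W B \<cdot> k = scal W B \<cdot> (h \<cdot> q)" "q \<cdot> r = scal v A" "W \<cdot> v = W" "v \<in> S" for k r q h v
  proof -
    have "k \<cdot> (r \<cdot> scal W A) = (scal W B \<cdot> k) \<cdot> r"
      using that(1-11) by (simp add: scal_nat scal_nat_reassoc)
    also have "\<dots> = scal W B \<cdot> (h \<cdot> (q \<cdot> r))"
      unfolding that(12) using that(1-11) by simp
    also have "\<dots> = (scal W B \<cdot> scal v B) \<cdot> h"
      unfolding that(13) using that(9-11,15) scal_nat[of v h B] by simp
    also have "\<dots> = scal W B \<cdot> h"
      using scal_absorb(1)[OF that(14,15)] by simp
    finally show ?thesis .
  qed
  have 1: "f \<cdot> (t \<cdot> scal W A) = scal W B \<cdot> g"
    by (rule aux[of f t s g w]) (simp_all add: Wf(1) st Ws)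
  have 2: "f' \<cdot> (t' \<cdot> scal W A) = scal W B \<cdot> g'"
    by (rule aux[of f' t' s' g' w']) (simp_all add: Wf(2) st' Ws)
  have 3: "s \<cdot> (t \<cdot> scal W A) = scal W A" "s' \<cdot> (t' \<cdot> scal W A) = scal W A"
    by (simp_all add: cmp_reassoc1[OF st] cmp_reassoc1[OF st'] scal_absorb(2) Ws)
  show "roof_equiv C J (s, f) (s', f')"
    unfolding roof_equiv_def prod.case
    by (rule exI[of _ "t \<cdot> scal W A"], rule exI[of _ "t' \<cdot> scal W A"]) (simp add: 1 2 3 Wf(3) weq_scal)
qed

text \<open>The roof \<open>(s, f)\<close> represents the localisation of \<open>g\<close> if and only if \<open>f \<doteq> g \<cdot> s\<close>.\<close>

definition cls :: "'m \<Rightarrow> ('m \<times> 'm) set" where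
  "cls g = {(s, f). (s, f) \<in> roofs C J (Dom C g) (Cod C g) \<and> f \<doteq> g \<cdot> s}"

lemma cls_iff: "(s, f) \<in> cls g \<longleftrightarrow> s \<in> serre_weq C J \<and> f \<in> Ar C \<and> Cod C s = Dom C g \<and> Dom C s = Dom C f \<and>
    Cod C f = Cod C g \<and> f \<doteq> g \<cdot> s"
  by (auto simp: cls_def roofs_iff)

lemma self_in_cls: "g \<in> Ar C \<Longrightarrow> (idt C (Dom C g), g) \<in> cls g"
  by (simp add: cls_iff)

text \<open>By \<open>roof_equiv_iff\<close> the equivalence of roofs is pulled back from the
  congruence on arrows of \<open>C\<close>, so a roof class is the whole fibre over \<open>g\<close>
  and remembers no particular roof.\<close>

lemma roof_class_eq_cls:
  assumes r: "(s, f) \<in> roofs C J (Dom C g) (Cod C g)" and g: "g \<in> Ar C" and fg: "f \<doteq> g \<cdot> s"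
  shows "roof_class C J s f = cls g"
proof -
  have f: "Cod C s = Dom C g" "Cod C f = Cod C g"
    using r by (auto simp: roofs_iff)
  have "roof_equiv C J (s, f) (s', f') \<longleftrightarrow> f' \<doteq> g \<cdot> s'"
    if r': "(s', f') \<in> roofs C J (Dom C g) (Cod C g)" for s' f'
  proof
    assume eq: "roof_equiv C J (s, f) (s', f')"
    obtain g' where g': "g' \<in> Ar C" "Dom C g' = Dom C g" "Cod C g' = Cod C g" "f' \<doteq> g' \<cdot> s'"
      using roof_representative[OF r'] by blast
    have "g \<doteq> g'"
      using roof_equiv_iff[OF r r' g refl refl g'(1-3) fg g'(4)] eq by simp
    then have "g \<cdot> s' \<doteq> g' \<cdot> s'"
      by (rule eqv_cmp_right) (use r' in \<open>auto simp: roofs_iff\<close>)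
    then show "f' \<doteq> g \<cdot> s'"
      using g'(4) eqv_sym eqv_trans by blast
  next
    assume "f' \<doteq> g \<cdot> s'"
    then show "roof_equiv C J (s, f) (s', f')"
      using roof_equiv_iff[OF r r' g refl refl g refl refl fg] g by simp
  qed
  then show ?thesis
    by (auto simp: roof_class_def cls_def f)
qed

lemma cls_eq_iff:
  assumes "f \<in> Ar C" "g \<in> Ar C" "Dom C g = Dom C f" "Cod C g = Cod C f"
  shows "cls f = cls g \<longleftrightarrow> f \<doteq> g"
proof
  assume "cls f = cls g"
  then have "(idt C (Dom C f), f) \<in> cls g"
    using self_in_cls[OF assms(1)] by simp
  then show "f \<doteq> g"
    using assms by (simp add: cls_iff)
next
  assume fg: "f \<doteq> g"
  have "h \<doteq> f \<cdot> s \<longleftrightarrow> h \<doteq> g \<cdot> s" if "s \<in> Ar C" "Cod C s = Dom C f" for h s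
    using eqv_cmp_right[OF fg, of s] that eqv_trans eqv_sym by metis
  then show "cls f = cls g"
    using assms by (auto simp: cls_def roofs_iff)
qed

lemma loc_ar_eq: "f \<in> Ar C \<Longrightarrow> loc_ar C J f = (Dom C f, Cod C f, cls f)"
  unfolding loc_ar_def using roof_class_eq_cls[of "idt C (Dom C f)" f f] by (simp add: roofs_iff)

text \<open>The union in \<open>frac_cmp\<close> ranges over all roofs and all completing squares.
  Each contributes the same class, because
  \<open>k v \<doteq> g t v = g h u \<doteq> g f s u\<close>, and identity roofs show that the
  family is nonempty.\<close>

lemma frac_cmp_cls:
  assumes [simp]: "f \<in> Ar C" "g \<in> Ar C" "Dom C g = Cod C f"
  shows "frac_cmp C J (cls g) (cls f) = cls (g \<cdot> f)"
proof -
  have *: "roof_class C J (s \<cdot> u) (k \<cdot> v) = cls (g \<cdot> f)"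
    if "(s, h) \<in> cls f" "(t, k) \<in> cls g" and u: "u \<in> serre_weq C J" and v [simp]: "v \<in> Ar C" "Dom C u = Dom C v"
      "Cod C u = Dom C h" "Cod C v = Dom C t" and eq: "h \<cdot> u = t \<cdot> v" for s h t k u v
  proof (rule roof_class_eq_cls)
    have s: "s \<in> serre_weq C J" and s' [simp]: "h \<in> Ar C" "Cod C s = Dom C f" "Dom C s = Dom C h" "Cod C h = Cod C f"
      and hf: "h \<doteq> f \<cdot> s"
      using that(1) by (auto simp: cls_iff)
    have t: "t \<in> serre_weq C J" and t' [simp]: "k \<in> Ar C" "Cod C t = Cod C f" "Dom C t = Dom C k" "Cod C k = Cod C g"
      and kg: "k \<doteq> g \<cdot> t"
      using that(2) by (auto simp: cls_iff)
    have [simp]: "s \<in> Ar C" "t \<in> Ar C" "u \<in> Ar C"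
      using s t u by simp_all
    show "(s \<cdot> u, k \<cdot> v) \<in> roofs C J (Dom C (g \<cdot> f)) (Cod C (g \<cdot> f))"
      using weq_cmp[OF s u] that(7) by (simp add: roofs_iff)
    have "k \<cdot> v \<doteq> (g \<cdot> t) \<cdot> v"
      using eqv_cmp_right[OF kg, of v] that(7) by simp
    also have "(g \<cdot> t) \<cdot> v = g \<cdot> (h \<cdot> u)"
      using eq that(7) by simp
    also have "\<dots> \<doteq> g \<cdot> ((f \<cdot> s) \<cdot> u)"
      by (intro eqv_cmp_left eqv_cmp_right hf) simp_all
    also have "\<dots> = (g \<cdot> f) \<cdot> (s \<cdot> u)"
      by simp
    finally show "k \<cdot> v \<doteq> (g \<cdot> f) \<cdot> (s \<cdot> u)" .
  qed simp
  have "cls (g \<cdot> f) = roof_class C J (idt C (Dom C f) \<cdot> idt C (Dom C f)) (g \<cdot> f)"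
    by (rule *[symmetric, OF self_in_cls self_in_cls]) simp_all
  then have ex: "\<exists>s h t k u v. cls (g \<cdot> f) = roof_class C J (s \<cdot> u) (k \<cdot> v) \<and> (s, h) \<in> cls f \<and> (t, k) \<in> cls g \<and>
      u \<in> serre_weq C J \<and> v \<in> Ar C \<and> Dom C u = Dom C v \<and> Cod C u = Dom C h \<and> Cod C v = Dom C t \<and> h \<cdot> u = t \<cdot> v"
    by - (rule exI[of _ "idt C (Dom C f)"], rule exI[of _ f], rule exI[of _ "idt C (Cod C f)"], rule exI[of _ g],
      rule exI[of _ "idt C (Dom C f)"], rule exI[of _ f], use self_in_cls[of f] self_in_cls[of g] in simp)
  have "{roof_class C J (s \<cdot> u) (k \<cdot> v) | s h t k u v.
     (s, h) \<in> cls f \<and> (t, k) \<in> cls g \<and> u \<in> serre_weq C J \<and> v \<in> Ar C \<and> Dom C u = Dom C v \<and>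
     Cod C u = Dom C h \<and> Cod C v = Dom C t \<and> h \<cdot> u = t \<cdot> v} = {cls (g \<cdot> f)}" (is "?X = _")
  proof (rule Set.set_eqI)
    fix x
    show "x \<in> ?X \<longleftrightarrow> x \<in> {cls (g \<cdot> f)}"
      using * ex unfolding mem_Collect_eq singleton_iff by metis
  qed
  then show ?thesis
    unfolding frac_cmp_def by simp
qed

text \<open>Over a common denominator \<open>s u = t v\<close> one has
  \<open>h u + k v \<doteq> f s u + g t v = (f + g) s u\<close>, so the union again has a single
  member.\<close>

lemma frac_add_cls:
  assumes [simp]: "f \<in> Ar C" "g \<in> Ar C" "Dom C g = Dom C f" "Cod C g = Cod C f"
  shows "frac_add C J (cls f) (cls g) = cls (hadd C f g)"
proof -
  have *: "roof_class C J (s \<cdot> u) (hadd C (h \<cdot> u) (k \<cdot> v)) = cls (hadd C f g)"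
    if "(s, h) \<in> cls f" "(t, k) \<in> cls g" and v [simp]: "u \<in> Ar C" "v \<in> Ar C" "Dom C u = Dom C v"
      "Cod C u = Dom C s" "Cod C v = Dom C t" and eq: "s \<cdot> u = t \<cdot> v" and su: "s \<cdot> u \<in> serre_weq C J" for s h t k u v
  proof (rule roof_class_eq_cls)
    have s: "s \<in> serre_weq C J" and s' [simp]: "h \<in> Ar C" "Cod C s = Dom C f" "Dom C s = Dom C h" "Cod C h = Cod C f"
      and hf: "h \<doteq> f \<cdot> s"
      using that(1) by (auto simp: cls_iff)
    have t: "t \<in> serre_weq C J" and t' [simp]: "k \<in> Ar C" "Cod C t = Dom C f" "Dom C t = Dom C k" "Cod C k = Cod C f"
      and kg: "k \<doteq> g \<cdot> t"
      using that(2) by (auto simp: cls_iff)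
    have [simp]: "s \<in> Ar C" "t \<in> Ar C"
      using s t by simp_all
    have [simp]: "Cod C u = Dom C h" "Cod C v = Dom C k"
      using that(6,7) by simp_all
    show "(s \<cdot> u, hadd C (h \<cdot> u) (k \<cdot> v)) \<in> roofs C J (Dom C (hadd C f g)) (Cod C (hadd C f g))"
      using su by (simp add: roofs_iff)
    have "h \<cdot> u \<doteq> (f \<cdot> s) \<cdot> u"
      by (rule eqv_cmp_right[OF hf]) simp_all
    moreover have "k \<cdot> v \<doteq> (g \<cdot> t) \<cdot> v"
      by (rule eqv_cmp_right[OF kg]) simp_all
    ultimately have "hadd C (h \<cdot> u) (k \<cdot> v) \<doteq> hadd C ((f \<cdot> s) \<cdot> u) ((g \<cdot> t) \<cdot> v)"
      by (rule eqv_hadd) simp_all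
    also have "hadd C ((f \<cdot> s) \<cdot> u) ((g \<cdot> t) \<cdot> v) = hadd C f g \<cdot> (s \<cdot> u)"
      using eq by (simp add: hadd_cmp_simp)
    finally show "hadd C (h \<cdot> u) (k \<cdot> v) \<doteq> hadd C f g \<cdot> (s \<cdot> u)" .
  qed simp
  have "cls (hadd C f g) = roof_class C J (idt C (Dom C f) \<cdot> idt C (Dom C f))
      (hadd C (f \<cdot> idt C (Dom C f)) (g \<cdot> idt C (Dom C f)))"
    by (rule *[symmetric, where s = "idt C (Dom C f)" and t = "idt C (Dom C f)"])
      (use self_in_cls[of f] self_in_cls[of g] in simp_all)
  then have ex: "\<exists>s h t k u v. cls (hadd C f g) = roof_class C J (s \<cdot> u) (hadd C (h \<cdot> u) (k \<cdot> v)) \<and>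
     (s, h) \<in> cls f \<and> (t, k) \<in> cls g \<and> u \<in> Ar C \<and> v \<in> Ar C \<and> Dom C u = Dom C v \<and>
     Cod C u = Dom C s \<and> Cod C v = Dom C t \<and> s \<cdot> u = t \<cdot> v \<and> s \<cdot> u \<in> serre_weq C J"
    by - (rule exI[of _ "idt C (Dom C f)"], rule exI[of _ f], rule exI[of _ "idt C (Dom C f)"], rule exI[of _ g],
      rule exI[of _ "idt C (Dom C f)"], rule exI[of _ "idt C (Dom C f)"],
      use self_in_cls[of f] self_in_cls[of g] in simp)
  have "{roof_class C J (s \<cdot> u) (hadd C (h \<cdot> u) (k \<cdot> v)) | s h t k u v.
     (s, h) \<in> cls f \<and> (t, k) \<in> cls g \<and> u \<in> Ar C \<and> v \<in> Ar C \<and> Dom C u = Dom C v \<and>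
     Cod C u = Dom C s \<and> Cod C v = Dom C t \<and> s \<cdot> u = t \<cdot> v \<and> s \<cdot> u \<in> serre_weq C J} = {cls (hadd C f g)}" (is "?X = _")
  proof (rule Set.set_eqI)
    fix x
    show "x \<in> ?X \<longleftrightarrow> x \<in> {cls (hadd C f g)}"
      using * ex unfolding mem_Collect_eq singleton_iff by metis
  qed
  then show ?thesis
    unfolding frac_add_def by simp
qed

text \<open>Weak equivalences are closed under tensor products, so no square has to be completed
  here.\<close>

lemma frac_tar_cls:
  assumes [simp]: "f \<in> Ar C" "g \<in> Ar C"
  shows "frac_tar C J (cls f) (cls g) = cls (f \<otimes>\<^sub>a g)"
proof -
  have *: "roof_class C J (s \<otimes>\<^sub>a t) (h \<otimes>\<^sub>a k) = cls (f \<otimes>\<^sub>a g)"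
    if "(s, h) \<in> cls f" "(t, k) \<in> cls g" for s h t k
  proof (rule roof_class_eq_cls)
    have s: "s \<in> serre_weq C J" and s' [simp]: "h \<in> Ar C" "Cod C s = Dom C f" "Dom C s = Dom C h" "Cod C h = Cod C f"
      and hf: "h \<doteq> f \<cdot> s"
      using that(1) by (auto simp: cls_iff)
    have t: "t \<in> serre_weq C J" and t' [simp]: "k \<in> Ar C" "Cod C t = Dom C g" "Dom C t = Dom C k" "Cod C k = Cod C g"
      and kg: "k \<doteq> g \<cdot> t"
      using that(2) by (auto simp: cls_iff)
    have [simp]: "s \<in> Ar C" "t \<in> Ar C"
      using s t by simp_all
    show "(s \<otimes>\<^sub>a t, h \<otimes>\<^sub>a k) \<in> roofs C J (Dom C (f \<otimes>\<^sub>a g)) (Cod C (f \<otimes>\<^sub>a g))"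
      using weq_tar[OF s t] by (simp add: roofs_iff)
    show "h \<otimes>\<^sub>a k \<doteq> (f \<otimes>\<^sub>a g) \<cdot> (s \<otimes>\<^sub>a t)"
      using eqv_tar[OF hf kg] by (simp add: tar_merge)
  qed simp
  have "{roof_class C J (s \<otimes>\<^sub>a t) (h \<otimes>\<^sub>a k) | s h t k. (s, h) \<in> cls f \<and> (t, k) \<in> cls g} = {cls (f \<otimes>\<^sub>a g)}" (is "?X = _")
  proof (rule Set.set_eqI)
    fix x
    show "x \<in> ?X \<longleftrightarrow> x \<in> {cls (f \<otimes>\<^sub>a g)}"
      using * self_in_cls[of f] self_in_cls[of g] assms unfolding mem_Collect_eq singleton_iff by metis
  qed
  then show ?thesis
    unfolding frac_tar_def by simp
qed

end

section \<open>Quotients of tensor categories by congruences\<close>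

text \<open>\<open>D\<close> is only a record at this point: it has the objects of \<open>C\<close>,
  its arrows lift along \<open>P\<close>, and its operations and constraints are computed on lifts.
  The laws of \<open>D\<close> then follow from those of \<open>C\<close>, for roofs and for formal
  tensors alike. \<open>Ar_Ob\<close> is stated because \<open>homs_eq\<close> speaks only of arrows
  between objects of \<open>C\<close>.\<close>

locale tensor_quotient = C: tensor_category C
  for C :: "('o, 'm, 'z) tensor_cat_scheme" and D :: "('o, 'n, 'y) tensor_cat_scheme" and P :: "'m \<Rightarrow> 'n" +
  assumes Ob_eq: "Ob D = Ob C"
    and homs_eq: "A \<in> Ob C \<Longrightarrow> B \<in> Ob C \<Longrightarrow> homs D A B = P ` homs C A B"
    and Ar_Ob: "y \<in> Ar D \<Longrightarrow> Dom D y \<in> Ob C \<and> Cod D y \<in> Ob C"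
    and idt_eq: "A \<in> Ob C \<Longrightarrow> idt D A = P (idt C A)"
    and cmp_eq: "f \<in> Ar C \<Longrightarrow> g \<in> Ar C \<Longrightarrow> Dom C g = Cod C f \<Longrightarrow> P g \<cdot>\<^bsub>D\<^esub> P f = P (g \<cdot>\<^bsub>C\<^esub> f)"
    and hzero_eq: "A \<in> Ob C \<Longrightarrow> B \<in> Ob C \<Longrightarrow> hzero D A B = P (hzero C A B)"
    and hadd_eq: "f \<in> Ar C \<Longrightarrow> g \<in> Ar C \<Longrightarrow> Dom C g = Dom C f \<Longrightarrow> Cod C g = Cod C f \<Longrightarrow>
      hadd D (P f) (P g) = P (hadd C f g)"
    and tob_eq: "tob D = tob C"
    and unt_eq: "unt D = unt C"
    and tar_eq: "f \<in> Ar C \<Longrightarrow> g \<in> Ar C \<Longrightarrow> P f \<otimes>\<^sub>a\<^bsub>D\<^esub> P g = P (f \<otimes>\<^sub>a\<^bsub>C\<^esub> g)"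
    and asc_eq: "A \<in> Ob C \<Longrightarrow> B \<in> Ob C \<Longrightarrow> E \<in> Ob C \<Longrightarrow> asc D A B E = P (asc C A B E)"
    and lun_eq: "A \<in> Ob C \<Longrightarrow> lun D A = P (lun C A)"
    and run_eq: "A \<in> Ob C \<Longrightarrow> run D A = P (run C A)"
    and brd_eq: "A \<in> Ob C \<Longrightarrow> B \<in> Ob C \<Longrightarrow> brd D A B = P (brd C A B)"
begin

lemmas eqs = Ob_eq idt_eq cmp_eq hzero_eq hadd_eq tob_eq unt_eq tar_eq asc_eq lun_eq run_eq brd_eq

lemma P_homs:
  assumes "x \<in> Ar C" "Dom C x = A" "Cod C x = B"
  shows "P x \<in> homs D A B"
proof -
  have "A \<in> Ob C" "B \<in> Ob C"
    using assms by auto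
  then show ?thesis
    unfolding homs_eq[OF \<open>A \<in> Ob C\<close> \<open>B \<in> Ob C\<close>] using assms by auto
qed

lemma P_simps [simp]:
  assumes "x \<in> Ar C"
  shows "P x \<in> Ar D" "Dom D (P x) = Dom C x" "Cod D (P x) = Cod C x"
  using P_homs[OF assms refl refl] by auto

lemma homsE:
  assumes "f \<in> homs D A B"
  obtains g where "g \<in> Ar C" "Dom C g = A" "Cod C g = B" "f = P g" "A \<in> Ob C" "B \<in> Ob C"
proof -
  have AB: "A \<in> Ob C" "B \<in> Ob C"
    using assms Ar_Ob by auto
  then have "f \<in> P ` homs C A B"
    using assms homs_eq by blast
  then show ?thesis
    using that AB by auto
qed

lemma P_isos:
  assumes "f \<in> isos C A B"
  shows "P f \<in> isos D A B"
proof -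
  note f = C.inv_ar_simps[OF assms]
  have ob: "A \<in> Ob C" "B \<in> Ob C"
    using f(1-3) C.dom_closed C.cod_closed by metis+
  have "is_inverse D (P f) (P (inv_ar C f))"
    unfolding is_inverse_def using f ob by (simp add: eqs)
  then show ?thesis
    unfolding isos_def using f by auto
qed

lemma category_D: "category D"
proof
  show "Dom D f \<in> Ob D" "Cod D f \<in> Ob D" if "f \<in> Ar D" for f
    using that Ar_Ob Ob_eq by auto
  show "idt D A \<in> homs D A A" if "A \<in> Ob D" for A
    using that by (simp add: eqs)
  show "g \<cdot>\<^bsub>D\<^esub> f \<in> homs D A E" if "f \<in> homs D A B" "g \<in> homs D B E" for f g A B E
    using that by (elim homsE) (simp add: eqs)
  show "f \<cdot>\<^bsub>D\<^esub> idt D A = f" "idt D B \<cdot>\<^bsub>D\<^esub> f = f" if "f \<in> homs D A B" for f A B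
    using that by (elim homsE, simp add: eqs)+
  show "(h \<cdot>\<^bsub>D\<^esub> g) \<cdot>\<^bsub>D\<^esub> f = h \<cdot>\<^bsub>D\<^esub> (g \<cdot>\<^bsub>D\<^esub> f)"
    if "f \<in> homs D A B" "g \<in> homs D B E" "h \<in> homs D E E'" for f g h A B E E'
    using that by (elim homsE) (simp add: eqs)
qed

lemma P_inv_ar:
  assumes "f \<in> isos C A B"
  shows "inv_ar D (P f) = P (inv_ar C f)"
proof -
  interpret D: category D
    by (rule category_D)
  note f = C.inv_ar_simps[OF assms]
  have ob: "A \<in> Ob C" "B \<in> Ob C"
    using f(1-3) C.dom_closed C.cod_closed by metis+
  show ?thesis
    by (rule D.isosI(2)[of _ A B]) (use f ob in \<open>simp_all add: eqs\<close>)
qed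

lemma P_Z_act:
  assumes "z \<in> Ar C" "Dom C z = unt C" "Cod C z = unt C" "f \<in> Ar C"
  shows "Z_act D (P z) (P f) = P (Z_act C z f)"
  using assms P_inv_ar[OF C.lun_iso[of "Dom C f"]] by (simp add: Z_act_def eqs)

lemma hom_comm_group_D:
  assumes "A \<in> Ob D" "B \<in> Ob D"
  shows "comm_group (hom_group D A B)"
proof -
  have AB [simp]: "A \<in> Ob C" "B \<in> Ob C"
    using assms by (auto simp: eqs)
  have [simp]: "carrier (hom_group D A B) = homs D A B" "mult (hom_group D A B) = hadd D"
    "one (hom_group D A B) = hzero D A B"
    by (auto simp: hom_group_def)
  show ?thesis
  proof (rule comm_groupI; unfold \<open>carrier (hom_group D A B) = homs D A B\<close> \<open>mult (hom_group D A B) = hadd D\<close>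
      \<open>one (hom_group D A B) = hzero D A B\<close>)
    show "hadd D x y \<in> homs D A B" if "x \<in> homs D A B" "y \<in> homs D A B" for x y
      using that by (elim homsE) (simp add: eqs)
    show "hzero D A B \<in> homs D A B"
      by (simp add: eqs)
    show "hadd D (hadd D x y) z = hadd D x (hadd D y z)"
      if "x \<in> homs D A B" "y \<in> homs D A B" "z \<in> homs D A B" for x y z
      using that by (elim homsE) (simp add: eqs C.hadd_assoc)
    show "hadd D x y = hadd D y x" if xy: "x \<in> homs D A B" "y \<in> homs D A B" for x y
    proof -
      obtain a b where "a \<in> Ar C" "b \<in> Ar C" "Dom C a = A" "Dom C b = A" "Cod C a = B" "Cod C b = B" "x = P a" "y = P b"
        using xy by (elim homsE) blast
      then show ?thesis
        using C.hadd_comm[of a b] by (simp add: eqs)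
    qed
    show "hadd D (hzero D A B) x = x" if "x \<in> homs D A B" for x
      using that by (elim homsE) (simp add: eqs)
    show "\<exists>y\<in>homs D A B. hadd D y x = hzero D A B" if x: "x \<in> homs D A B" for x
    proof -
      obtain a where "a \<in> Ar C" "Dom C a = A" "Cod C a = B" "x = P a"
        using x by (elim homsE)
      then show ?thesis
        by (intro bexI[of _ "P (C.hneg a)"]) (simp_all add: eqs)
    qed
  qed
qed

lemma ex_zero_object_D: "\<exists>N. is_zero_object D N"
proof -
  obtain N where N: "is_zero_object C N"
    using C.ex_zero_object by blast
  have "(\<exists>!f. f \<in> homs D N A) \<and> (\<exists>!f. f \<in> homs D A N)" if "A \<in> Ob C" for A
  proof -
    have *: "N \<in> Ob C" "\<exists>!f. f \<in> homs C N A" "\<exists>!f. f \<in> homs C A N"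
      using N that by (auto simp: is_zero_object_def)
    then show ?thesis
      unfolding homs_eq[OF *(1) that] homs_eq[OF that *(1)] by blast
  qed
  then have "is_zero_object D N"
    using N unfolding is_zero_object_def by (simp add: Ob_eq)
  then show ?thesis
    by blast
qed

lemma ex_biproduct_D:
  assumes "A \<in> Ob D" "B \<in> Ob D"
  shows "\<exists>X i j p q. is_biproduct D A B X i j p q"
proof -
  obtain X i j p q where "is_biproduct C A B X i j p q"
    using C.ex_biproduct assms Ob_eq by metis
  note * = C.biproductD[OF this]
  have "is_biproduct D A B X (P i) (P j) (P p) (P q)"
    unfolding is_biproduct_def using * by (simp add: eqs)
  then show ?thesis
    by blast
qed

lemma additive_category_D: "additive_category D"
proof (intro additive_category.intro additive_category_axioms.intro)
  show "g \<cdot>\<^bsub>D\<^esub> hadd D f f' = hadd D (g \<cdot>\<^bsub>D\<^esub> f) (g \<cdot>\<^bsub>D\<^esub> f')"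
    if "f \<in> homs D A B" "f' \<in> homs D A B" "g \<in> homs D B E" for f f' g A B E
    using that by (elim homsE) (simp add: eqs C.cmp_hadd_simp)
  show "hadd D g g' \<cdot>\<^bsub>D\<^esub> f = hadd D (g \<cdot>\<^bsub>D\<^esub> f) (g' \<cdot>\<^bsub>D\<^esub> f)"
    if "f \<in> homs D A B" "g \<in> homs D B E" "g' \<in> homs D B E" for f g g' A B E
    using that by (elim homsE) (simp add: eqs C.hadd_cmp_simp)
qed (fact category_D hom_comm_group_D ex_zero_object_D ex_biproduct_D)+

lemma tensor_category_D: "tensor_category D"
proof (intro tensor_category.intro tensor_category_axioms.intro)
  show "additive_category D"
    by (rule additive_category_D)
  show "f \<otimes>\<^sub>a\<^bsub>D\<^esub> g \<in> homs D (A \<otimes>\<^sub>o\<^bsub>D\<^esub> B) (A' \<otimes>\<^sub>o\<^bsub>D\<^esub> B')"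
    if "f \<in> homs D A A'" "g \<in> homs D B B'" for f g A A' B B'
    using that by (elim homsE) (simp add: eqs)
  show "(f' \<cdot>\<^bsub>D\<^esub> f) \<otimes>\<^sub>a\<^bsub>D\<^esub> (g' \<cdot>\<^bsub>D\<^esub> g) = (f' \<otimes>\<^sub>a\<^bsub>D\<^esub> g') \<cdot>\<^bsub>D\<^esub> (f \<otimes>\<^sub>a\<^bsub>D\<^esub> g)"
    if "f \<in> homs D A A'" "f' \<in> homs D A' A''" "g \<in> homs D B B'" "g' \<in> homs D B' B''"
    for f f' g g' A A' A'' B B' B''
    using that by (elim homsE) (simp add: eqs C.tar_cmp_simp)
  show "hadd D f f' \<otimes>\<^sub>a\<^bsub>D\<^esub> g = hadd D (f \<otimes>\<^sub>a\<^bsub>D\<^esub> g) (f' \<otimes>\<^sub>a\<^bsub>D\<^esub> g)"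
    if "f \<in> homs D A A'" "f' \<in> homs D A A'" "g \<in> homs D B B'" for f f' g A A' B B'
    using that by (elim homsE) (simp add: eqs C.tar_hadd_left[of _ A A' _ _ B B'])
  show "f \<otimes>\<^sub>a\<^bsub>D\<^esub> hadd D g g' = hadd D (f \<otimes>\<^sub>a\<^bsub>D\<^esub> g) (f \<otimes>\<^sub>a\<^bsub>D\<^esub> g')"
    if "f \<in> homs D A A'" "g \<in> homs D B B'" "g' \<in> homs D B B'" for f g g' A A' B B'
    using that by (elim homsE) (simp add: eqs C.tar_hadd_right[of _ A A' _ B B'])
  show "asc D A' B' E' \<cdot>\<^bsub>D\<^esub> ((f \<otimes>\<^sub>a\<^bsub>D\<^esub> g) \<otimes>\<^sub>a\<^bsub>D\<^esub> h) = (f \<otimes>\<^sub>a\<^bsub>D\<^esub> (g \<otimes>\<^sub>a\<^bsub>D\<^esub> h)) \<cdot>\<^bsub>D\<^esub> asc D A B E"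
    if "f \<in> homs D A A'" "g \<in> homs D B B'" "h \<in> homs D E E'" for f g h A A' B B' E E'
    using that by (elim homsE) (simp add: eqs C.asc_nat)
  show "lun D A' \<cdot>\<^bsub>D\<^esub> (idt D (unt D) \<otimes>\<^sub>a\<^bsub>D\<^esub> f) = f \<cdot>\<^bsub>D\<^esub> lun D A"
    "run D A' \<cdot>\<^bsub>D\<^esub> (f \<otimes>\<^sub>a\<^bsub>D\<^esub> idt D (unt D)) = f \<cdot>\<^bsub>D\<^esub> run D A" if "f \<in> homs D A A'" for f A A'
    using that by (elim homsE, simp add: eqs C.lun_nat C.run_nat)+
  show "brd D A' B' \<cdot>\<^bsub>D\<^esub> (f \<otimes>\<^sub>a\<^bsub>D\<^esub> g) = (g \<otimes>\<^sub>a\<^bsub>D\<^esub> f) \<cdot>\<^bsub>D\<^esub> brd D A B"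
    if "f \<in> homs D A A'" "g \<in> homs D B B'" for f g A A' B B'
    using that by (elim homsE) (simp add: eqs C.brd_nat)
  show "asc D A B E \<in> isos D ((A \<otimes>\<^sub>o\<^bsub>D\<^esub> B) \<otimes>\<^sub>o\<^bsub>D\<^esub> E) (A \<otimes>\<^sub>o\<^bsub>D\<^esub> (B \<otimes>\<^sub>o\<^bsub>D\<^esub> E))"
    if "A \<in> Ob D" "B \<in> Ob D" "E \<in> Ob D" for A B E
    using that P_isos[OF C.asc_iso[of A B E]] by (simp add: eqs)
  show "lun D A \<in> isos D (unt D \<otimes>\<^sub>o\<^bsub>D\<^esub> A) A" "run D A \<in> isos D (A \<otimes>\<^sub>o\<^bsub>D\<^esub> unt D) A" if "A \<in> Ob D" for A
    using that P_isos[OF C.lun_iso[of A]] P_isos[OF C.run_iso[of A]] by (simp_all add: eqs)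
  show "brd D A B \<in> isos D (A \<otimes>\<^sub>o\<^bsub>D\<^esub> B) (B \<otimes>\<^sub>o\<^bsub>D\<^esub> A)" if "A \<in> Ob D" "B \<in> Ob D" for A B
    using that P_isos[OF C.brd_iso[of A B]] by (simp add: eqs)
qed (simp_all add: eqs C.pentagon C.triangle C.hexagon)

end

text \<open>Both sides are quotients of \<open>C\<close>, so each axiom is checked on lifts, where
  it becomes a law of \<open>C\<close>; the monoidal constraints are images of identities.\<close>

lemma tensor_quotient_functor:
  assumes q1: "tensor_quotient C D1 P1" and q2: "tensor_quotient C D2 P2"
    and far: "\<And>f. f \<in> Ar C \<Longrightarrow> far F (P1 f) = P2 f"
    and fob: "fob F = (\<lambda>A. A)"
    and fmu: "\<And>A B. A \<in> Ob C \<Longrightarrow> B \<in> Ob C \<Longrightarrow> fmu F A B = P2 (idt C (A \<otimes>\<^sub>o\<^bsub>C\<^esub> B))"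
    and feta: "feta F = P2 (idt C (unt C))"
  shows "tensor_functor D1 D2 F"
proof -
  interpret Q1: tensor_quotient C D1 P1
    by (rule q1)
  interpret Q2: tensor_quotient C D2 P2
    by (rule q2)
  note eqs = Q1.eqs Q2.eqs far fob fmu feta
  show ?thesis
  proof (intro tensor_functor.intro tensor_functor_axioms.intro)
    show "fob F A \<in> Ob D2" "far F (idt D1 A) = idt D2 (fob F A)" if "A \<in> Ob D1" for A
      using that by (simp_all add: eqs)
    show "far F f \<in> homs D2 (fob F A) (fob F B)" if "f \<in> homs D1 A B" for f A B
      using that by (elim Q1.homsE) (simp add: eqs)
    show "far F (g \<cdot>\<^bsub>D1\<^esub> f) = far F g \<cdot>\<^bsub>D2\<^esub> far F f" if "f \<in> homs D1 A B" "g \<in> homs D1 B E" for f g A B E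
      using that by (elim Q1.homsE) (simp add: eqs)
    show "far F (hadd D1 f g) = hadd D2 (far F f) (far F g)" if "f \<in> homs D1 A B" "g \<in> homs D1 A B" for f g A B
      using that by (elim Q1.homsE) (simp add: eqs)
    show "feta F \<in> isos D2 (unt D2) (fob F (unt D1))"
      using Q2.P_isos[OF Q1.C.idt_iso(1)[OF Q1.C.unt_closed]] by (simp add: eqs)
    show "fmu F A B \<in> isos D2 (fob F A \<otimes>\<^sub>o\<^bsub>D2\<^esub> fob F B) (fob F (A \<otimes>\<^sub>o\<^bsub>D1\<^esub> B))" if "A \<in> Ob D1" "B \<in> Ob D1" for A B
      using that Q2.P_isos[OF Q1.C.idt_iso(1)[of "A \<otimes>\<^sub>o\<^bsub>C\<^esub> B"]] by (simp add: eqs)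
    show "fmu F A' B' \<cdot>\<^bsub>D2\<^esub> (far F f \<otimes>\<^sub>a\<^bsub>D2\<^esub> far F g) = far F (f \<otimes>\<^sub>a\<^bsub>D1\<^esub> g) \<cdot>\<^bsub>D2\<^esub> fmu F A B"
      if "f \<in> homs D1 A A'" "g \<in> homs D1 B B'" for f g A A' B B'
      using that by (elim Q1.homsE) (simp add: eqs)
  qed (simp_all add: eqs Q1.tensor_category_D Q2.tensor_category_D)
qed

text \<open>Together, \<open>P\<close> and \<open>far\<close> say that \<open>P1\<close> and
  \<open>P2\<close> identify the same parallel arrows, so an inverse can be defined through
  arbitrary lifts. Both natural isomorphisms consist of identities.\<close>

lemma tensor_quotient_equivalence:
  assumes q1: "tensor_quotient C D1 P1" and q2: "tensor_quotient C D2 P2"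
    and P: "\<And>f g. f \<in> Ar C \<Longrightarrow> g \<in> Ar C \<Longrightarrow> Dom C f = Dom C g \<Longrightarrow> Cod C f = Cod C g \<Longrightarrow> P2 f = P2 g \<Longrightarrow> P1 f = P1 g"
    and far: "\<And>f. f \<in> Ar C \<Longrightarrow> far F (P1 f) = P2 f"
    and fob: "fob F = (\<lambda>A. A)"
    and fmu: "\<And>A B. A \<in> Ob C \<Longrightarrow> B \<in> Ob C \<Longrightarrow> fmu F A B = P2 (idt C (A \<otimes>\<^sub>o\<^bsub>C\<^esub> B))"
    and feta: "feta F = P2 (idt C (unt C))"
  shows "tensor_equivalence D1 D2 F"
proof -
  interpret Q1: tensor_quotient C D1 P1
    by (rule q1)
  interpret Q2: tensor_quotient C D2 P2
    by (rule q2)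
  define G where "G = \<lparr>fob = (\<lambda>A. A), far = (\<lambda>y. P1 (SOME f. f \<in> Ar C \<and> P2 f = y)),
    fmu = (\<lambda>A B. P1 (idt C (A \<otimes>\<^sub>o\<^bsub>C\<^esub> B))), feta = P1 (idt C (unt C))\<rparr>"
  have G: "fob G = (\<lambda>A. A)" "fmu G = (\<lambda>A B. P1 (idt C (A \<otimes>\<^sub>o\<^bsub>C\<^esub> B)))" "feta G = P1 (idt C (unt C))"
    by (simp_all add: G_def)
  \<comment> \<open>Two lifts of one arrow are parallel because \<open>P2\<close> preserves
    endpoints; hence \<open>P\<close> applies to them.\<close>
  have far_G: "far G (P2 f) = P1 f" if f: "f \<in> Ar C" for f
  proof -
    define g where "g = (SOME g. g \<in> Ar C \<and> P2 g = P2 f)"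
    have "g \<in> Ar C \<and> P2 g = P2 f"
      unfolding g_def by (rule someI[of _ f]) (simp add: f)
    moreover from this have "Dom C g = Dom C f" "Cod C g = Cod C f"
      using Q2.P_simps(2,3)[of g] Q2.P_simps(2,3)[of f] f by auto
    ultimately have "P1 g = P1 f"
      using P f by blast
    then show ?thesis
      by (simp add: G_def g_def)
  qed
  have F: "tensor_functor D1 D2 F"
    by (rule tensor_quotient_functor[OF q1 q2 far fob fmu feta])
  have G': "tensor_functor D2 D1 G"
    by (rule tensor_quotient_functor[OF q2 q1 far_G]) (simp_all add: G)
  note eqs = Q1.eqs Q2.eqs far fob fmu feta far_G G
  have "tensor_nat_iso D1 D1 (tfunctor_comp D1 G F) (tfunctor_id D1) (\<lambda>A. P1 (idt C A))"
    unfolding tensor_nat_iso_def tfunctor_comp_def tfunctor_id_def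
    by (auto simp: eqs Q1.P_isos Q1.C.idt_iso simp del: homs_iff elim!: Q1.homsE)
  moreover have "tensor_nat_iso D2 D2 (tfunctor_comp D2 F G) (tfunctor_id D2) (\<lambda>A. P2 (idt C A))"
    unfolding tensor_nat_iso_def tfunctor_comp_def tfunctor_id_def
    by (auto simp: eqs Q2.P_isos Q1.C.idt_iso simp del: homs_iff elim!: Q2.homsE)
  ultimately show ?thesis
    using F G' unfolding tensor_equivalence_def by blast
qed

section \<open>The Serre quotient as a quotient by a congruence\<close>

context serre_ideal
begin

abbreviation "Q \<equiv> serre_quotient C J"
abbreviation "loc \<equiv> loc_ar C J"

lemma Q_simps [simp]:
  "Ob Q = Ob C" "Dom Q (A, B, X) = A" "Cod Q (A, B, X) = B"
  "idt Q A = loc (idt C A)" "hzero Q A B = loc (hzero C A B)" "tob Q = tob C" "unt Q = unt C"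
  "asc Q A B E = loc (asc C A B E)" "lun Q A = loc (lun C A)" "run Q A = loc (run C A)"
  "brd Q A B = loc (brd C A B)"
  by (simp_all add: serre_quotient_def)

lemma homs_Q:
  assumes "A \<in> Ob C" "B \<in> Ob C"
  shows "homs Q A B = loc ` homs C A B"
proof
  show "homs Q A B \<subseteq> loc ` homs C A B"
  proof
    fix x
    assume "x \<in> homs Q A B"
    then obtain s f where sf: "(s, f) \<in> roofs C J A B" and x: "x = (A, B, roof_class C J s f)"
      by (auto simp: serre_quotient_def)
    obtain f0 where f0: "f0 \<in> Ar C" "Dom C f0 = A" "Cod C f0 = B" "f \<doteq> f0 \<cdot> s"
      using roof_representative[OF sf] by blast
    then have "x = loc f0"
      using roof_class_eq_cls[of s f f0] sf x by (simp add: loc_ar_eq)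
    then show "x \<in> loc ` homs C A B"
      using f0 by auto
  qed
  show "loc ` homs C A B \<subseteq> homs Q A B"
  proof
    fix x
    assume "x \<in> loc ` homs C A B"
    then obtain f where f: "f \<in> Ar C" "Dom C f = A" "Cod C f = B" and x: "x = loc f"
      by auto
    have "(idt C A, f) \<in> roofs C J A B"
      using f assms by (simp add: roofs_iff)
    then show "x \<in> homs Q A B"
      using f assms unfolding x loc_ar_def by (auto simp: serre_quotient_def)
  qed
qed

lemma tensor_quotient_Q: "tensor_quotient C Q loc"
proof (intro tensor_quotient.intro tensor_quotient_axioms.intro)
  show "Dom Q y \<in> Ob C \<and> Cod Q y \<in> Ob C" if "y \<in> Ar Q" for y
    using that by (auto simp: serre_quotient_def)
  show "loc g \<cdot>\<^bsub>Q\<^esub> loc f = loc (g \<cdot> f)" if "f \<in> Ar C" "g \<in> Ar C" "Dom C g = Cod C f" for f g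
    using that by (simp add: loc_ar_eq serre_quotient_def frac_cmp_cls)
  show "hadd Q (loc f) (loc g) = loc (hadd C f g)"
    if "f \<in> Ar C" "g \<in> Ar C" "Dom C g = Dom C f" "Cod C g = Cod C f" for f g
    using that by (simp add: loc_ar_eq serre_quotient_def frac_add_cls)
  show "loc f \<otimes>\<^sub>a\<^bsub>Q\<^esub> loc g = loc (f \<otimes>\<^sub>a g)" if "f \<in> Ar C" "g \<in> Ar C" for f g
    using that by (simp add: loc_ar_eq serre_quotient_def frac_tar_cls)
qed (simp_all add: homs_Q tensor_category_axioms)

sublocale Q: tensor_quotient C Q loc
  by (rule tensor_quotient_Q)

lemma loc_eq_iff:
  assumes "f \<in> Ar C" "g \<in> Ar C" "Dom C g = Dom C f" "Cod C g = Cod C f"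
  shows "loc f = loc g \<longleftrightarrow> f \<doteq> g"
  using assms cls_eq_iff by (simp add: loc_ar_eq)

lemma Z_map_loc:
  assumes "z \<in> Ar C" "Dom C z = I" "Cod C z = I"
  shows "Z_map Q (serre_loc C J) z = loc z"
  using assms Q.P_inv_ar[OF idt_iso(1)[of I]] idt_iso(2)[of I]
  by (simp add: Z_map_def serre_loc_def Q.cmp_eq)

lemma eqv_hzero_iff:
  assumes "z \<in> Ar C" "Dom C z = I" "Cod C z = I"
  shows "z \<doteq> hzero C I I \<longleftrightarrow> z \<in> I_ideal C J"
proof -
  have "z \<doteq> hzero C I I \<longleftrightarrow> (\<exists>w\<in>S. w \<cdot> z = hzero C I I)"
    using assms by (auto simp: eqv_def)
  then show ?thesis
    using S_killed_ideal[OF assms] by simp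
qed

text \<open>A scalar \<open>z\<close> vanishes in the quotient when \<open>w \<cdot> z = 0\<close>
  for some \<open>w\<close> in \<open>S\<close>, and \<open>S_killed_ideal\<close> identifies these
  scalars with the ideal.\<close>

lemma Z_map_kernel: "a_kernel (Z_ring C) (Z_ring Q) (Z_map Q (serre_loc C J)) = I_ideal C J"
proof -
  have "z \<in> a_kernel (Z_ring C) (Z_ring Q) (Z_map Q (serre_loc C J)) \<longleftrightarrow> z \<in> I_ideal C J" for z
  proof (cases "z \<in> homs C I I")
    case True
    then have z: "z \<in> Ar C" "Dom C z = I" "Cod C z = I"
      by auto
    have "z \<in> a_kernel (Z_ring C) (Z_ring Q) (Z_map Q (serre_loc C J)) \<longleftrightarrow> loc z = loc (hzero C I I)"
      using z by (simp add: a_kernel_def kernel_def Z_map_loc) (simp add: Z_ring_def)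
    then show ?thesis
      using loc_eq_iff[of z "hzero C I I"] eqv_hzero_iff[OF z] z by simp
  next
    case False
    then show ?thesis
      by (auto simp: a_kernel_def kernel_def)
  qed
  then show ?thesis
    by blast
qed

lemma serre_loc_full: "full_functor C Q (serre_loc C J)"
  unfolding full_functor_def by (simp add: serre_loc_def homs_Q del: homs_iff)

end

section \<open>Base change along the quotient of the scalars\<close>

text \<open>Serves both levels of the nested \<open>frag_extend\<close> in
  \<open>frag_bilinear\<close>.\<close>

lemma hom_free_Abelian_group_frag_extend:
  assumes h: "h \<in> hom (free_Abelian_group U) K" and g: "\<And>q. q \<in> T \<Longrightarrow> Poly_Mapping.keys (g q) \<subseteq> U"
  shows "(\<lambda>y. h (frag_extend g y)) \<in> hom (free_Abelian_group T) K"
    and "Poly_Mapping.keys y \<subseteq> T \<Longrightarrow> Poly_Mapping.keys (frag_extend g y) \<subseteq> U"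
proof -
  show *: "Poly_Mapping.keys (frag_extend g y) \<subseteq> U" if "Poly_Mapping.keys y \<subseteq> T" for y
    using keys_frag_extend[of g y] g that by blast
  show "(\<lambda>y. h (frag_extend g y)) \<in> hom (free_Abelian_group T) K"
  proof (rule homI)
    fix x y
    assume xy: "x \<in> carrier (free_Abelian_group T)" "y \<in> carrier (free_Abelian_group T)"
    then show "h (frag_extend g x) \<in> carrier K"
      using hom_in_carrier[OF h, of "frag_extend g x"] * by simp
    show "h (frag_extend g (x \<otimes>\<^bsub>free_Abelian_group T\<^esub> y)) = h (frag_extend g x) \<otimes>\<^bsub>K\<^esub> h (frag_extend g y)"
      using hom_mult[OF h, of "frag_extend g x" "frag_extend g y"] * xy by (simp add: frag_extend_add)
  qed
qed

lemma hom_free_Abelian_group_diff: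
  assumes K: "group K" and h: "h \<in> hom (free_Abelian_group S) K"
    and x: "Poly_Mapping.keys x \<subseteq> S" and y: "Poly_Mapping.keys y \<subseteq> S"
  shows "h (x - y) = \<one>\<^bsub>K\<^esub> \<longleftrightarrow> h x = h y" "h (x - y) \<otimes>\<^bsub>K\<^esub> h y = h x" "h (x - y) \<in> carrier K"
proof -
  interpret K: group K
    by (rule K)
  have xy: "Poly_Mapping.keys (x - y) \<subseteq> S"
    using keys_diff[of x y] x y by blast
  have c: "h z \<in> carrier K" if "Poly_Mapping.keys z \<subseteq> S" for z
    using hom_in_carrier[OF h, of z] that by simp
  show *: "h (x - y) \<otimes>\<^bsub>K\<^esub> h y = h x"
    using hom_mult[OF h, of "x - y" y] xy y by simp
  show "h (x - y) \<in> carrier K"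
    by (rule c[OF xy])
  show "h (x - y) = \<one>\<^bsub>K\<^esub> \<longleftrightarrow> h x = h y"
    using * K.r_cancel_one[OF c[OF y] c[OF xy]] by auto
qed

lemma hom_free_Abelian_group_eq:
  assumes K: "group K" and h: "h \<in> hom (free_Abelian_group S) K" and h': "h' \<in> hom (free_Abelian_group S) K"
    and eq: "\<And>p. p \<in> S \<Longrightarrow> h (frag_of p) = h' (frag_of p)" and x: "Poly_Mapping.keys x \<subseteq> S"
  shows "h x = h' x"
proof -
  interpret K: group K
    by (rule K)
  show ?thesis
    using x
  proof (rule free_Abelian_group_induct)
    show "h 0 = h' 0"
      using hom_one[OF h group_free_Abelian_group K] hom_one[OF h' group_free_Abelian_group K] by simp
    show "h (x - y) = h' (x - y)"
      if "Poly_Mapping.keys x \<subseteq> S" "Poly_Mapping.keys y \<subseteq> S" "h x = h' x" "h y = h' y" for x y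
    proof -
      note * = hom_free_Abelian_group_diff(2,3)[OF K h that(1,2)] hom_free_Abelian_group_diff(2,3)[OF K h' that(1,2)]
      have "h' y \<in> carrier K"
        using hom_in_carrier[OF h', of y] that by simp
      then show ?thesis
        using * that(3,4) K.right_cancel[of "h' y" "h (x - y)" "h' (x - y)"] by simp
    qed
  qed (rule eq)
qed

text \<open>Since \<open>b\<close> is biadditive, the equation needs checking on generators only: in
  \<open>y\<close> for a fixed generator \<open>p\<close>, and after that in \<open>x\<close> for a
  fixed \<open>y\<close>.\<close>

lemma hom_frag_bilinear:
  assumes K: "group K" and \<psi>: "\<psi> \<in> hom (free_Abelian_group U) K"
    and \<alpha>: "\<alpha> \<in> hom (free_Abelian_group S) K1" and \<beta>: "\<beta> \<in> hom (free_Abelian_group T) K2"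
    and b1: "\<And>a. a \<in> carrier K1 \<Longrightarrow> b a \<in> hom K2 K"
    and b2: "\<And>c. c \<in> carrier K2 \<Longrightarrow> (\<lambda>a. b a c) \<in> hom K1 K"
    and gen: "\<And>p q. p \<in> S \<Longrightarrow> q \<in> T \<Longrightarrow> \<mu> p q \<in> U"
      "\<And>p q. p \<in> S \<Longrightarrow> q \<in> T \<Longrightarrow> \<psi> (frag_of (\<mu> p q)) = b (\<alpha> (frag_of p)) (\<beta> (frag_of q))"
    and x: "Poly_Mapping.keys x \<subseteq> S" and y: "Poly_Mapping.keys y \<subseteq> T"
  shows "Poly_Mapping.keys (frag_bilinear \<mu> x y) \<subseteq> U" "\<psi> (frag_bilinear \<mu> x y) = b (\<alpha> x) (\<beta> y)"
proof -
  have ca: "\<alpha> u \<in> carrier K1" if "Poly_Mapping.keys u \<subseteq> S" for u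
    using hom_in_carrier[OF \<alpha>, of u] that by simp
  have cb: "\<beta> v \<in> carrier K2" if "Poly_Mapping.keys v \<subseteq> T" for v
    using hom_in_carrier[OF \<beta>, of v] that by simp
  have k: "Poly_Mapping.keys (frag_extend (\<lambda>q. frag_of (\<mu> p q)) y) \<subseteq> U" if "p \<in> S" for p
    by (rule hom_free_Abelian_group_frag_extend(2)[OF \<psi> _ y]) (use gen(1)[OF that] in simp)
  show "Poly_Mapping.keys (frag_bilinear \<mu> x y) \<subseteq> U"
    unfolding frag_bilinear_def by (rule hom_free_Abelian_group_frag_extend(2)[OF \<psi> k x])
  have 1: "\<psi> (frag_extend (\<lambda>q. frag_of (\<mu> p q)) y) = b (\<alpha> (frag_of p)) (\<beta> y)" if p: "p \<in> S" for p
  proof (rule hom_free_Abelian_group_eq[OF K _ _ _ y])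
    show "(\<lambda>y. \<psi> (frag_extend (\<lambda>q. frag_of (\<mu> p q)) y)) \<in> hom (free_Abelian_group T) K"
      by (rule hom_free_Abelian_group_frag_extend(1)[OF \<psi>]) (use gen(1)[OF p] in simp)
    have "b (\<alpha> (frag_of p)) \<in> hom K2 K"
      by (rule b1[OF ca]) (use p in simp)
    from hom_compose[OF \<beta> this] show "(\<lambda>y. b (\<alpha> (frag_of p)) (\<beta> y)) \<in> hom (free_Abelian_group T) K"
      by (simp add: comp_def)
  qed (use gen(2)[OF p] in simp)
  show "\<psi> (frag_bilinear \<mu> x y) = b (\<alpha> x) (\<beta> y)"
    unfolding frag_bilinear_def
  proof (rule hom_free_Abelian_group_eq[OF K _ _ _ x])
    show "(\<lambda>x. \<psi> (frag_extend (\<lambda>p. frag_extend (\<lambda>q. frag_of (\<mu> p q)) y) x)) \<in> hom (free_Abelian_group S) K"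
      by (rule hom_free_Abelian_group_frag_extend(1)[OF \<psi> k])
    from hom_compose[OF \<alpha> b2[OF cb[OF y]]] show "(\<lambda>x. b (\<alpha> x) (\<beta> y)) \<in> hom (free_Abelian_group S) K"
      by (simp add: comp_def)
  qed (simp add: 1)
qed

text \<open>Keys may cancel in a sum, so all products are compared over the union of the keys of
  both summands, where the additional factors are zeroth powers.\<close>

lemma (in comm_group) frag_finprod_hom:
  assumes g: "\<And>p. p \<in> S \<Longrightarrow> g p \<in> carrier G"
  shows "(\<lambda>x. finprod G (\<lambda>p. g p [^] Poly_Mapping.lookup x p) (Poly_Mapping.keys x)) \<in> hom (free_Abelian_group S) G"
    (is "?h \<in> _")
    and "p \<in> S \<Longrightarrow> finprod G (\<lambda>q. g q [^] Poly_Mapping.lookup (frag_of p) q) (Poly_Mapping.keys (frag_of p)) = g p"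
proof -
  have ext: "?h x = finprod G (\<lambda>p. g p [^] Poly_Mapping.lookup x p) X"
    if "Poly_Mapping.keys x \<subseteq> X" "finite X" "X \<subseteq> S" for x X
    by (rule finprod_mono_neutral_cong_left) (use that g in \<open>auto simp: in_keys_iff\<close>)
  show "?h \<in> hom (free_Abelian_group S) G"
  proof (rule homI)
    fix x y
    assume "x \<in> carrier (free_Abelian_group S)" "y \<in> carrier (free_Abelian_group S)"
    then have xy: "Poly_Mapping.keys x \<subseteq> S" "Poly_Mapping.keys y \<subseteq> S"
      by auto
    show "?h x \<in> carrier G"
      by (rule finprod_closed) (use xy g in auto)
    let ?X = "Poly_Mapping.keys x \<union> Poly_Mapping.keys y"
    have gX: "g p \<in> carrier G" if "p \<in> ?X" for p
      using that xy g by blast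
    have "?h (x + y) = finprod G (\<lambda>p. g p [^] Poly_Mapping.lookup (x + y) p) ?X"
      by (rule ext) (use keys_add[of x y] xy in auto)
    also have "\<dots> = finprod G (\<lambda>p. g p [^] Poly_Mapping.lookup x p \<otimes> g p [^] Poly_Mapping.lookup y p) ?X"
      by (rule finprod_cong') (use gX in \<open>auto simp: Poly_Mapping.lookup_add int_pow_mult\<close>)
    also have "\<dots> = ?h x \<otimes> ?h y"
      using ext[of x ?X] ext[of y ?X] xy gX by (subst finprod_multf) auto
    finally show "?h (x \<otimes>\<^bsub>free_Abelian_group S\<^esub> y) = ?h x \<otimes> ?h y"
      by simp
  qed
  show "finprod G (\<lambda>q. g q [^] Poly_Mapping.lookup (frag_of p) q) (Poly_Mapping.keys (frag_of p)) = g p" if "p \<in> S"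
    using g[OF that] finprod_insert[of "{}" p "\<lambda>q. g q [^] Poly_Mapping.lookup (frag_of p) q"] int_pow_1[of "g p"] by simp
qed

section \<open>Scalars modulo the ideal, and evaluation of formal tensors in the quotient\<close>

context serre_ideal
begin

abbreviation "K \<equiv> I_ideal C J"
abbreviation "coset z \<equiv> K +>\<^bsub>Z_ring C\<^esub> z"
abbreviation "tensors A B \<equiv> carrier (Z_ring C Quot K) \<times> homs C A B"
abbreviation "rel A B \<equiv> tensor_relations (Z_ring C) (quot_module (Z_ring C) K) (hom_module C A B)"

lemma module_simps [simp]:
  "carrier (quot_module (Z_ring C) K) = carrier (Z_ring C Quot K)"
  "add (quot_module (Z_ring C) K) = add (Z_ring C Quot K)"
  "r \<odot>\<^bsub>quot_module (Z_ring C) K\<^esub> X = coset r \<otimes>\<^bsub>Z_ring C Quot K\<^esub> X"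
  "carrier (hom_module C A B) = homs C A B" "add (hom_module C A B) = hadd C"
  "smult (hom_module C A B) = Z_act C"
  by (simp_all add: quot_module_def hom_module_def)

lemma coset_closed: "z \<in> homs C I I \<Longrightarrow> coset z \<in> carrier (Z_ring C Quot K)"
  by (auto simp: FactRing_def A_RCOSETS_def')

lemma cosetE:
  assumes "s \<in> carrier (Z_ring C Quot K)"
  obtains z where "z \<in> Ar C" "Dom C z = I" "Cod C z = I" "s = coset z"
  using assms by (auto simp: FactRing_def A_RCOSETS_def')

lemma coset_mult:
  assumes "z \<in> homs C I I" "y \<in> homs C I I"
  shows "coset z \<otimes>\<^bsub>Z_ring C Quot K\<^esub> coset y = coset (z \<cdot> y)"
proof -
  interpret ideal K "Z_ring C"
    by (rule I_ideal_ideal)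
  show ?thesis
    using rcoset_mult_add[of z y] assms by (simp add: FactRing_def)
qed

lemma coset_add:
  assumes "z \<in> homs C I I" "y \<in> homs C I I"
  shows "coset z \<oplus>\<^bsub>Z_ring C Quot K\<^esub> coset y = coset (hadd C z y)"
proof -
  interpret ideal K "Z_ring C"
    by (rule I_ideal_ideal)
  show ?thesis
    using a_rcos_sum[of z y] assms by (simp add: FactRing_def)
qed

lemma coset_one: "\<one>\<^bsub>Z_ring C Quot K\<^esub> = coset (idt C I)"
  by (simp add: FactRing_def)

text \<open>\<open>1 - w\<close> is the scalar \<open>i \<cdot> j\<close>, which lies in the
  ideal.\<close>

lemma coset_S:
  assumes "w \<in> S"
  shows "coset w = coset (idt C I)"
proof -
  interpret ideal K "Z_ring C"
    by (rule I_ideal_ideal)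
  obtain i j where ij: "i \<cdot> j \<in> K" "hadd C (i \<cdot> j) w = idt C I"
    using S_elim[OF assms] by blast
  then have "idt C I \<in> coset w"
    by (auto simp: a_r_coset_def' intro!: bexI[of _ "i \<cdot> j"])
  then show ?thesis
    by (rule a_repr_independence) (use assms a_subgroup in auto)
qed

text \<open>Gives \<open>the_elem\<close> in \<open>induced_functor\<close> its meaning: adding an
  element of the ideal does not change the localised scalar.\<close>

lemma Z_map_coset:
  assumes "z \<in> Ar C" "Dom C z = I" "Cod C z = I"
  shows "Z_map Q (serre_loc C J) ` coset z = {loc z}"
proof -
  have 0: "hzero C I I \<in> K"
    by (rule I_ideal_closed)
  have "loc (hadd C k z) = loc z" if k: "k \<in> K" for k
  proof -
    have "hadd C k z \<doteq> hadd C (hzero C I I) z"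
      using k assms eqv_hzero_iff[of k] by (intro eqv_hadd_right) auto
    then show ?thesis
      using k assms loc_eq_iff[of "hadd C k z" z] by simp
  qed
  then have "Z_map Q (serre_loc C J) (hadd C k z) = loc z" if "k \<in> K" for k
    using that assms by (simp add: Z_map_loc)
  then show ?thesis
    using 0 by (auto simp: a_r_coset_def' image_iff)
qed

text \<open>
  \<open>phi A B\<close> is the additive extension to the free abelian group that \<open>induced_functor\<close> evaluates on
  representatives. It turns out that its kernel is exactly \<open>rel A B\<close>.
\<close>

definition val :: "'m set \<times> 'm \<Rightarrow> ('o, 'm) frac" where
  "val = (\<lambda>(s, f). Z_act Q (the_elem (Z_map Q (serre_loc C J) ` s)) (far (serre_loc C J) f))"

definition phi :: "'o \<Rightarrow> 'o \<Rightarrow> ('m set \<times> 'm \<Rightarrow>\<^sub>0 int) \<Rightarrow> ('o, 'm) frac" where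
  "phi A B x = finprod (hom_group Q A B) (\<lambda>p. val p [^]\<^bsub>hom_group Q A B\<^esub> Poly_Mapping.lookup x p)
    (Poly_Mapping.keys x)"

lemma val_coset:
  assumes "z \<in> Ar C" "Dom C z = I" "Cod C z = I" "f \<in> Ar C" "Cod C f = B"
  shows "val (coset z, f) = loc (scal z B \<cdot> f)"
proof -
  have "val (coset z, f) = Z_act Q (loc z) (loc f)"
    using Z_map_coset[OF assms(1-3)] by (simp add: val_def serre_loc_def)
  then show ?thesis
    using assms by (simp add: Q.P_Z_act Z_act_eq_scal)
qed

lemma hom_group_Q_simps:
  "carrier (hom_group Q A B) = homs Q A B" "mult (hom_group Q A B) = hadd Q"
  "one (hom_group Q A B) = loc (hzero C A B)"
  by (simp_all add: hom_group_def)

lemma hom_group_Q: "A \<in> Ob C \<Longrightarrow> B \<in> Ob C \<Longrightarrow> comm_group (hom_group Q A B)"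
  using Q.hom_comm_group_D[of A B] by simp

lemma val_closed:
  assumes "A \<in> Ob C" "B \<in> Ob C" "p \<in> tensors A B"
  shows "val p \<in> carrier (hom_group Q A B)"
proof -
  obtain z f where z: "z \<in> Ar C" "Dom C z = I" "Cod C z = I" and p: "p = (coset z, f)"
    and f: "f \<in> Ar C" "Dom C f = A" "Cod C f = B"
    using assms(3) by (auto elim!: cosetE)
  show ?thesis
    unfolding p val_coset[OF z f(1,3)] hom_group_Q_simps
    by (rule Q.P_homs) (use z f assms in simp_all)
qed

lemma phi_hom:
  assumes "A \<in> Ob C" "B \<in> Ob C"
  shows "phi A B \<in> hom (free_Abelian_group (tensors A B)) (hom_group Q A B)"
proof -
  interpret comm_group "hom_group Q A B"
    by (rule hom_group_Q[OF assms])
  show ?thesis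
    using frag_finprod_hom(1)[of "tensors A B" val] val_closed[OF assms] unfolding phi_def by blast
qed

lemma phi_frag:
  assumes "z \<in> Ar C" "Dom C z = I" "Cod C z = I" "f \<in> Ar C" "Dom C f = A" "Cod C f = B"
  shows "phi A B (frag_of (coset z, f)) = loc (scal z B \<cdot> f)"
proof -
  have AB: "A \<in> Ob C" "B \<in> Ob C"
    using assms by auto
  interpret comm_group "hom_group Q A B"
    by (rule hom_group_Q[OF AB])
  have "(coset z, f) \<in> tensors A B"
    using assms coset_closed by simp
  then have "phi A B (frag_of (coset z, f)) = val (coset z, f)"
    using frag_finprod_hom(2)[of "tensors A B" val] val_closed[OF AB] unfolding phi_def by blast
  then show ?thesis
    using val_coset assms by simp
qed

lemma phi_diff:
  assumes "A \<in> Ob C" "B \<in> Ob C" "Poly_Mapping.keys x \<subseteq> tensors A B" "Poly_Mapping.keys y \<subseteq> tensors A B"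
  shows "phi A B (x - y) = loc (hzero C A B) \<longleftrightarrow> phi A B x = phi A B y"
  using hom_free_Abelian_group_diff(1)[OF comm_group.axioms(2)[OF hom_group_Q] phi_hom, OF assms(1,2,1,2,3,4)]
  by (simp add: hom_group_Q_simps)

text \<open>The generators inside \<open>tensor_relations\<close> with the module operations of this
  case unfolded, named apart so that \<open>generate\<close> can be reasoned about directly.\<close>

definition rel_gens :: "'o \<Rightarrow> 'o \<Rightarrow> ('m set \<times> 'm \<Rightarrow>\<^sub>0 int) set" where
  "rel_gens A B =
     {frag_of (m \<oplus>\<^bsub>Z_ring C Quot K\<^esub> m', n) - frag_of (m, n) - frag_of (m', n) | m m' n.
         m \<in> carrier (Z_ring C Quot K) \<and> m' \<in> carrier (Z_ring C Quot K) \<and> n \<in> homs C A B} \<union>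
      {frag_of (m, hadd C n n') - frag_of (m, n) - frag_of (m, n') | m n n'.
         m \<in> carrier (Z_ring C Quot K) \<and> n \<in> homs C A B \<and> n' \<in> homs C A B} \<union>
      {frag_of (coset r \<otimes>\<^bsub>Z_ring C Quot K\<^esub> m, n) - frag_of (m, Z_act C r n) | r m n.
         r \<in> homs C I I \<and> m \<in> carrier (Z_ring C Quot K) \<and> n \<in> homs C A B}"

lemma rel_gensI:
  assumes "m \<in> carrier (Z_ring C Quot K)" "n \<in> homs C A B"
  shows "n' \<in> homs C A B \<Longrightarrow> frag_of (m, hadd C n n') - frag_of (m, n) - frag_of (m, n') \<in> rel_gens A B"
    and "r \<in> homs C I I \<Longrightarrow>
      frag_of (coset r \<otimes>\<^bsub>Z_ring C Quot K\<^esub> m, n) - frag_of (m, Z_act C r n) \<in> rel_gens A B"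
  using assms unfolding rel_gens_def by blast+

lemma rel_eq: "rel A B = generate (free_Abelian_group (tensors A B)) (rel_gens A B)"
  by (simp add: tensor_relations_def rel_gens_def del: homs_iff)

text \<open>The three kinds of relation hold in the quotient because the action is additive in the
  scalar, composition is additive in the arrow, and scalars commute.\<close>

lemma rel_gens_phi:
  assumes AB [simp]: "A \<in> Ob C" "B \<in> Ob C" and x: "x \<in> rel_gens A B"
  shows "Poly_Mapping.keys x \<subseteq> tensors A B" "phi A B x = loc (hzero C A B)"
proof -
  interpret H: comm_group "hom_group Q A B"
    by (rule hom_group_Q[OF AB])
  have *: "Poly_Mapping.keys (frag_of p - q) \<subseteq> tensors A B \<and> phi A B (frag_of p - q) = loc (hzero C A B)"
    if "p \<in> tensors A B" "Poly_Mapping.keys q \<subseteq> tensors A B" "phi A B (frag_of p) = phi A B q" for p q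
  proof
    show "Poly_Mapping.keys (frag_of p - q) \<subseteq> tensors A B"
      using keys_diff[of "frag_of p" q] that by auto
    show "phi A B (frag_of p - q) = loc (hzero C A B)"
      using phi_diff[OF AB, of "frag_of p" q] that by simp
  qed
  have add: "phi A B (frag_of p + frag_of q) = hadd Q (phi A B (frag_of p)) (phi A B (frag_of q))"
    "Poly_Mapping.keys (frag_of p + frag_of q) \<subseteq> tensors A B" if "p \<in> tensors A B" "q \<in> tensors A B" for p q
  proof -
    show "phi A B (frag_of p + frag_of q) = hadd Q (phi A B (frag_of p)) (phi A B (frag_of q))"
      using hom_mult[OF phi_hom[OF AB], of "frag_of p" "frag_of q"] that by (simp add: hom_group_Q_simps)
    show "Poly_Mapping.keys (frag_of p + frag_of q) \<subseteq> tensors A B"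
      using keys_add[of "frag_of p" "frag_of q"] that by auto
  qed
  \<comment> \<open>Classes of scalars are replaced by representatives, and each relation is
    regrouped as one generator minus an element, the shape handled by the auxiliary fact
    above.\<close>
  consider (1) z z' n where "z \<in> Ar C" "Dom C z = I" "Cod C z = I" "z' \<in> Ar C" "Dom C z' = I" "Cod C z' = I"
      "n \<in> Ar C" "Dom C n = A" "Cod C n = B"
      "x = frag_of (coset (hadd C z z'), n) - (frag_of (coset z, n) + frag_of (coset z', n))"
    | (2) z n n' where "z \<in> Ar C" "Dom C z = I" "Cod C z = I" "n \<in> Ar C" "Dom C n = A" "Cod C n = B"
      "n' \<in> Ar C" "Dom C n' = A" "Cod C n' = B"
      "x = frag_of (coset z, hadd C n n') - (frag_of (coset z, n) + frag_of (coset z, n'))"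
    | (3) r z n where "r \<in> Ar C" "Dom C r = I" "Cod C r = I" "z \<in> Ar C" "Dom C z = I" "Cod C z = I"
      "n \<in> Ar C" "Dom C n = A" "Cod C n = B"
      "x = frag_of (coset (r \<cdot> z), n) - frag_of (coset z, scal r B \<cdot> n)"
    using x unfolding rel_gens_def
    by (elim UnE CollectE exE conjE) (auto elim!: cosetE simp: coset_add coset_mult Z_act_eq_scal diff_diff_eq)
  then have "Poly_Mapping.keys x \<subseteq> tensors A B \<and> phi A B x = loc (hzero C A B)"
  proof cases
    case 1
    then show ?thesis
      unfolding 1(10)
      by (intro * add(2))
        (simp_all add: add coset_closed phi_frag Q.hadd_eq scal_hadd hadd_cmp_simp)
  next
    case 2
    then show ?thesis
      unfolding 2(10)
      by (intro * add(2))
        (simp_all add: add coset_closed phi_frag Q.hadd_eq cmp_hadd_simp)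
  next
    case 3
    have "scal (r \<cdot> z) B = scal z B \<cdot> scal r B"
      using unit_commute[of r z] 3 by (simp add: scal_mult)
    then show ?thesis
      unfolding 3(10) using 3
      by (intro *) (simp_all add: coset_closed phi_frag)
  qed
  then show "Poly_Mapping.keys x \<subseteq> tensors A B" "phi A B x = loc (hzero C A B)"
    by auto
qed

section \<open>The subgroup of relations as the kernel of \<open>phi\<close>\<close>

lemma rel_subgroup:
  assumes "A \<in> Ob C" "B \<in> Ob C"
  shows "subgroup (rel A B) (free_Abelian_group (tensors A B))"
proof -
  interpret G: group "free_Abelian_group (tensors A B)"
    by simp
  show ?thesis
    unfolding rel_eq by (rule G.generate_is_subgroup) (use rel_gens_phi(1)[OF assms] in auto)
qed

lemma rel_closed:
  assumes "A \<in> Ob C" "B \<in> Ob C"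
  shows "0 \<in> rel A B" "x \<in> rel A B \<Longrightarrow> y \<in> rel A B \<Longrightarrow> x + y \<in> rel A B"
    "x \<in> rel A B \<Longrightarrow> - x \<in> rel A B" "x \<in> rel A B \<Longrightarrow> Poly_Mapping.keys x \<subseteq> tensors A B"
    "x \<in> rel_gens A B \<Longrightarrow> x \<in> rel A B"
proof -
  note s = rel_subgroup[OF assms]
  show "0 \<in> rel A B" "x \<in> rel A B \<Longrightarrow> y \<in> rel A B \<Longrightarrow> x + y \<in> rel A B"
    using subgroup.one_closed[OF s] subgroup.m_closed[OF s, of x y] by simp_all
  show k: "x \<in> rel A B \<Longrightarrow> Poly_Mapping.keys x \<subseteq> tensors A B" for x
    using subgroup.mem_carrier[OF s, of x] by simp
  show "x \<in> rel A B \<Longrightarrow> - x \<in> rel A B"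
    using subgroup.m_inv_closed[OF s, of x] k by simp
  show "x \<in> rel_gens A B \<Longrightarrow> x \<in> rel A B"
    unfolding rel_eq by (rule generate.incl)
qed

lemma rel_diff:
  assumes "A \<in> Ob C" "B \<in> Ob C" "x \<in> rel A B" "y \<in> rel A B"
  shows "x - y \<in> rel A B"
  using rel_closed(2)[OF assms(1,2,3) rel_closed(3)[OF assms(1,2,4)]] by simp

lemma rel_phi:
  assumes AB: "A \<in> Ob C" "B \<in> Ob C" and x: "x \<in> rel A B"
  shows "phi A B x = loc (hzero C A B)"
proof -
  interpret G: group "free_Abelian_group (tensors A B)"
    by simp
  interpret H: comm_group "hom_group Q A B"
    by (rule hom_group_Q[OF AB])
  interpret group_hom "free_Abelian_group (tensors A B)" "hom_group Q A B" "phi A B"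
    by unfold_locales (rule phi_hom[OF AB])
  have "rel A B \<subseteq> kernel (free_Abelian_group (tensors A B)) (hom_group Q A B) (phi A B)"
    unfolding rel_eq
    by (rule G.generate_subgroup_incl[OF _ subgroup_kernel])
      (use rel_gens_phi[OF AB] in \<open>auto simp: kernel_def hom_group_Q_simps\<close>)
  then show ?thesis
    using x by (auto simp: kernel_def hom_group_Q_simps)
qed

text \<open>The balancing relation, taken at the class of 1, moves the scalar from the class to the
  arrow.\<close>

lemma rel_scal:
  assumes "z \<in> Ar C" "Dom C z = I" "Cod C z = I" "f \<in> Ar C" "Dom C f = A" "Cod C f = B"
  shows "frag_of (coset z, f) - frag_of (coset (idt C I), scal z B \<cdot> f) \<in> rel A B"
proof -
  have AB: "A \<in> Ob C" "B \<in> Ob C"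
    using assms by auto
  have "frag_of (coset z \<otimes>\<^bsub>Z_ring C Quot K\<^esub> coset (idt C I), f) - frag_of (coset (idt C I), Z_act C z f) \<in> rel_gens A B"
    by (rule rel_gensI(2)) (use assms coset_closed in simp_all)
  from rel_closed(5)[OF AB this] show ?thesis
    using assms by (simp add: coset_mult Z_act_eq_scal)
qed

lemma rel_add:
  assumes "f \<in> Ar C" "Dom C f = A" "Cod C f = B" "g \<in> Ar C" "Dom C g = A" "Cod C g = B"
  shows "frag_of (coset (idt C I), hadd C f g) - frag_of (coset (idt C I), f) - frag_of (coset (idt C I), g) \<in> rel A B"
proof -
  have AB: "A \<in> Ob C" "B \<in> Ob C"
    using assms by auto
  show ?thesis
    by (rule rel_closed(5)[OF AB rel_gensI(1)]) (use assms coset_closed in simp_all)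
qed

text \<open>A pure tensor \<open>[z] \<otimes> f\<close> equals \<open>1 \<otimes> z f\<close>. The
  free group is generated under differences, so the inductive step amounts to
  \<open>1 \<otimes> f - 1 \<otimes> g = 1 \<otimes> (f - g)\<close>.\<close>

lemma tensor_normal_form:
  assumes AB [simp]: "A \<in> Ob C" "B \<in> Ob C" and x: "Poly_Mapping.keys x \<subseteq> tensors A B"
  shows "\<exists>f. f \<in> Ar C \<and> Dom C f = A \<and> Cod C f = B \<and> x - frag_of (coset (idt C I), f) \<in> rel A B"
  using x
proof (rule free_Abelian_group_induct)
  \<comment> \<open>For \<open>0 + 0 = 0\<close> the additivity relation reduces to
    \<open>- (1 \<otimes> 0)\<close>.\<close>
  show "\<exists>f. f \<in> Ar C \<and> Dom C f = A \<and> Cod C f = B \<and> 0 - frag_of (coset (idt C I), f) \<in> rel A B"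
    using rel_add[of "hzero C A B" A B "hzero C A B"] by (intro exI[of _ "hzero C A B"]) simp
next
  fix x y
  assume "\<exists>f. f \<in> Ar C \<and> Dom C f = A \<and> Cod C f = B \<and> x - frag_of (coset (idt C I), f) \<in> rel A B"
    "\<exists>f. f \<in> Ar C \<and> Dom C f = A \<and> Cod C f = B \<and> y - frag_of (coset (idt C I), f) \<in> rel A B"
  then obtain f g where f: "f \<in> Ar C" "Dom C f = A" "Cod C f = B" "x - frag_of (coset (idt C I), f) \<in> rel A B"
    and g: "g \<in> Ar C" "Dom C g = A" "Cod C g = B" "y - frag_of (coset (idt C I), g) \<in> rel A B"
    by blast
  \<comment> \<open>The available relation concerns sums, so \<open>f - g\<close> enters as an arrow
    \<open>h\<close> with \<open>h + g = f\<close>.\<close>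
  define h where "h = hadd C f (hneg g)"
  have h: "h \<in> Ar C" "Dom C h = A" "Cod C h = B" "hadd C h g = f"
    using f g by (simp_all add: h_def hadd_assoc)
  let ?e = "\<lambda>k. frag_of (coset (idt C I), k)"
  have "(x - ?e f) - (y - ?e g) + (?e (hadd C h g) - ?e h - ?e g) \<in> rel A B"
    by (rule rel_closed(2)[OF AB rel_diff[OF AB f(4) g(4)] rel_add]) (use g h in simp_all)
  then have "x - y - ?e h \<in> rel A B"
    by (simp add: h algebra_simps)
  then show "\<exists>f. f \<in> Ar C \<and> Dom C f = A \<and> Cod C f = B \<and> x - y - ?e f \<in> rel A B"
    using h by blast
next
  fix p
  assume "p \<in> tensors A B"
  then obtain z f where "z \<in> Ar C" "Dom C z = I" "Cod C z = I" "f \<in> Ar C" "Dom C f = A" "Cod C f = B"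
    "p = (coset z, f)"
    by (auto elim!: cosetE)
  then show "\<exists>f. f \<in> Ar C \<and> Dom C f = A \<and> Cod C f = B \<and> frag_of p - frag_of (coset (idt C I), f) \<in> rel A B"
    using rel_scal[of z f A B] by (intro exI[of _ "scal z B \<cdot> f"]) simp
qed

lemma phi_one_frag:
  assumes "f \<in> Ar C" "Dom C f = A" "Cod C f = B"
  shows "phi A B (frag_of (coset (idt C I), f)) = loc f" "Poly_Mapping.keys (frag_of (coset (idt C I), f)) \<subseteq> tensors A B"
proof -
  have AB: "A \<in> Ob C" "B \<in> Ob C"
    using assms by auto
  show "phi A B (frag_of (coset (idt C I), f)) = loc f"
    using phi_frag[of "idt C I" f A B] assms AB by simp
  show "Poly_Mapping.keys (frag_of (coset (idt C I), f)) \<subseteq> tensors A B"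
    using assms coset_closed[of "idt C I"] by simp
qed

text \<open>Injectivity is the point. Both arguments reduce to \<open>1 \<otimes> f\<close> and
  \<open>1 \<otimes> g\<close> with \<open>f \<doteq> g\<close>. A \<open>w\<close> with
  \<open>w f = w g\<close> has class 1, so
  \<open>1 \<otimes> f = [w] \<otimes> f = 1 \<otimes> w f\<close>, and likewise for
  \<open>g\<close>.\<close>

lemma rel_iff_phi:
  assumes AB: "A \<in> Ob C" "B \<in> Ob C"
    and x: "Poly_Mapping.keys x \<subseteq> tensors A B" and y: "Poly_Mapping.keys y \<subseteq> tensors A B"
  shows "x - y \<in> rel A B \<longleftrightarrow> phi A B x = phi A B y"
proof
  show "phi A B x = phi A B y" if "x - y \<in> rel A B"
    using rel_phi[OF AB that] phi_diff[OF AB x y] by simp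
  assume eq: "phi A B x = phi A B y"
  let ?e = "\<lambda>k. frag_of (coset (idt C I), k)"
  obtain f where f [simp]: "f \<in> Ar C" "Dom C f = A" "Cod C f = B" and xf: "x - ?e f \<in> rel A B"
    using tensor_normal_form[OF AB x] by blast
  obtain g where g [simp]: "g \<in> Ar C" "Dom C g = A" "Cod C g = B" and yg: "y - ?e g \<in> rel A B"
    using tensor_normal_form[OF AB y] by blast
  have "phi A B x = loc f" "phi A B y = loc g"
    using rel_phi[OF AB xf] phi_diff[OF AB x phi_one_frag(2)] rel_phi[OF AB yg] phi_diff[OF AB y phi_one_frag(2)]
    by (simp_all add: phi_one_frag(1))
  then have "f \<doteq> g"
    using eq loc_eq_iff[of f g] by simp
  then obtain w where w: "w \<in> S" "scal w B \<cdot> f = scal w B \<cdot> g"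
    using eqvD(5)[of f g] by auto
  have fg: "?e f - ?e (scal w B \<cdot> f) \<in> rel A B" "?e g - ?e (scal w B \<cdot> g) \<in> rel A B"
    using rel_scal[of w f A B] rel_scal[of w g A B] w(1) by (simp_all add: coset_S)
  have "(x - ?e f) - (y - ?e g) + ((?e f - ?e (scal w B \<cdot> f)) - (?e g - ?e (scal w B \<cdot> g))) \<in> rel A B"
    by (rule rel_closed(2)[OF AB rel_diff[OF AB xf yg] rel_diff[OF AB fg]])
  then show "x - y \<in> rel A B"
    by (simp add: w(2) algebra_simps)
qed

text \<open>A coset of the relations, described as a fibre of \<open>phi\<close>. Arrows of the base
  change are thereby indexed by arrows of \<open>Q\<close>, and operations on cosets can be
  evaluated in \<open>Q\<close>.\<close>

definition bcl :: "'o \<Rightarrow> 'o \<Rightarrow> ('o, 'm) frac \<Rightarrow> ('m set \<times> 'm \<Rightarrow>\<^sub>0 int) set" where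
  "bcl A B q = {x. Poly_Mapping.keys x \<subseteq> tensors A B \<and> phi A B x = q}"

lemma bc_class_eq:
  assumes AB: "A \<in> Ob C" "B \<in> Ob C" and x: "Poly_Mapping.keys x \<subseteq> tensors A B"
  shows "bc_class C K A B x = bcl A B (phi A B x)"
proof -
  have "y \<in> bc_class C K A B x \<longleftrightarrow> y \<in> bcl A B (phi A B x)" for y
  proof -
    have "y \<in> bc_class C K A B x \<longleftrightarrow> y - x \<in> rel A B"
      unfolding bc_class_def tensor_class_def r_coset_def
      by (auto simp: algebra_simps intro!: bexI[of _ "y - x"])
    also have "\<dots> \<longleftrightarrow> y \<in> bcl A B (phi A B x)"
    proof (cases "Poly_Mapping.keys y \<subseteq> tensors A B")
      case True
      then show ?thesis
        using rel_iff_phi[OF AB True x] by (simp add: bcl_def del: homs_iff)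
    next
      case False
      have "y - x \<notin> rel A B"
      proof
        assume "y - x \<in> rel A B"
        then have "Poly_Mapping.keys (y - x) \<subseteq> tensors A B"
          by (rule rel_closed(4)[OF AB])
        then show False
          using keys_add[of "y - x" x] x False by auto
      qed
      then show ?thesis
        using False by (simp add: bcl_def del: homs_iff)
    qed
    finally show ?thesis .
  qed
  then show ?thesis
    by blast
qed

section \<open>The operations of the base change, computed on fibres\<close>

lemma bc_ar_eq: "f \<in> Ar C \<Longrightarrow> bc_ar C K f = (Dom C f, Cod C f, bcl (Dom C f) (Cod C f) (loc f))"
  unfolding bc_ar_def coset_one using phi_one_frag[of f] bc_class_eq[of "Dom C f" "Cod C f"] by simp

lemma bcl_loc_nonempty:
  assumes "f \<in> Ar C" "Dom C f = A" "Cod C f = B"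
  shows "frag_of (coset (idt C I), f) \<in> bcl A B (loc f)"
  using phi_one_frag[OF assms] by (simp add: bcl_def del: homs_iff)

lemma tensor_product_simps:
  "carrier (tensor_product (Z_ring C) (quot_module (Z_ring C) K) (hom_module C A B)) =
    bc_class C K A B ` {x. Poly_Mapping.keys x \<subseteq> tensors A B}"
  "mult (tensor_product (Z_ring C) (quot_module (Z_ring C) K) (hom_module C A B)) X Y =
    X <#>\<^bsub>free_Abelian_group (tensors A B)\<^esub> Y"
  "one (tensor_product (Z_ring C) (quot_module (Z_ring C) K) (hom_module C A B)) = rel A B"
  by (auto simp: tensor_product_def FactGroup_def RCOSETS_def bc_class_def tensor_class_def simp del: homs_iff)

lemma tensor_product_carrier:
  assumes AB: "A \<in> Ob C" "B \<in> Ob C"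
  shows "carrier (tensor_product (Z_ring C) (quot_module (Z_ring C) K) (hom_module C A B)) =
    (\<lambda>f. bcl A B (loc f)) ` homs C A B"
proof -
  have "\<exists>f\<in>homs C A B. bc_class C K A B x = bcl A B (loc f)" if x: "Poly_Mapping.keys x \<subseteq> tensors A B" for x
  proof -
    obtain f where f: "f \<in> Ar C" "Dom C f = A" "Cod C f = B" "x - frag_of (coset (idt C I), f) \<in> rel A B"
      using tensor_normal_form[OF AB x] by blast
    then have "phi A B x = loc f"
      using rel_iff_phi[OF AB x phi_one_frag(2)] by (simp add: phi_one_frag(1))
    then show ?thesis
      using f bc_class_eq[OF AB x] by auto
  qed
  moreover have "\<exists>x. Poly_Mapping.keys x \<subseteq> tensors A B \<and> bcl A B (loc f) = bc_class C K A B x" if "f \<in> homs C A B" for f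
  proof -
    have f: "f \<in> Ar C" "Dom C f = A" "Cod C f = B"
      using that by auto
    show ?thesis
      using phi_one_frag[OF f] bc_class_eq[OF AB phi_one_frag(2)[OF f]] by metis
  qed
  ultimately show ?thesis
    unfolding tensor_product_simps by blast
qed

lemma rel_eq_bcl:
  assumes AB: "A \<in> Ob C" "B \<in> Ob C"
  shows "rel A B = bcl A B (loc (hzero C A B))"
proof -
  have "phi A B 0 = loc (hzero C A B)"
    using rel_phi[OF AB rel_closed(1)[OF AB]] .
  moreover have "x \<in> rel A B \<longleftrightarrow> x \<in> bcl A B (phi A B 0)" for x
  proof
    show "x \<in> bcl A B (phi A B 0)" if "x \<in> rel A B"
      using that rel_phi[OF AB that] rel_closed(4)[OF AB that] calculation by (simp add: bcl_def del: homs_iff)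
    show "x \<in> rel A B" if "x \<in> bcl A B (phi A B 0)"
      using that rel_iff_phi[OF AB, of x 0] by (simp add: bcl_def del: homs_iff)
  qed
  ultimately show ?thesis
    by auto
qed

text \<open>Additivity of \<open>phi\<close> gives one inclusion. For the other, an \<open>x\<close>
  over the sum is split as \<open>(x - y) + y\<close> with \<open>y\<close> the standard
  representative of \<open>g\<close>.\<close>

lemma bcl_add:
  assumes f: "f \<in> Ar C" "Dom C f = A" "Cod C f = B" and g: "g \<in> Ar C" "Dom C g = A" "Cod C g = B"
  shows "bcl A B (loc f) <#>\<^bsub>free_Abelian_group (tensors A B)\<^esub> bcl A B (loc g) = bcl A B (loc (hadd C f g))"
proof -
  have AB: "A \<in> Ob C" "B \<in> Ob C"
    using f by auto
  have add: "Poly_Mapping.keys (x + y) \<subseteq> tensors A B" "phi A B (x + y) = hadd Q (phi A B x) (phi A B y)"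
    if "Poly_Mapping.keys x \<subseteq> tensors A B" "Poly_Mapping.keys y \<subseteq> tensors A B" for x y
    using hom_mult[OF phi_hom[OF AB], of x y] keys_add[of x y] that by (auto simp: hom_group_Q_simps)
  have l: "loc (hadd C f g) = hadd Q (loc f) (loc g)"
    using f g by (simp add: Q.hadd_eq)
  show ?thesis
  proof
    show "bcl A B (loc f) <#>\<^bsub>free_Abelian_group (tensors A B)\<^esub> bcl A B (loc g) \<subseteq> bcl A B (loc (hadd C f g))"
      unfolding l set_mult_def using add by (auto simp: bcl_def simp del: homs_iff)
    show "bcl A B (loc (hadd C f g)) \<subseteq> bcl A B (loc f) <#>\<^bsub>free_Abelian_group (tensors A B)\<^esub> bcl A B (loc g)"
    proof
      fix x
      let ?y = "frag_of (coset (idt C I), g)"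
      assume "x \<in> bcl A B (loc (hadd C f g))"
      then have x: "Poly_Mapping.keys x \<subseteq> tensors A B" "phi A B x = loc (hadd C f g)"
        by (auto simp: bcl_def simp del: homs_iff)
      have y: "Poly_Mapping.keys ?y \<subseteq> tensors A B" "phi A B ?y = loc g"
        using phi_one_frag[OF g] by auto
      have "phi A B (frag_of (coset (idt C I), f) + ?y) = phi A B x"
        using add(2)[OF phi_one_frag(2)[OF f] y(1)] x phi_one_frag(1)[OF f] y l by simp
      then have "x - (frag_of (coset (idt C I), f) + ?y) \<in> rel A B"
        using rel_iff_phi[OF AB x(1) add(1)[OF phi_one_frag(2)[OF f] y(1)]] by simp
      then have "(x - ?y) - frag_of (coset (idt C I), f) \<in> rel A B"
        by (simp add: algebra_simps)
      moreover have xy: "Poly_Mapping.keys (x - ?y) \<subseteq> tensors A B"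
        using keys_diff[of x ?y] x y by blast
      ultimately have xin: "x - ?y \<in> bcl A B (loc f)"
        using rel_iff_phi[OF AB xy phi_one_frag(2)[OF f]] phi_one_frag(1)[OF f] by (simp add: bcl_def del: homs_iff)
      show "x \<in> bcl A B (loc f) <#>\<^bsub>free_Abelian_group (tensors A B)\<^esub> bcl A B (loc g)"
        unfolding set_mult_def by (rule UN_I[OF xin UN_I[OF bcl_loc_nonempty[OF g]]]) simp
    qed
  qed
qed

text \<open>The fibres are nonempty and every pair of representatives yields the same class, so the
  unions in \<open>base_change\<close> collapse.\<close>

lemma UN_bcl:
  assumes AB: "A \<in> Ob C" "B \<in> Ob C" and "f \<in> Ar C" "Dom C f = A'" "Cod C f = B'" "g \<in> Ar C" "Dom C g = A''" "Cod C g = B''"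
    and m: "\<And>x y. x \<in> bcl A' B' (loc f) \<Longrightarrow> y \<in> bcl A'' B'' (loc g) \<Longrightarrow>
      Poly_Mapping.keys (m x y) \<subseteq> tensors A B \<and> phi A B (m x y) = q"
  shows "(\<Union>x\<in>bcl A' B' (loc f). \<Union>y\<in>bcl A'' B'' (loc g). bc_class C K A B (m x y)) = bcl A B q"
proof -
  have "bc_class C K A B (m x y) = bcl A B q" if "x \<in> bcl A' B' (loc f)" "y \<in> bcl A'' B'' (loc g)" for x y
    using m[OF that] bc_class_eq[OF AB] by auto
  then show ?thesis
    using bcl_loc_nonempty[of f A' B'] bcl_loc_nonempty[of g A'' B''] assms(3-8) by blast
qed

text \<open>Composition in \<open>Q\<close> is biadditive, so \<open>hom_frag_bilinear\<close>
  reduces the claim to pure tensors, where naturality lets the inner scalar slide past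
  \<open>h\<close>.\<close>

lemma bcl_cmp:
  assumes f: "f \<in> Ar C" "Dom C f = A" "Cod C f = B" and g: "g \<in> Ar C" "Dom C g = B" "Cod C g = D"
  shows "(\<Union>y\<in>bcl B D (loc g). \<Union>x\<in>bcl A B (loc f). bc_class C K A D
       (frag_bilinear (\<lambda>(t, g) (s, f). (t \<otimes>\<^bsub>Z_ring C Quot K\<^esub> s, g \<cdot> f)) y x)) = bcl A D (loc (g \<cdot> f))"
proof (rule UN_bcl)
  show A [simp]: "A \<in> Ob C" "D \<in> Ob C"
    using f g by auto
  have B [simp]: "B \<in> Ob C"
    using f by auto
  interpret Qc: tensor_category Q
    by (rule Q.tensor_category_D)
  let ?\<mu> = "\<lambda>(t, g) (s, f). (t \<otimes>\<^bsub>Z_ring C Quot K\<^esub> s, g \<cdot> f)"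
  fix y x
  assume "y \<in> bcl B D (loc g)" "x \<in> bcl A B (loc f)"
  then have y: "Poly_Mapping.keys y \<subseteq> tensors B D" "phi B D y = loc g"
    and x: "Poly_Mapping.keys x \<subseteq> tensors A B" "phi A B x = loc f"
    by (auto simp: bcl_def simp del: homs_iff)
  have gen: "?\<mu> p q \<in> tensors A D \<and> phi A D (frag_of (?\<mu> p q)) = phi B D (frag_of p) \<cdot>\<^bsub>Q\<^esub> phi A B (frag_of q)"
    if p: "p \<in> tensors B D" and q: "q \<in> tensors A B" for p q
  proof -
    obtain z h where z [simp]: "z \<in> Ar C" "Dom C z = I" "Cod C z = I" "h \<in> Ar C" "Dom C h = B" "Cod C h = D"
      and p': "p = (coset z, h)"
      using p by (auto elim!: cosetE)
    obtain z' k where z' [simp]: "z' \<in> Ar C" "Dom C z' = I" "Cod C z' = I" "k \<in> Ar C" "Dom C k = A" "Cod C k = B"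
      and q': "q = (coset z', k)"
      using q by (auto elim!: cosetE)
    have "h \<cdot> (scal z' B \<cdot> k) = scal z' D \<cdot> (h \<cdot> k)"
      by (simp add: scal_nat_reassoc)
    then show ?thesis
      unfolding p' q' by (simp add: coset_mult coset_closed phi_frag Q.cmp_eq scal_mult)
  qed
  note bil = hom_frag_bilinear[OF comm_group.axioms(2)[OF hom_group_Q[OF A]] phi_hom[OF A] phi_hom[OF B A(2)]
      phi_hom[OF A(1) B], where b = "Cmp Q" and \<mu> = ?\<mu>, OF _ _ conjunct1[OF gen] conjunct2[OF gen] y(1) x(1)]
  have b1: "Cmp Q a \<in> hom (hom_group Q A B) (hom_group Q A D)" if "a \<in> carrier (hom_group Q B D)" for a
  proof (rule homI)
    fix u v
    assume "u \<in> carrier (hom_group Q A B)" "v \<in> carrier (hom_group Q A B)"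
    then have uv: "u \<in> homs Q A B" "v \<in> homs Q A B" and a: "a \<in> homs Q B D"
      using that unfolding hom_group_Q_simps by blast+
    show "a \<cdot>\<^bsub>Q\<^esub> u \<in> carrier (hom_group Q A D)"
      unfolding hom_group_Q_simps by (rule Qc.cmp_closed[OF uv(1) a])
    show "a \<cdot>\<^bsub>Q\<^esub> (u \<otimes>\<^bsub>hom_group Q A B\<^esub> v) = (a \<cdot>\<^bsub>Q\<^esub> u) \<otimes>\<^bsub>hom_group Q A D\<^esub> (a \<cdot>\<^bsub>Q\<^esub> v)"
      unfolding hom_group_Q_simps by (rule Qc.cmp_hadd[OF uv a])
  qed
  have b2: "(\<lambda>a. a \<cdot>\<^bsub>Q\<^esub> c) \<in> hom (hom_group Q B D) (hom_group Q A D)" if "c \<in> carrier (hom_group Q A B)" for c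
  proof (rule homI)
    fix u v
    assume "u \<in> carrier (hom_group Q B D)" "v \<in> carrier (hom_group Q B D)"
    then have uv: "u \<in> homs Q B D" "v \<in> homs Q B D" and c: "c \<in> homs Q A B"
      using that unfolding hom_group_Q_simps by blast+
    show "u \<cdot>\<^bsub>Q\<^esub> c \<in> carrier (hom_group Q A D)"
      unfolding hom_group_Q_simps by (rule Qc.cmp_closed[OF c uv(1)])
    show "(u \<otimes>\<^bsub>hom_group Q B D\<^esub> v) \<cdot>\<^bsub>Q\<^esub> c = (u \<cdot>\<^bsub>Q\<^esub> c) \<otimes>\<^bsub>hom_group Q A D\<^esub> (v \<cdot>\<^bsub>Q\<^esub> c)"
      unfolding hom_group_Q_simps by (rule Qc.hadd_cmp[OF c uv])
  qed
  show "Poly_Mapping.keys (frag_bilinear ?\<mu> y x) \<subseteq> tensors A D \<and> phi A D (frag_bilinear ?\<mu> y x) = loc (g \<cdot> f)"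
    using bil[OF b1 b2] f g by (simp add: x y Q.cmp_eq del: homs_iff)
qed (use f g in simp_all)

text \<open>As for composition, with the scalars of the two factors collected by
  \<open>scal_tensor\<close>.\<close>

lemma bcl_tar:
  assumes f: "f \<in> Ar C" "Dom C f = A" "Cod C f = A'" and g: "g \<in> Ar C" "Dom C g = B" "Cod C g = B'"
  shows "(\<Union>x\<in>bcl A A' (loc f). \<Union>y\<in>bcl B B' (loc g). bc_class C K (A \<otimes>\<^sub>o B) (A' \<otimes>\<^sub>o B')
       (frag_bilinear (\<lambda>(s, f) (t, g). (s \<otimes>\<^bsub>Z_ring C Quot K\<^esub> t, f \<otimes>\<^sub>a g)) x y)) =
    bcl (A \<otimes>\<^sub>o B) (A' \<otimes>\<^sub>o B') (loc (f \<otimes>\<^sub>a g))"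
proof (rule UN_bcl)
  have A [simp]: "A \<in> Ob C" "A' \<in> Ob C" and B [simp]: "B \<in> Ob C" "B' \<in> Ob C"
    using f g by auto
  show AB: "A \<otimes>\<^sub>o B \<in> Ob C" "A' \<otimes>\<^sub>o B' \<in> Ob C"
    by simp_all
  interpret Qc: tensor_category Q
    by (rule Q.tensor_category_D)
  let ?\<mu> = "\<lambda>(s, f) (t, g). (s \<otimes>\<^bsub>Z_ring C Quot K\<^esub> t, f \<otimes>\<^sub>a g)"
  fix x y
  assume "x \<in> bcl A A' (loc f)" "y \<in> bcl B B' (loc g)"
  then have y: "Poly_Mapping.keys y \<subseteq> tensors B B'" "phi B B' y = loc g"
    and x: "Poly_Mapping.keys x \<subseteq> tensors A A'" "phi A A' x = loc f"
    by (auto simp: bcl_def simp del: homs_iff)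
  have gen: "?\<mu> p q \<in> tensors (A \<otimes>\<^sub>o B) (A' \<otimes>\<^sub>o B') \<and>
      phi (A \<otimes>\<^sub>o B) (A' \<otimes>\<^sub>o B') (frag_of (?\<mu> p q)) = phi A A' (frag_of p) \<otimes>\<^sub>a\<^bsub>Q\<^esub> phi B B' (frag_of q)"
    if p: "p \<in> tensors A A'" and q: "q \<in> tensors B B'" for p q
  proof -
    obtain z h where z [simp]: "z \<in> Ar C" "Dom C z = I" "Cod C z = I" "h \<in> Ar C" "Dom C h = A" "Cod C h = A'"
      and p': "p = (coset z, h)"
      using p by (auto elim!: cosetE)
    obtain z' k where z' [simp]: "z' \<in> Ar C" "Dom C z' = I" "Cod C z' = I" "k \<in> Ar C" "Dom C k = B" "Cod C k = B'"
      and q': "q = (coset z', k)"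
      using q by (auto elim!: cosetE)
    have "scal (z \<cdot> z') (A' \<otimes>\<^sub>o B') = scal z A' \<otimes>\<^sub>a scal z' B'"
      by (simp add: scal_mult scal_tensor(1)[of z] scal_tensor(2)[of z'] tar_merge)
    then show ?thesis
      unfolding p' q' by (simp add: coset_mult coset_closed phi_frag Q.tar_eq tar_merge)
  qed
  note bil = hom_frag_bilinear[OF comm_group.axioms(2)[OF hom_group_Q[OF AB]] phi_hom[OF AB] phi_hom[OF A]
      phi_hom[OF B], where b = "tar Q" and \<mu> = ?\<mu>, OF _ _ conjunct1[OF gen] conjunct2[OF gen] x(1) y(1)]
  have b1: "tar Q a \<in> hom (hom_group Q B B') (hom_group Q (A \<otimes>\<^sub>o B) (A' \<otimes>\<^sub>o B'))" if "a \<in> carrier (hom_group Q A A')" for a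
  proof (rule homI)
    fix u v
    assume "u \<in> carrier (hom_group Q B B')" "v \<in> carrier (hom_group Q B B')"
    then have uv: "u \<in> homs Q B B'" "v \<in> homs Q B B'" and a: "a \<in> homs Q A A'"
      using that unfolding hom_group_Q_simps by blast+
    show "a \<otimes>\<^sub>a\<^bsub>Q\<^esub> u \<in> carrier (hom_group Q (A \<otimes>\<^sub>o B) (A' \<otimes>\<^sub>o B'))"
      using Qc.tar_closed[OF a uv(1)] by (simp add: hom_group_Q_simps)
    show "a \<otimes>\<^sub>a\<^bsub>Q\<^esub> (u \<otimes>\<^bsub>hom_group Q B B'\<^esub> v) =
        a \<otimes>\<^sub>a\<^bsub>Q\<^esub> u \<otimes>\<^bsub>hom_group Q (A \<otimes>\<^sub>o B) (A' \<otimes>\<^sub>o B')\<^esub> a \<otimes>\<^sub>a\<^bsub>Q\<^esub> v"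
      unfolding hom_group_Q_simps by (rule Qc.tar_hadd_right[OF a uv])
  qed
  have b2: "(\<lambda>a. a \<otimes>\<^sub>a\<^bsub>Q\<^esub> c) \<in> hom (hom_group Q A A') (hom_group Q (A \<otimes>\<^sub>o B) (A' \<otimes>\<^sub>o B'))"
    if "c \<in> carrier (hom_group Q B B')" for c
  proof (rule homI)
    fix u v
    assume "u \<in> carrier (hom_group Q A A')" "v \<in> carrier (hom_group Q A A')"
    then have uv: "u \<in> homs Q A A'" "v \<in> homs Q A A'" and c: "c \<in> homs Q B B'"
      using that unfolding hom_group_Q_simps by blast+
    show "u \<otimes>\<^sub>a\<^bsub>Q\<^esub> c \<in> carrier (hom_group Q (A \<otimes>\<^sub>o B) (A' \<otimes>\<^sub>o B'))"
      using Qc.tar_closed[OF uv(1) c] by (simp add: hom_group_Q_simps)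
    show "(u \<otimes>\<^bsub>hom_group Q A A'\<^esub> v) \<otimes>\<^sub>a\<^bsub>Q\<^esub> c =
        u \<otimes>\<^sub>a\<^bsub>Q\<^esub> c \<otimes>\<^bsub>hom_group Q (A \<otimes>\<^sub>o B) (A' \<otimes>\<^sub>o B')\<^esub> v \<otimes>\<^sub>a\<^bsub>Q\<^esub> c"
      unfolding hom_group_Q_simps by (rule Qc.tar_hadd_left[OF uv c])
  qed
  show "Poly_Mapping.keys (frag_bilinear ?\<mu> x y) \<subseteq> tensors (A \<otimes>\<^sub>o B) (A' \<otimes>\<^sub>o B') \<and>
      phi (A \<otimes>\<^sub>o B) (A' \<otimes>\<^sub>o B') (frag_bilinear ?\<mu> x y) = loc (f \<otimes>\<^sub>a g)"
    using bil[OF b1 b2] f g by (simp add: x y Q.tar_eq del: homs_iff)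
qed (use f g in simp_all)

lemma tensor_quotient_base_change: "tensor_quotient C (base_change C K) (bc_ar C K)"
proof (intro tensor_quotient.intro tensor_quotient_axioms.intro)
  show "homs (base_change C K) A B = bc_ar C K ` homs C A B" if AB: "A \<in> Ob C" "B \<in> Ob C" for A B
  proof -
    have "homs (base_change C K) A B = (\<lambda>X. (A, B, X)) `
        carrier (tensor_product (Z_ring C) (quot_module (Z_ring C) K) (hom_module C A B))"
      using AB by (auto simp: base_change_def)
    also have "\<dots> = bc_ar C K ` homs C A B"
      unfolding tensor_product_carrier[OF AB] image_image by (rule image_cong) (auto simp: bc_ar_eq)
    finally show ?thesis .
  qed
  show "Dom (base_change C K) y \<in> Ob C \<and> Cod (base_change C K) y \<in> Ob C" if "y \<in> Ar (base_change C K)" for y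
    using that by (auto simp: base_change_def)
  show "bc_ar C K g \<cdot>\<^bsub>base_change C K\<^esub> bc_ar C K f = bc_ar C K (g \<cdot> f)"
    if "f \<in> Ar C" "g \<in> Ar C" "Dom C g = Cod C f" for f g
    using that bcl_cmp[of f _ _ g] by (simp add: bc_ar_eq base_change_def)
  show "hzero (base_change C K) A B = bc_ar C K (hzero C A B)" if "A \<in> Ob C" "B \<in> Ob C" for A B
    using that rel_eq_bcl by (simp add: bc_ar_eq base_change_def tensor_product_simps)
  show "hadd (base_change C K) (bc_ar C K f) (bc_ar C K g) = bc_ar C K (hadd C f g)"
    if "f \<in> Ar C" "g \<in> Ar C" "Dom C g = Dom C f" "Cod C g = Cod C f" for f g
    using that bcl_add[of f _ _ g] by (simp add: bc_ar_eq base_change_def tensor_product_simps del: homs_iff)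
  show "bc_ar C K f \<otimes>\<^sub>a\<^bsub>base_change C K\<^esub> bc_ar C K g = bc_ar C K (f \<otimes>\<^sub>a g)" if "f \<in> Ar C" "g \<in> Ar C" for f g
    using that bcl_tar[of f _ _ g] by (simp add: bc_ar_eq base_change_def)
qed (simp_all add: base_change_def tensor_category_axioms)

text \<open>The function evaluated under \<open>the_elem\<close> is \<open>phi\<close>, which is
  constant on its own nonempty fibre.\<close>

lemma induced_functor_bc_ar:
  assumes f: "f \<in> Ar C"
  shows "far (induced_functor C Q (serre_loc C J)) (bc_ar C K f) = loc f"
proof -
  let ?A = "Dom C f" and ?B = "Cod C f"
  have "far (induced_functor C Q (serre_loc C J)) (bc_ar C K f) = the_elem (phi ?A ?B ` bcl ?A ?B (loc f))"
    unfolding bc_ar_eq[OF f] induced_functor_def phi_def val_def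
    by (simp add: case_prod_unfold serre_loc_def)
  also have "phi ?A ?B ` bcl ?A ?B (loc f) = (\<lambda>_. loc f) ` bcl ?A ?B (loc f)"
    by (rule image_cong) (simp_all add: bcl_def del: homs_iff)
  also have "\<dots> = {loc f}"
    by (rule image_constant[OF bcl_loc_nonempty[OF f refl refl]])
  finally show ?thesis
    by simp
qed

text \<open>\<open>bc_ar\<close> identifies whatever \<open>loc\<close> identifies, since the fibre
  \<open>bcl\<close> depends on \<open>f\<close> only through its endpoints and
  \<open>loc f\<close>; the general comparison of two quotients of \<open>C\<close> then
  applies.\<close>

lemma induced_functor_equivalence:
  "tensor_equivalence (base_change C K) Q (induced_functor C Q (serre_loc C J))"
proof (rule tensor_quotient_equivalence[OF tensor_quotient_base_change tensor_quotient_Q])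
  show "bc_ar C K f = bc_ar C K g"
    if "f \<in> Ar C" "g \<in> Ar C" "Dom C f = Dom C g" "Cod C f = Cod C g" "loc f = loc g" for f g
    using that by (simp add: bc_ar_eq)
  show "far (induced_functor C Q (serre_loc C J)) (bc_ar C K f) = loc f" if "f \<in> Ar C" for f
    by (rule induced_functor_bc_ar[OF that])
qed (simp_all add: induced_functor_def serre_loc_def)

end

theorem theorem4p21:
  fixes \<A> :: "('o, 'm) tensor_cat" and \<I> :: "'o set"
  assumes "rigid_abelian_tensor_category \<A>"
    and "serre_tensor_ideal \<A> \<I>"
  defines "Q \<equiv> serre_quotient \<A> \<I>"
    and "F \<equiv> serre_loc \<A> \<I>"
  shows "a_kernel (Z_ring \<A>) (Z_ring Q) (Z_map Q F) = I_ideal \<A> \<I> \<and>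
    tensor_equivalence (base_change \<A> (I_ideal \<A> \<I>)) Q (induced_functor \<A> Q F) \<and>
    full_functor \<A> Q F"
proof -
  interpret serre_ideal \<A> \<I>
    using assms(1,2) by (intro serre_ideal.intro serre_ideal_axioms.intro)
  show ?thesis
    unfolding Q_def F_def using Z_map_kernel induced_functor_equivalence serre_loc_full by blast
qed

end
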